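(* Let $C$ be an algebraically closed field of characteristic zero, $k=C(x)$, and let $(\sigma_1,\sigma_2)$ be as in one of the cases 2S, 2Q, 2M described in the context. Let $B_1,B_2\in \mathrm{GL}_n(k)$ satisfy the consistency condition $\sigma_1(B_2)B_1=\sigma_2(B_1)B_2$. In cases 2S and 2Q, the system $\sigma_j(Y)=B_jY$, $j=1,2$, is equivalent over $k$ to a system $\sigma_j(Z)=\tilde B_jZ$, $j=1,2$, with constant invertible commuting $\tilde B_j$, that is, $\tilde B_j\in \mathrm{GL}_n(C)$, $j=1,2$, and $\tilde B_2\tilde B_1=\tilde B_1\tilde B_2$. In case 2M, the system $\sigma_j(Y)=B_jY$, $j=1,2$, is equivalent over $K=C(\{x^{1/s}\mid s\in\mathbb{N}^*\})$ to a system $\sigma_j(Z)=\tilde B_jZ$, $j=1,2$, with constant invertible commuting $\tilde B_1,\tilde B_2\in \mathrm{GL}_n(C)$.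
   Context: Cases ($\sigma_1,\sigma_2$ are commuting $C$-algebra endomorphisms of $k$, acting entrywise on matrices): - Case 2S: $\sigma_1(x)=x+1$, $\sigma_2(x)=x+\alpha$ with $\alpha\in C\setminus\mathbb{Q}$. - Case 2Q: $C\subset\mathbb{C}$, $\sigma_j(x)=q_jx$ with $q_1,q_2\in C$ nonzero, not roots of unity, multiplicatively independent (there are no nonzero integers $n_1,n_2$ with $q_2^{n_2}=q_1^{n_1}$), and at least one of the $q_j$ does not have modulus 1 (labelled so that $|q_1|\neq1$). - Case 2M: $\sigma_j(x)=x^{q_j}$ with multiplicatively independent integers $q_1,q_2\ge 2$; $\sigma_j$ is extended to the field $K$ of all fractional powers of $x$ by $\sigma_j(x^{a})=x^{q_ja}$ for $a\in\mathbb{Q}$. For a field $F\in\{k,K\}$, the system $\sigma_j(Y)=B_jY$ ($j=1,2$) is equivalent over $F$ to $\sigma_j(Z)=\tilde B_jZ$ ($j=1,2$) if there is $G\in \mathrm{GL}_n(F)$ with $\tilde B_j=\sigma_j(G)B_jG^{-1}$ for $j=1,2$ (gauge transformation $Z=GY$). *)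

theory Defs
  imports
    "HOL-Analysis.Analysis"
    "HOL-Computational_Algebra.Polynomial_Factorial"
    "HOL-Library.Poly_Mapping"
begin

section \<open>The fields \<open>k\<close> and \<open>K\<close>\<close>

type_synonym 'c ratfun = "'c poly fract"

text \<open>
  \<open>K = C({x^(1/s) | s \<ge> 1})\<close> is realised as the fraction field of the group algebra of
  \<open>(\<rat>, +)\<close> over \<open>C\<close>, whose elements are the finite sums \<open>\<Sum> c\<^sub>a x^a\<close> with rational
  exponents \<open>a\<close>.
\<close>
type_synonym 'c fpfun = "(rat \<Rightarrow>\<^sub>0 'c) fract"

definition k_const :: "'c::field \<Rightarrow> 'c ratfun"
  where "k_const c = to_fract [:c:]"

definition k_var :: "'c::field ratfun"
  where "k_var = to_fract [:0, 1:]"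

definition K_const :: "'c::field \<Rightarrow> 'c fpfun"
  where "K_const c = to_fract (Poly_Mapping.single 0 c)"

definition K_pow :: "rat \<Rightarrow> 'c::field fpfun"
  where "K_pow a = to_fract (Poly_Mapping.single a 1)"

definition field_hom :: "('a::field \<Rightarrow> 'b::field) \<Rightarrow> bool"
  where "field_hom h \<longleftrightarrow>
    h 1 = 1 \<and> (\<forall>a b. h (a + b) = h a + h b) \<and> (\<forall>a b. h (a * b) = h a * h b)"

text \<open>The first two arguments are the structure maps of the two \<open>C\<close>-algebras.\<close>
definition C_alg_hom ::
    "('c::field \<Rightarrow> 'a::field) \<Rightarrow> ('c \<Rightarrow> 'b::field) \<Rightarrow> ('a \<Rightarrow> 'b) \<Rightarrow> bool"
  where "C_alg_hom cA cB h \<longleftrightarrow> field_hom h \<and> (\<forall>c. h (cA c) = cB c)"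

text \<open>
  Extension to the fraction field. The description is only meaningful if \<open>h\<close> is an injective
  ring homomorphism, as in \<open>fract_ext_Fract\<close> below.
\<close>
definition fract_ext :: "('r::idom \<Rightarrow> 'l::field) \<Rightarrow> 'r fract \<Rightarrow> 'l"
  where "fract_ext h f = (THE v. \<exists>a b. b \<noteq> 0 \<and> f = Fract a b \<and> v = h a / h b)"

text \<open>The inclusion of \<open>k\<close> in \<open>K\<close>, i.e. \<open>f \<mapsto> f(x^1)\<close>.\<close>
definition k_to_K :: "'c::field ratfun \<Rightarrow> 'c fpfun"
  where "k_to_K = fract_ext (\<lambda>p. poly (map_poly K_const p) (K_pow 1))"


section \<open>The three cases\<close>

definition mult_independent :: "'a::field \<Rightarrow> 'a \<Rightarrow> bool"
  where "mult_independent q1 q2 \<longleftrightarrow>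
    \<not> (\<exists>n1 n2 :: int. n1 \<noteq> 0 \<and> n2 \<noteq> 0 \<and> q2 powi n2 = q1 powi n1)"

definition root_of_unity :: "'a::field \<Rightarrow> bool"
  where "root_of_unity q \<longleftrightarrow> (\<exists>m::nat. m > 0 \<and> q ^ m = 1)"

definition commuting_endos :: "('c::field ratfun \<Rightarrow> 'c ratfun) \<Rightarrow> ('c ratfun \<Rightarrow> 'c ratfun) \<Rightarrow> bool"
  where "commuting_endos \<sigma>1 \<sigma>2 \<longleftrightarrow>
    C_alg_hom k_const k_const \<sigma>1 \<and> C_alg_hom k_const k_const \<sigma>2 \<and> \<sigma>1 \<circ> \<sigma>2 = \<sigma>2 \<circ> \<sigma>1"

text \<open>A \<open>C\<close>-algebra endomorphism of \<open>k = C(x)\<close> is determined by its value at \<open>x\<close>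
  (\<open>C_alg_hom_k_unique\<close> below).\<close>
definition case_2S ::
    "('c::field_char_0 ratfun \<Rightarrow> 'c ratfun) \<Rightarrow> ('c ratfun \<Rightarrow> 'c ratfun) \<Rightarrow> bool"
  where "case_2S \<sigma>1 \<sigma>2 \<longleftrightarrow>
    commuting_endos \<sigma>1 \<sigma>2 \<and>
    \<sigma>1 k_var = k_var + 1 \<and>
    (\<exists>\<alpha>. \<alpha> \<notin> \<rat> \<and> \<sigma>2 k_var = k_var + k_const \<alpha>)"

text \<open>
  The inclusion of \<open>C\<close> in the complex numbers is given by a field homomorphism \<open>\<iota>\<close>.
\<close>
definition case_2Q ::
    "('c::field_char_0 ratfun \<Rightarrow> 'c ratfun) \<Rightarrow> ('c ratfun \<Rightarrow> 'c ratfun) \<Rightarrow> bool"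
  where "case_2Q \<sigma>1 \<sigma>2 \<longleftrightarrow>
    commuting_endos \<sigma>1 \<sigma>2 \<and>
    (\<exists>(\<iota> :: 'c \<Rightarrow> complex) q1 q2.
       field_hom \<iota> \<and> q1 \<noteq> 0 \<and> q2 \<noteq> 0 \<and>
       \<not> root_of_unity q1 \<and> \<not> root_of_unity q2 \<and>
       mult_independent q1 q2 \<and> cmod (\<iota> q1) \<noteq> 1 \<and>
       \<sigma>1 k_var = k_const q1 * k_var \<and> \<sigma>2 k_var = k_const q2 * k_var)"

text \<open>\<open>\<tau>1\<close>, \<open>\<tau>2\<close> are the extensions of \<open>\<sigma>1\<close>, \<open>\<sigma>2\<close> from \<open>k\<close> to \<open>K\<close>.\<close>
definition case_2M ::
    "('c::field_char_0 ratfun \<Rightarrow> 'c ratfun) \<Rightarrow> ('c ratfun \<Rightarrow> 'c ratfun) \<Rightarrow>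
     ('c fpfun \<Rightarrow> 'c fpfun) \<Rightarrow> ('c fpfun \<Rightarrow> 'c fpfun) \<Rightarrow> bool"
  where "case_2M \<sigma>1 \<sigma>2 \<tau>1 \<tau>2 \<longleftrightarrow>
    commuting_endos \<sigma>1 \<sigma>2 \<and>
    C_alg_hom K_const K_const \<tau>1 \<and> C_alg_hom K_const K_const \<tau>2 \<and>
    (\<forall>f. \<tau>1 (k_to_K f) = k_to_K (\<sigma>1 f)) \<and> (\<forall>f. \<tau>2 (k_to_K f) = k_to_K (\<sigma>2 f)) \<and>
    (\<exists>q1 q2 :: nat. q1 \<ge> 2 \<and> q2 \<ge> 2 \<and>
       mult_independent (of_nat q1 :: rat) (of_nat q2) \<and>
       \<sigma>1 k_var = k_var ^ q1 \<and> \<sigma>2 k_var = k_var ^ q2 \<and>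
       (\<forall>a. \<tau>1 (K_pow a) = K_pow (of_nat q1 * a)) \<and>
       (\<forall>a. \<tau>2 (K_pow a) = K_pow (of_nat q2 * a)))"


section \<open>Gauge equivalence\<close>

definition gauge_equivalent ::
    "('f::field \<Rightarrow> 'f) \<Rightarrow> ('f \<Rightarrow> 'f) \<Rightarrow>
     'f^'n^'n \<Rightarrow> 'f^'n^'n \<Rightarrow> 'f^'n^'n \<Rightarrow> 'f^'n^'n \<Rightarrow> bool"
  where "gauge_equivalent \<sigma>1 \<sigma>2 B1 B2 B1' B2' \<longleftrightarrow>
    (\<exists>G. invertible G \<and>
       B1' = map_matrix \<sigma>1 G ** B1 ** matrix_inv G \<and>
       B2' = map_matrix \<sigma>2 G ** B2 ** matrix_inv G)"


section \<open>Well-definedness of the inclusion and existence of the endomorphisms\<close>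

text \<open>
  \<open>k_to_K\<close> is a \<open>C\<close>-algebra homomorphism with \<open>x \<mapsto> x^1\<close>, and each of the three cases
  is inhabited for all admissible parameters.
\<close>

lemma field_hom_0: "field_hom h \<Longrightarrow> h 0 = 0"
  unfolding field_hom_def by (metis add_cancel_right_right add.right_neutral)

lemma field_hom_eq_0: 
  assumes "field_hom h" "h a = 0" shows "a = 0"
proof (rule ccontr)
  assume "a \<noteq> 0"
  then have "1 = h (a * inverse a)" using assms unfolding field_hom_def by simp
  also have "\<dots> = h a * h (inverse a)" using assms unfolding field_hom_def by blast
  finally show False using assms by simp
qed

lemma field_hom_divide:
  assumes "field_hom h" shows "h (a / b) = h a / h b"
proof (cases "b = 0")
  case True then show ?thesis using field_hom_0[OF assms] by simp
next
  case False
  then have "h b \<noteq> 0" using field_hom_eq_0 assms by blast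
  moreover have "h (a / b) * h b = h (a / b * b)" using assms unfolding field_hom_def by metis
  ultimately show ?thesis using False by (simp add: field_simps)
qed

lemma fract_ext_Fract:
  assumes mult: "\<And>a b. h (a * b) = h a * h b"
    and inj: "\<And>a. h a = 0 \<Longrightarrow> a = 0" and "b \<noteq> 0"
  shows "fract_ext h (Fract a b) = h a / h b"
  unfolding fract_ext_def
proof (rule the_equality)
  show "\<exists>a' b'. b' \<noteq> 0 \<and> Fract a b = Fract a' b' \<and> h a / h b = h a' / h b'"
    using assms by blast
next
  fix v assume "\<exists>a' b'. b' \<noteq> 0 \<and> Fract a b = Fract a' b' \<and> v = h a' / h b'"
  then obtain a' b' where *: "b' \<noteq> 0" "Fract a b = Fract a' b'" "v = h a' / h b'" by blast
  then have "a * b' = a' * b" using \<open>b \<noteq> 0\<close> by (simp add: eq_fract)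
  then have "h a * h b' = h a' * h b" using mult by metis
  moreover have "h b \<noteq> 0" "h b' \<noteq> 0" using inj * \<open>b \<noteq> 0\<close> by blast+
  ultimately show "v = h a / h b" using *(3) by (simp add: frac_eq_eq)
qed

lemma fract_ext_hom:
  assumes "h 1 = 1" and add: "\<And>a b. h (a + b) = h a + h b"
    and mult: "\<And>a b. h (a * b) = h a * h b"
    and inj: "\<And>a. h a = 0 \<Longrightarrow> a = 0"
  shows "field_hom (fract_ext h)" and "fract_ext h (to_fract a) = h a"
proof -
  note ext = fract_ext_Fract[of h, OF mult inj]
  show "fract_ext h (to_fract a) = h a" for a
    using assms(1) by (simp add: to_fract_def ext)
  then have 1: "fract_ext h 1 = 1" using assms(1) by (metis to_fract_1)
  have 2: "fract_ext h (f + g) = fract_ext h f + fract_ext h g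
    \<and> fract_ext h (f * g) = fract_ext h f * fract_ext h g" for f g
  proof -
    obtain a b where f: "f = Fract a b" "b \<noteq> 0" by (cases f) 
    obtain c d where g: "g = Fract c d" "d \<noteq> 0" by (cases g)
    have "h b \<noteq> 0" "h d \<noteq> 0" using inj f g by blast+
    then show ?thesis using f g by (simp add: ext add mult field_simps)
  qed
  show "field_hom (fract_ext h)" unfolding field_hom_def using 1 2 by blast
qed

lemma C_alg_hom_k_eval:
  assumes "C_alg_hom k_const cL h"
  shows "h (to_fract p) = poly (map_poly cL p) (h k_var)"
proof -
  have h: "field_hom h" "\<And>c. h (k_const c) = cL c" using assms by (auto simp: C_alg_hom_def)
  have "k_const 0 = 0" by (simp add: k_const_def)
  then have c0: "cL 0 = 0" using h field_hom_0 by metis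
  show ?thesis
  proof (induction p)
    case 0 show ?case using field_hom_0[OF h(1)] by simp
  next
    case (pCons a p)
    have "to_fract (pCons a p) = k_const a + k_var * to_fract p"
      unfolding k_const_def k_var_def
      by (simp del: to_fract_add to_fract_mult add: to_fract_add[symmetric] to_fract_mult[symmetric])
    then have "h (to_fract (pCons a p)) = cL a + h k_var * h (to_fract p)"
      using h unfolding field_hom_def by metis
    then show ?case using pCons c0 by (simp add: map_poly_pCons)
  qed
qed

lemma C_alg_hom_k_unique:
  fixes h h' :: "'c::field ratfun \<Rightarrow> 'l::field"
  assumes "C_alg_hom k_const cL h" "C_alg_hom k_const cL h'" "h k_var = h' k_var"
  shows "h = h'"
proof
  fix f :: "'c ratfun"
  obtain a b where f: "f = to_fract a / to_fract b"
    by (metis Fract_cases Fract_conv_to_fract)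
  have "field_hom h" "field_hom h'" using assms by (auto simp: C_alg_hom_def)
  then show "h f = h' f" using f assms
    by (simp add: field_hom_divide C_alg_hom_k_eval)
qed

lemma C_alg_hom_k_exists:
  assumes hom: "cL 1 = 1" "\<And>a b. cL (a + b) = cL a + cL b" "\<And>a b. cL (a * b) = cL a * cL b"
    and transc: "\<And>p. poly (map_poly cL p) t = 0 \<Longrightarrow> p = 0"
  defines "h \<equiv> fract_ext (\<lambda>p. poly (map_poly cL p) t)"
  shows "C_alg_hom k_const cL h" and "h k_var = t"
proof -
  have c0: "cL 0 = 0" using hom(2)[of 0 0] by (metis add_cancel_right_right add.right_neutral)
  let ?e = "\<lambda>p. poly (map_poly cL p) t"
  have add: "?e (p + q) = ?e p + ?e q" for p q
  proof -
    have "map_poly cL (p + q) = map_poly cL p + map_poly cL q"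
      by (rule poly_eqI) (simp add: coeff_map_poly c0 hom)
    then show ?thesis by simp
  qed
  have sm: "?e (smult a q) = cL a * ?e q" for a q
  proof -
    have "map_poly cL (smult a q) = smult (cL a) (map_poly cL q)"
      by (rule poly_eqI) (simp add: coeff_map_poly c0 hom)
    then show ?thesis by simp
  qed
  have mult: "?e (p * q) = ?e p * ?e q" for p q
    by (induction p) (simp_all add: add sm map_poly_pCons c0 algebra_simps)
  have "?e 1 = 1" by (simp add: one_pCons map_poly_pCons c0 hom)
  from fract_ext_hom[of ?e, OF this add mult transc]
  have *: "field_hom h" "\<And>p. h (to_fract p) = ?e p" unfolding h_def by auto
  show "C_alg_hom k_const cL h"
    using * by (simp add: C_alg_hom_def k_const_def map_poly_pCons c0)
  show "h k_var = t" by (simp add: * k_var_def map_poly_pCons c0 hom)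
qed

lemma k_const_hom: "k_const 1 = 1" "k_const (a + b) = k_const a + k_const b"
  "k_const (a * b) = k_const a * k_const b"
  by (simp_all add: k_const_def flip: one_pCons to_fract_add to_fract_mult)

lemma K_const_hom: "K_const 1 = 1" "K_const (a + b) = K_const a + K_const b"
  "K_const (a * b) = K_const a * K_const b"
  by (simp_all add: K_const_def single_add mult_single flip: to_fract_add to_fract_mult)

lemma k_endo_exists:
  assumes "degree g > 0"
  shows "\<exists>\<sigma>. C_alg_hom k_const k_const \<sigma> \<and> \<sigma> k_var = to_fract g"
proof -
  have e: "poly (map_poly k_const p) (to_fract g) = to_fract (pcompose p g)" for p
    by (induction p) (simp_all add: map_poly_pCons pcompose_pCons k_const_def)
  have "p = 0" if "poly (map_poly k_const p) (to_fract g) = 0" for p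
    using that assms e[of p] by (auto dest: pcompose_eq_0)
  from C_alg_hom_k_exists[OF k_const_hom this] show ?thesis by blast
qed

lemma K_pow_power: "K_pow a ^ n = K_pow (of_nat n * a)"
  by (induction n) (simp_all add: K_pow_def mult_single algebra_simps flip: to_fract_mult)

lemma k_to_K_hom: "C_alg_hom k_const K_const (k_to_K :: 'a::field ratfun \<Rightarrow> _)"
  and k_to_K_var: "k_to_K (k_var :: 'a ratfun) = K_pow 1"
proof -
  have transc: "p = 0" if "poly (map_poly K_const p) (K_pow 1) = 0" for p :: "'a poly"
  proof -
    have c0: "K_const 0 = 0" by (simp add: K_const_def)
    have "degree (map_poly K_const p) = degree p"
      by (rule degree_map_poly) (auto simp: K_const_def dest: arg_cong[of _ 0 "\<lambda>f. Poly_Mapping.lookup f 0"])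
    then have "poly (map_poly K_const p) (K_pow 1)
        = (\<Sum>i\<le>degree p. coeff (map_poly K_const p) i * K_pow 1 ^ i)"
      by (simp add: poly_altdef)
    also have "\<dots> = to_fract (\<Sum>i\<le>degree p. Poly_Mapping.single (of_nat i) (coeff p i))"
      by (simp add: coeff_map_poly c0 K_pow_power)
        (simp add: K_const_def K_pow_def mult_single flip: to_fract_mult)
    finally have z: "(\<Sum>i\<le>degree p. Poly_Mapping.single (of_nat i :: rat) (coeff p i)) = 0"
      using that by (metis to_fract_eq_0_iff)
    have "coeff p j = 0" if "j \<le> degree p" for j
    proof -
      have "0 = Poly_Mapping.lookup
          (\<Sum>i\<le>degree p. Poly_Mapping.single (of_nat i :: rat) (coeff p i)) (of_nat j)"
        using z by simp
      also have "\<dots> = (\<Sum>i\<le>degree p. if i = j then coeff p i else 0)"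
        by (simp add: lookup_sum lookup_single when_def)
      finally show ?thesis using that by simp
    qed
    then show "p = 0" by (metis le_refl leading_coeff_0_iff)
  qed
  show "C_alg_hom k_const K_const (k_to_K :: 'a ratfun \<Rightarrow> _)"
    unfolding k_to_K_def by (rule C_alg_hom_k_exists(1)[OF K_const_hom transc])
  show "k_to_K (k_var :: 'a ratfun) = K_pow 1"
    unfolding k_to_K_def by (rule C_alg_hom_k_exists(2)[OF K_const_hom transc])
qed

lemma K_endo_exists:
  assumes "(q::rat) \<noteq> 0"
  shows "\<exists>\<tau>. C_alg_hom K_const K_const \<tau> \<and> (\<forall>a. \<tau> (K_pow a) = K_pow (q * a))"
proof -
  have inj: "inj (\<lambda>a. a / q)" using assms by (auto simp: inj_def)
  define D where "D = (Poly_Mapping.map_key (\<lambda>a. a / q) :: (rat \<Rightarrow>\<^sub>0 'a) \<Rightarrow> _)"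
  have add: "D (f + g) = D f + D g" for f g
    unfolding D_def by (rule map_key_plus[OF inj])
  have D0: "D 0 = 0" unfolding D_def by (rule map_key_zero[OF inj])
  have sgl: "D (Poly_Mapping.single a v) = Poly_Mapping.single (q * a) v" for a v
    using map_key_single[OF inj, of "q * a" v] assms by (simp add: D_def)
  have sum: "D (sum F A) = (\<Sum>x\<in>A. D (F x))" if "finite A" for A and F :: "rat \<Rightarrow> _"
    using that by (induction) (auto simp: D0 add)
  have expand: "f = (\<Sum>k\<in>Poly_Mapping.keys f. Poly_Mapping.single k (Poly_Mapping.lookup f k))"
    for f :: "rat \<Rightarrow>\<^sub>0 'a"
    by (rule poly_mapping_eqI) (auto simp: lookup_sum lookup_single when_def in_keys_iff)
  have mult1: "D (Poly_Mapping.single a v * g) = D (Poly_Mapping.single a v) * D g" for a v g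
    by (subst (1 2) expand[of g])
      (simp add: sum_distrib_left sum sgl mult_single distrib_left)
  have mult: "D (f * g) = D f * D g" for f g
    by (subst (1 2) expand[of f]) (simp add: sum_distrib_right sum mult1)
  have lk: "Poly_Mapping.lookup (D f) (q * a) = Poly_Mapping.lookup f a" for f a
    unfolding D_def using assms by (simp add: map_key.rep_eq[OF inj])
  have "f = 0" if "D f = 0" for f
    by (rule poly_mapping_eqI) (use lk that in \<open>metis lookup_zero\<close>)
  moreover have "D 1 = 1" using sgl[of 0 1] by simp
  ultimately have *: "field_hom (fract_ext (\<lambda>f. to_fract (D f)))"
    "\<And>f. fract_ext (\<lambda>f. to_fract (D f)) (to_fract f) = to_fract (D f)"
    using fract_ext_hom[of "\<lambda>f. to_fract (D f)"] by (auto simp: add mult)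
  show ?thesis
    by (rule exI[of _ "fract_ext (\<lambda>f. to_fract (D f))"])
      (use * in \<open>auto simp: C_alg_hom_def K_const_def K_pow_def sgl\<close>)
qed

lemma C_alg_hom_comp:
  "C_alg_hom cA cB h \<Longrightarrow> C_alg_hom cB cD g \<Longrightarrow> C_alg_hom cA cD (g \<circ> h)"
  by (simp add: C_alg_hom_def field_hom_def)

lemma commuting_endosI:
  fixes \<sigma>1 \<sigma>2 :: "'c::field ratfun \<Rightarrow> 'c ratfun"
  assumes "C_alg_hom k_const k_const \<sigma>1" "C_alg_hom k_const k_const \<sigma>2"
    "\<sigma>1 (\<sigma>2 k_var) = \<sigma>2 (\<sigma>1 k_var)"
  shows "commuting_endos \<sigma>1 \<sigma>2"
  using assms C_alg_hom_k_unique[of _ "\<sigma>1 \<circ> \<sigma>2" "\<sigma>2 \<circ> \<sigma>1"]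
  by (auto simp: commuting_endos_def intro: C_alg_hom_comp)

lemma C_alg_hom_simps:
  assumes "C_alg_hom cA cB h"
  shows "h (a + b) = h a + h b" "h (a * b) = h a * h b" "h 1 = 1" "h (cA c) = cB c"
    "h (a ^ n) = h a ^ n"
proof -
  show *: "h (a + b) = h a + h b" "h (a * b) = h a * h b" "h 1 = 1" "h (cA c) = cB c" for a b
    using assms by (auto simp: C_alg_hom_def field_hom_def)
  show "h (a ^ n) = h a ^ n" by (induction n) (simp_all add: *)
qed

lemma case_2S_exists:
  fixes \<alpha> :: "'a::field_char_0"
  assumes "\<alpha> \<notin> \<rat>"
  shows "\<exists>\<sigma>1 \<sigma>2. case_2S \<sigma>1 \<sigma>2 \<and> \<sigma>2 k_var = k_var + k_const \<alpha>"
proof -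
  obtain \<sigma>1 \<sigma>2 :: "'a ratfun \<Rightarrow> 'a ratfun"
    where *: "C_alg_hom k_const k_const \<sigma>1" "\<sigma>1 k_var = to_fract [:1, 1:]"
    "C_alg_hom k_const k_const \<sigma>2" "\<sigma>2 k_var = to_fract [:\<alpha>, 1:]"
    using k_endo_exists[of "[:1, 1:]"] k_endo_exists[of "[:\<alpha>, 1:]"] by auto
  have v: "\<sigma>1 k_var = k_var + 1" "\<sigma>2 k_var = k_var + k_const \<alpha>"
    using * by (simp_all add: k_var_def k_const_def one_pCons flip: to_fract_1 to_fract_add)
  have "commuting_endos \<sigma>1 \<sigma>2"
    by (rule commuting_endosI[OF *(1,3)])
      (simp add: v C_alg_hom_simps[OF *(1)] C_alg_hom_simps[OF *(3)] ac_simps)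
  then show ?thesis using v assms unfolding case_2S_def by blast
qed

lemma case_2Q_exists:
  assumes "field_hom (\<iota> :: 'c::field_char_0 \<Rightarrow> complex)" "q1 \<noteq> 0" "q2 \<noteq> 0"
    "\<not> root_of_unity q1" "\<not> root_of_unity q2" "mult_independent q1 q2" "cmod (\<iota> q1) \<noteq> 1"
  shows "\<exists>\<sigma>1 \<sigma>2. case_2Q \<sigma>1 \<sigma>2 \<and>
    \<sigma>1 k_var = k_const q1 * k_var \<and> \<sigma>2 k_var = k_const q2 * k_var"
proof -
  obtain \<sigma>1 \<sigma>2 where *: "C_alg_hom k_const k_const \<sigma>1" "\<sigma>1 k_var = to_fract [:0, q1:]"
    "C_alg_hom k_const k_const \<sigma>2" "\<sigma>2 k_var = to_fract [:0, q2:]"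
    using k_endo_exists[of "[:0, q1:]"] k_endo_exists[of "[:0, q2:]"] assms by auto
  have v: "\<sigma>1 k_var = k_const q1 * k_var" "\<sigma>2 k_var = k_const q2 * k_var"
    using * by (simp_all add: k_var_def k_const_def flip: to_fract_mult)
  have "commuting_endos \<sigma>1 \<sigma>2"
    by (rule commuting_endosI[OF *(1,3)])
      (simp add: v C_alg_hom_simps[OF *(1)] C_alg_hom_simps[OF *(3)] ac_simps)
  then show ?thesis using v assms unfolding case_2Q_def by blast
qed

lemma case_2M_exists:
  assumes "q1 \<ge> 2" "q2 \<ge> 2" "mult_independent (of_nat q1 :: rat) (of_nat q2)"
  shows "\<exists>\<sigma>1 \<sigma>2 \<tau>1 \<tau>2. case_2M \<sigma>1 \<sigma>2 \<tau>1 \<tau>2 \<and>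
    \<sigma>1 k_var = k_var ^ q1 \<and> \<sigma>2 k_var = k_var ^ q2"
proof -
  have p: "to_fract (p ^ n) = to_fract p ^ n" for p :: "'a poly" and n
    by (induction n) simp_all
  have "degree ([:0, 1:] ^ q :: 'a poly) > 0" if "q \<ge> 2" for q
    using that by (simp add: degree_power_eq)
  from k_endo_exists[OF this[OF assms(1)]] k_endo_exists[OF this[OF assms(2)]]
  obtain \<sigma>1 \<sigma>2 :: "'a ratfun \<Rightarrow> 'a ratfun"
    where *: "C_alg_hom k_const k_const \<sigma>1" "\<sigma>1 k_var = k_var ^ q1"
      "C_alg_hom k_const k_const \<sigma>2" "\<sigma>2 k_var = k_var ^ q2"
    by (auto simp: p k_var_def)
  obtain \<tau>1 \<tau>2 :: "'a fpfun \<Rightarrow> 'a fpfun"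
    where t: "C_alg_hom K_const K_const \<tau>1" "\<And>a. \<tau>1 (K_pow a) = K_pow (of_nat q1 * a)"
      "C_alg_hom K_const K_const \<tau>2" "\<And>a. \<tau>2 (K_pow a) = K_pow (of_nat q2 * a)"
    using K_endo_exists[of "of_nat q1"] K_endo_exists[of "of_nat q2"] assms by auto
  have ext: "\<tau> (k_to_K f) = k_to_K (\<sigma> f)"
    if "C_alg_hom K_const K_const \<tau>" "\<And>a. \<tau> (K_pow a) = K_pow (of_nat q * a)"
      "C_alg_hom k_const k_const \<sigma>" "\<sigma> k_var = k_var ^ q"
    for \<tau> \<sigma> q and f :: "'a ratfun"
  proof -
    have "(\<tau> \<circ> k_to_K) k_var = (k_to_K \<circ> \<sigma>) k_var"
      using that by (simp add: k_to_K_var C_alg_hom_simps(5)[OF k_to_K_hom] K_pow_power)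
    then have "\<tau> \<circ> k_to_K = k_to_K \<circ> \<sigma>"
      by (rule C_alg_hom_k_unique[OF C_alg_hom_comp[OF k_to_K_hom that(1)]
            C_alg_hom_comp[OF that(3) k_to_K_hom]])
    then show ?thesis by (metis comp_apply)
  qed
  have "commuting_endos \<sigma>1 \<sigma>2"
    using * by (intro commuting_endosI)
      (simp_all add: C_alg_hom_simps(5)[OF *(1)] C_alg_hom_simps(5)[OF *(3)] mult.commute
        flip: power_mult)
  moreover have "\<forall>f. \<tau>1 (k_to_K f) = k_to_K (\<sigma>1 f)" "\<forall>f. \<tau>2 (k_to_K f) = k_to_K (\<sigma>2 f)"
    using ext[OF t(1,2) *(1,2)] ext[OF t(3,4) *(3,4)] by simp_all
  ultimately have "case_2M \<sigma>1 \<sigma>2 \<tau>1 \<tau>2"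
    unfolding case_2M_def
    by (intro conjI exI[of _ q1] exI[of _ q2] allI) (simp_all add: * t assms)
  then show ?thesis using * by blast
qed

end

theory Submission
  imports Defs "HOL-Number_Theory.Cong"
begin

text \<open>
  With \<open>D\<^sub>j = B\<^sub>j\<^sup>-\<^sup>1\<close> the additive maps \<open>\<Phi>\<^sub>j v = D\<^sub>j \<sigma>\<^sub>j(v)\<close> of \<open>k\<^sup>n\<close> commute, and a constant form of the
  system amounts to a basis of \<open>k\<^sup>n\<close> whose \<open>C\<close>-span is stable under \<open>\<Phi>\<^sub>1\<close> and \<open>\<Phi>\<^sub>2\<close>. Such a basis is
  found among the torsion vectors, those killed by some \<open>f(\<Phi>\<^sub>1)\<close> with \<open>0 \<noteq> f \<in> C[X]\<close>, so the point
  is that torsion vectors span \<open>k\<^sup>n\<close>.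

  In cases 2S and 2Q consider the vectors \<open>v\<close> for which \<open>h \<Phi>\<^sub>1\<^sup>i \<Phi>\<^sub>2\<^sup>j v\<close> has no finite nonzero (in case 2S:
  no finite) pole for a fixed \<open>h\<close> and all large \<open>i\<close>, \<open>j\<close>. They span \<open>k\<^sup>n\<close>, and counting degrees shows that
  they form a \<open>C[\<Phi>\<^sub>1]\<close>-module of finite rank. Hence some nonzero \<open>P(\<Phi>\<^sub>1, \<Phi>\<^sub>2)\<close> maps all of them to torsion
  vectors. Multiplication by \<open>x\<close> twists \<open>P\<close> into further such relations; by the independence
  of \<open>\<sigma>\<^sub>1\<close> and \<open>\<sigma>\<^sub>2\<close>, elimination leaves a relation in \<open>\<Phi>\<^sub>1\<close> alone.

  In case 2M attach to \<open>v\<close> the canonical heights \<open>lim H(\<Phi>\<^sub>1\<^sup>l v) / q\<^sub>1\<^sup>l\<close>, where \<open>H\<close> is minus the order at \<open>0\<close>,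
  minus the order at \<open>\<infinity>\<close>, or the degree of a common denominator. Passing to the sections \<open>p\<^sub>a\<close>
  of \<open>v = \<Sum> x\<^sup>a p\<^sub>a(x\<^sup>N)\<close>, where \<open>N\<close> is a power of \<open>q\<^sub>2\<close>, essentially divides the sum of the first two
  heights by \<open>N\<close> and does not increase the third one, which can be made small from the start. As the
  first two heights take values in a fixed lattice, their sum becomes nonpositive. After a
  substitution \<open>x \<mapsto> x\<^sup>S\<close> and a multiplication by a power of \<open>x\<close>, a long piece of the \<open>\<Phi>\<^sub>1\<close>-orbit lies
  in a \<open>C\<close>-space of smaller dimension, which makes the vector a torsion vector.
\<close>

section \<open>Polynomials in a linear operator\<close>

text \<open>That torsion vectors span is not yet enough. In cases 2S and 2Q multiplication by x
  preserves torsion, so the torsion vectors form a C-space of infinite dimension and a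
  finite-dimensional stable piece must be selected. In case 2S it is spanned by eigenvectors of
  \<open>\<Phi>1\<close>: nilpotent parts disappear because a y(x+1) - c y = g has a polynomial
  solution whenever a is nonzero. In case 2Q multiplication by x^k multiplies eigenvalues by q1^k,
  and one eigenvalue is kept from each class modulo powers of q1. In case 2M torsion scalars are
  constant, and all torsion vectors are kept. Each piece is stable under \<open>\<Phi>2\<close>,
  which commutes with \<open>\<Phi>1\<close>. In the Mahler case the second equation makes the first
  system gauge equivalent to its pullbacks along x -> x^s for every monomial s in q1 and q2; this
  allows sections to be taken without leaving the system. Heights are integral only up to a
  denominator S depending on q1 and n. The substitution x -> x^S that clears it is undone at the end
  by x -> x^(1/S), and this is where K enters.\<close>

locale op_module = module scale
  for scale :: "'a::comm_ring_1 \<Rightarrow> 'b::ab_group_add \<Rightarrow> 'b" +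
  fixes T :: "'b \<Rightarrow> 'b"
  assumes T_add: "T (u + v) = T u + T v"
    and T_scale: "T (scale a v) = scale a (T v)"
begin

lemma T_0 [simp]: "T 0 = 0"
  using T_add[of 0 0] by simp

lemma T_sum: "T (sum g A) = (\<Sum>i\<in>A. T (g i))"
  by (induction A rule: infinite_finite_induct) (simp_all add: T_add)

definition act :: "'a poly \<Rightarrow> 'b \<Rightarrow> 'b"
  where "act f v = (\<Sum>i\<le>degree f. scale (coeff f i) ((T ^^ i) v))"

lemma act_eq_sum:
  assumes "degree f \<le> N"
  shows "act f v = (\<Sum>i\<le>N. scale (coeff f i) ((T ^^ i) v))"
  unfolding act_def
  by (rule sum.mono_neutral_left) (use assms in \<open>auto simp: coeff_eq_0\<close>)

lemma act_0 [simp]: "act 0 v = 0"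
  by (simp add: act_def)

lemma act_pCons: "act (pCons a f) v = scale a v + T (act f v)"
proof -
  have "act (pCons a f) v = (\<Sum>i\<le>Suc (degree f). scale (coeff (pCons a f) i) ((T ^^ i) v))"
    by (rule act_eq_sum) (rule degree_pCons_le)
  also have "\<dots> = scale a v + T (act f v)"
    by (subst sum.atMost_Suc_shift) (simp add: act_def T_sum T_scale)
  finally show ?thesis .
qed

lemma act_add_left: "act (f + g) v = act f v + act g v"
proof -
  define N where "N = max (degree f) (degree g)"
  have "degree f \<le> N" "degree g \<le> N" "degree (f + g) \<le> N"
    by (auto simp: N_def degree_add_le)
  then show ?thesis
    by (simp add: act_eq_sum[of _ N] scale_left_distrib sum.distrib)
qed

lemma act_smult: "act (smult a f) v = scale a (act f v)"
  by (induction f) (simp_all add: act_pCons scale_right_distrib T_scale)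

lemma act_mult: "act (f * g) v = act f (act g v)"
  by (induction f) (simp_all add: act_pCons act_add_left act_smult)

lemma act_add_right: "act f (u + v) = act f u + act f v"
  by (induction f) (simp_all add: act_pCons scale_right_distrib T_add ac_simps)

lemma act_scale: "act f (scale a v) = scale a (act f v)"
  by (induction f) (simp_all add: act_pCons scale_right_distrib T_scale ac_simps)

lemma act_const [simp]: "act [:a:] v = scale a v"
  by (simp add: act_pCons)

lemma act_1 [simp]: "act 1 v = v"
  by (simp add: one_pCons)

lemma act_monom: "act (monom a i) v = scale a ((T ^^ i) v)"
proof (induction i)
  case (Suc i)
  then show ?case by (simp add: monom_Suc act_pCons T_scale)
qed (simp add: monom_0)

lemma module_act: "module act"
  by standard (simp_all add: act_add_left act_add_right act_mult)

lemma act_commute: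
  assumes add: "\<And>u v. S (u + v) = S u + S v"
    and scale: "\<And>a v. S (scale a v) = scale a (S v)"
    and comm: "\<And>v. S (T v) = T (S v)"
  shows "S (act f v) = act f (S v)"
proof (induction f)
  case 0
  have "S 0 = 0" using add[of 0 0] by simp
  then show ?case by simp
qed (simp add: act_pCons add scale comm)

lemma act_closed:
  assumes "subspace L" "\<And>v. v \<in> L \<Longrightarrow> T v \<in> L" "v \<in> L"
  shows "act f v \<in> L"
  by (induction f) (use assms in \<open>auto simp: act_pCons subspace_0 subspace_add subspace_scale\<close>)

end

section \<open>Torsion vectors of two commuting operators\<close>

locale commuting_ops = vector_space scale
  for scale :: "'c::field \<Rightarrow> 'b::ab_group_add \<Rightarrow> 'b" +
  fixes T S :: "'b \<Rightarrow> 'b"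
  assumes T_add: "T (u + v) = T u + T v" and T_scale: "T (scale a v) = scale a (T v)"
    and S_add: "S (u + v) = S u + S v" and S_scale: "S (scale a v) = scale a (S v)"
    and comm: "S (T v) = T (S v)"
begin

sublocale op_T: op_module scale T
  by standard (simp_all add: T_add T_scale)

sublocale mod_T: module op_T.act
  by (rule op_T.module_act)

text \<open>A polynomial in both operators is a \<open>'c poly poly\<close> that acts through
  \<open>S\<close>, with coefficients acting through \<open>T\<close>. For this second use the
  scalars of \<open>op_module\<close> are only a commutative ring.\<close>

sublocale op_TS: op_module op_T.act S
  by standard (simp_all add: S_add op_T.act_commute[of S, OF S_add S_scale comm])

definition tors :: "'b \<Rightarrow> bool"
  where "tors v \<longleftrightarrow> (\<exists>f. f \<noteq> 0 \<and> op_T.act f v = 0)"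

lemma torsI: "f \<noteq> 0 \<Longrightarrow> op_T.act f v = 0 \<Longrightarrow> tors v"
  unfolding tors_def by blast

lemma tors_0 [simp]: "tors 0"
  by (rule torsI[of 1]) auto

lemma act_swap: "op_T.act f (op_T.act g v) = op_T.act g (op_T.act f v)"
  by (simp only: op_T.act_mult[symmetric] mult.commute)

lemma tors_add: assumes "tors u" "tors v" shows "tors (u + v)"
proof -
  obtain f g where f: "f \<noteq> 0" "op_T.act f u = 0" and g: "g \<noteq> 0" "op_T.act g v = 0"
    using assms unfolding tors_def by blast
  have "op_T.act (f * g) v = 0" using g by (simp only: op_T.act_mult mod_T.scale_zero_right)
  moreover have "op_T.act (f * g) u = op_T.act g (op_T.act f u)"
    by (simp add: mult.commute)
  ultimately show ?thesis
    using f g by (intro torsI[of "f * g"]) (simp_all add: op_T.act_add_right)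
qed

lemma tors_act: assumes "tors v" shows "tors (op_T.act f v)"
proof -
  obtain g where g: "g \<noteq> 0" "op_T.act g v = 0" using assms unfolding tors_def by blast
  have "op_T.act g (op_T.act f v) = op_T.act f (op_T.act g v)" by (rule act_swap)
  also have "\<dots> = 0" by (simp only: g mod_T.scale_zero_right)
  finally show ?thesis using g(1) by (rule torsI[rotated])
qed

lemma tors_scale: "tors v \<Longrightarrow> tors (scale a v)"
  using tors_act[of v "[:a:]"] by simp

lemma tors_actD: assumes "f \<noteq> 0" "tors (op_T.act f v)" shows "tors v"
proof -
  obtain g where "g \<noteq> 0" "op_T.act g (op_T.act f v) = 0" using assms unfolding tors_def by blast
  then show ?thesis using assms by (intro torsI[of "g * f"]) simp_all
qed

lemma S_act: "S (op_T.act f v) = op_T.act f (S v)"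
  by (rule op_TS.T_scale)

lemma tors_S: assumes "tors v" shows "tors (S v)"
proof -
  obtain g where "g \<noteq> 0" "op_T.act g v = 0" using assms unfolding tors_def by blast
  then show ?thesis by (intro torsI[of g]) (simp_all add: S_act[symmetric])
qed

lemma tors_diff: "tors u \<Longrightarrow> tors v \<Longrightarrow> tors (u - v)"
  using tors_add[OF _ tors_scale[of v "-1"], of u] by simp

text \<open>Eliminating the top coefficient between a relation \<open>P\<close> of minimal degree in \<open>S\<close> and its
  twist \<open>\<theta> P\<close> leaves no relation at all, and this contradicts the pairwise distinct
  weights \<open>\<lambda> b d\<close> of the twist, unless \<open>P\<close> does not involve \<open>S\<close>.\<close>
theorem all_tors:
  fixes m0 :: nat and th :: "nat \<Rightarrow> 'c poly \<Rightarrow> 'c poly" and lam :: "nat \<Rightarrow> nat \<Rightarrow> 'c"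
  assumes L: "subspace L" "\<And>v. v \<in> L \<Longrightarrow> T v \<in> L" "\<And>v. v \<in> L \<Longrightarrow> S v \<in> L"
    and S_inj: "\<And>v. S v = 0 \<Longrightarrow> v = 0"
    and rank: "\<And>w. (\<And>i. i \<le> m0 \<Longrightarrow> w i \<in> L) \<Longrightarrow>
      \<exists>f. (\<exists>i\<le>m0. f i \<noteq> 0) \<and> (\<Sum>i\<le>m0. op_T.act (f i) (w i)) = 0"
    and twist: "\<And>P. (\<And>v. v \<in> L \<Longrightarrow> tors (op_TS.act P v)) \<Longrightarrow>
      \<exists>Q. (\<forall>b. coeff Q b = th b (coeff P b)) \<and> (\<forall>v\<in>L. tors (op_TS.act Q v))"
    and th_deg: "\<And>b p. degree (th b p) \<le> degree p"
    and th_coeff: "\<And>b p. coeff (th b p) (degree p) = lam b (degree p) * lead_coeff p"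
    and lam: "\<And>b b' d d'. b \<noteq> b' \<Longrightarrow> lam b d \<noteq> lam b' d'"
    and "v \<in> L"
  shows "tors v"
proof -
  define good where "good P \<longleftrightarrow> (\<forall>v\<in>L. tors (op_TS.act P v))" for P
  define indep where "indep m w \<longleftrightarrow> (\<forall>i<m. w i \<in> L) \<and>
    (\<forall>f. (\<Sum>i<m. op_T.act (f i) (w i)) = 0 \<longrightarrow> (\<forall>i<m. f i = 0))" for m :: nat and w
  have S_tors: "tors v" if "tors (S v)" for v
  proof -
    from that obtain g where g: "g \<noteq> 0" "op_T.act g (S v) = 0"
      unfolding tors_def by blast
    have "S (op_T.act g v) = 0" unfolding S_act by (rule g)
    then show ?thesis by (rule torsI[OF g(1) S_inj])
  qed
  \<comment> \<open>The rank bound is applied to the iterates of \<open>v\<close> under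
    \<open>S\<close>.\<close>
  have rel1: "\<exists>P. P \<noteq> 0 \<and> op_TS.act P v = 0" if "v \<in> L" for v
  proof -
    have "(S ^^ i) v \<in> L" for i by (induction i) (use that L in auto)
    then obtain f where f: "\<exists>i\<le>m0. f i \<noteq> 0" "(\<Sum>i\<le>m0. op_T.act (f i) ((S ^^ i) v)) = 0"
      using rank[of "\<lambda>i. (S ^^ i) v"] by blast
    define P where "P = (\<Sum>i\<le>m0. monom (f i) i)"
    have c: "coeff P i = (if i \<le> m0 then f i else 0)" for i
      by (simp add: P_def coeff_sum)
    have "degree P \<le> m0" by (rule degree_le) (simp add: c)
    then have "op_TS.act P v = 0" using f by (simp add: op_TS.act_eq_sum[of P m0] c)
    moreover have "P \<noteq> 0" using f(1) c by (metis coeff_0)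
    ultimately show ?thesis by blast
  qed
  have bound: "m \<le> m0" if "indep m w" for m w
  proof (rule ccontr)
    assume "\<not> m \<le> m0"
    then have "\<And>i. i \<le> m0 \<Longrightarrow> w i \<in> L" using that by (auto simp: indep_def)
    from rank[of w, OF this] obtain f
      where f: "\<exists>i\<le>m0. f i \<noteq> 0" "(\<Sum>i\<le>m0. op_T.act (f i) (w i)) = 0" by blast
    have "(\<Sum>i<m. op_T.act (if i \<le> m0 then f i else 0) (w i)) = (\<Sum>i\<le>m0. op_T.act (f i) (w i))"
      using \<open>\<not> m \<le> m0\<close> by (intro sum.mono_neutral_cong_right) auto
    then have "(\<Sum>i<m. op_T.act (if i \<le> m0 then f i else 0) (w i)) = 0" using f(2) by simp
    moreover have *: "\<And>f. (\<Sum>i<m. op_T.act (f i) (w i)) = 0 \<Longrightarrow> \<forall>i<m. f i = 0"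
      using that unfolding indep_def by blast
    ultimately have **: "\<forall>i<m. (if i \<le> m0 then f i else 0) = 0" by (intro *)
    obtain i where "i \<le> m0" "f i \<noteq> 0" using f(1) by blast
    then show False using ** \<open>\<not> m \<le> m0\<close> by (auto dest!: spec[of _ i])
  qed
  define I where "I m \<longleftrightarrow> (\<exists>w. indep m w)" for m
  have "I 0" by (simp add: I_def indep_def)
  moreover have "\<forall>m. I m \<longrightarrow> m \<le> m0" using bound by (auto simp: I_def)
  ultimately obtain m where m: "I m" "\<forall>m'. I m' \<longrightarrow> m' \<le> m"
    using ex_has_greatest_nat[of I 0 "\<lambda>m. m" "Suc m0"] by (auto simp: less_Suc_eq_le)
  then obtain w where w: "indep m w" by (auto simp: I_def)
  have "\<forall>i<m. \<exists>P. P \<noteq> 0 \<and> op_TS.act P (w i) = 0" using rel1 w by (auto simp: indep_def)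
  then obtain Pw where Pw: "\<And>i. i < m \<Longrightarrow> Pw i \<noteq> 0 \<and> op_TS.act (Pw i) (w i) = 0" by metis
  \<comment> \<open>\<open>w\<close> is a maximal family in \<open>L\<close> independent over C[T],
    and \<open>P\<close> kills all of it. Any \<open>u\<close> in \<open>L\<close> has a nonzero
    multiple in the span of \<open>w\<close>, so \<open>P\<close> sends \<open>u\<close> to a
    torsion vector.\<close>
  define P where "P = (\<Prod>i<m. Pw i)"
  have "P \<noteq> 0" using Pw by (simp add: P_def)
  have P0: "op_TS.act P (w i) = 0" if "i < m" for i
  proof -
    have "P = (\<Prod>j\<in>{..<m} - {i}. Pw j) * Pw i"
      using that by (simp add: P_def prod.remove mult.commute)
    then show ?thesis using Pw[OF that]
      by (simp add: op_TS.act_mult module.scale_zero_right[OF op_TS.module_act])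
  qed
  have actcomm: "op_TS.act R (op_T.act f u) = op_T.act f (op_TS.act R u)" for R f u
    using op_TS.act_mult[of R "[:f:]" u] op_TS.act_mult[of "[:f:]" R u] by (simp add: mult.commute)
  have "good P" unfolding good_def
  proof
    fix u assume u: "u \<in> L"
    define w' where "w' i = (if i = m then u else w i)" for i
    have "\<not> indep (Suc m) w'" using m(2) I_def[of "Suc m"] by (auto dest!: spec[of _ "Suc m"])
    moreover have "\<forall>i<Suc m. w' i \<in> L" using w u by (auto simp: w'_def indep_def less_Suc_eq)
    ultimately obtain f where f: "(\<Sum>i<Suc m. op_T.act (f i) (w' i)) = 0" "\<exists>i<Suc m. f i \<noteq> 0"
      unfolding indep_def by blast
    have eq: "(\<Sum>i<m. op_T.act (f i) (w i)) + op_T.act (f m) u = 0"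
      using f(1) by (simp add: w'_def)
    have "f m \<noteq> 0"
    proof
      assume "f m = 0"
      then have "\<forall>i<m. f i = 0" using eq w unfolding indep_def by simp
      then show False using f(2) \<open>f m = 0\<close> by (auto simp: less_Suc_eq)
    qed
    have "op_TS.act P (\<Sum>i<m. op_T.act (f i) (w i)) = (\<Sum>i<m. op_TS.act P (op_T.act (f i) (w i)))"
      by (rule Modules.additive.sum, rule Modules.additive.intro, rule op_TS.act_add_right)
    also have "\<dots> = 0" by (simp add: actcomm P0)
    finally have "op_TS.act P (op_T.act (f m) u) = op_TS.act P ((\<Sum>i<m. op_T.act (f i) (w i)) + op_T.act (f m) u)"
      by (simp add: op_TS.act_add_right)
    also have "\<dots> = 0" unfolding eq by (rule module.scale_zero_right[OF op_TS.module_act])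
    finally have "op_T.act (f m) (op_TS.act P u) = 0" by (simp add: actcomm)
    then show "tors (op_TS.act P u)" using \<open>f m \<noteq> 0\<close> by (rule torsI[rotated])
  qed
  define R where "R r \<longleftrightarrow> (\<exists>P. P \<noteq> 0 \<and> good P \<and> degree P = r)" for r
  have "R (degree P)" using \<open>P \<noteq> 0\<close> \<open>good P\<close> by (auto simp: R_def)
  then obtain r where r: "R r" "\<forall>r'<r. \<not> R r'" using exists_least_iff[of R] by blast
  have min: "P = 0" if "degree P < r" "good P" for P using r(2) that by (auto simp: R_def)
  from r(1) obtain P where P: "P \<noteq> 0" "good P" "degree P = r" by (auto simp: R_def)
  obtain Q where Q: "\<And>b. coeff Q b = th b (coeff P b)" "good Q"
    using twist[of P] P(2) unfolding good_def by blast
  define p where "p = coeff P r"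
  have "p \<noteq> 0" using P by (auto simp: p_def)
  \<comment> \<open>The coefficients of S^r cancel in \<open>U\<close>, so minimality of
    \<open>r\<close> forces \<open>U = 0\<close>.\<close>
  define U where "U = smult (th r p) P - smult p Q"
  have th0: "th b 0 = 0" for b using th_deg[of b 0] th_coeff[of b 0]
    by (metis degree_0 le_zero_eq leading_coeff_0_iff mult_zero_right)
  have Rc: "coeff U b = th r p * coeff P b - p * th b (coeff P b)" for b
    by (simp add: U_def Q)
  have U0: "coeff U b = 0" if "b \<ge> r" for b
    using that P(3) by (cases "b = r") (auto simp: Rc p_def coeff_eq_0 th0)
  have "U = 0 \<or> degree U < r"
    using U0[of "degree U"] by (auto simp: not_less)
  moreover have "good U" unfolding good_def
  proof
    fix v assume "v \<in> L"
    have "op_TS.act U v + op_TS.act (smult p Q) v = op_TS.act (smult (th r p) P) v"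
      by (simp add: U_def flip: op_TS.act_add_left)
    then have "op_TS.act U v = op_T.act (th r p) (op_TS.act P v) - op_T.act p (op_TS.act Q v)"
      by (simp add: op_TS.act_smult eq_diff_eq)
    then show "tors (op_TS.act U v)"
      using P(2) Q(2) \<open>v \<in> L\<close> by (auto simp: good_def intro!: tors_diff tors_act)
  qed
  ultimately have "U = 0" using min by blast
  \<comment> \<open>\<open>U = 0\<close> gives \<open>th r p * q = p * th b q\<close>; comparing the
    coefficients at \<open>degree p + degree q\<close> equates two weights with different first
    indices.\<close>
  have low: "coeff P b = 0" if "b \<noteq> r" for b
  proof (rule ccontr)
    define q where "q = coeff P b"
    assume "coeff P b \<noteq> 0"
    then have "q \<noteq> 0" by (simp add: q_def)
    have "th r p * q = p * th b q" using Rc[of b] \<open>U = 0\<close> by (simp add: q_def)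
    then have "coeff (th r p * q) (degree p + degree q) = coeff (p * th b q) (degree p + degree q)"
      by simp
    \<comment> \<open>Degree bounds are used because \<open>th\<close> lowers the degree when a
      weight vanishes.\<close>
    moreover have "coeff (f * g) (m + n) = coeff f m * coeff g n"
      if "degree f \<le> m" "degree g \<le> n" for f g :: "'c poly" and m n
    proof -
      have "coeff (f * g) (m + n) = (\<Sum>i\<le>m + n. coeff f i * coeff g (m + n - i))"
        by (simp add: coeff_mult)
      also have "\<dots> = (\<Sum>i\<in>{m}. coeff f i * coeff g (m + n - i))"
      proof (rule sum.mono_neutral_right)
        show "\<forall>i\<in>{..m + n} - {m}. coeff f i * coeff g (m + n - i) = 0"
        proof
          fix i assume "i \<in> {..m + n} - {m}"
          then have "i > m \<or> m + n - i > n" by auto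
          then show "coeff f i * coeff g (m + n - i) = 0"
            using that by (auto intro!: coeff_eq_0)
        qed
      qed auto
      finally show ?thesis by simp
    qed
    ultimately have "lam r (degree p) * lead_coeff p * lead_coeff q
        = lead_coeff p * (lam b (degree q) * lead_coeff q)"
      using th_deg by (simp add: th_coeff)
    then have "lam r (degree p) = lam b (degree q)"
      using \<open>p \<noteq> 0\<close> \<open>q \<noteq> 0\<close> by simp
    then show False using lam[of r b] that by metis
  qed
  \<comment> \<open>Now \<open>P\<close> stands for p(T) S^r. Torsion passes back from p(T) S^r v to
    S^r v, and then to v by injectivity of \<open>S\<close>.\<close>
  have "P = monom p r"
    by (rule poly_eqI) (auto simp: p_def low)
  then have "op_TS.act P v = op_T.act p ((S ^^ r) v)"
    by (simp add: op_TS.act_monom)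
  then have "tors ((S ^^ r) v)"
    using P(2) \<open>v \<in> L\<close> \<open>p \<noteq> 0\<close> tors_actD by (metis good_def)
  moreover have "tors ((S ^^ m) v) \<Longrightarrow> tors v" for m
    by (induction m) (simp, use S_tors in simp)
  ultimately show "tors v" by blast
qed

lemma twisted_poly_exists:
  fixes th :: "nat \<Rightarrow> 'c poly \<Rightarrow> 'c poly"
  assumes "\<And>b. th b 0 = 0"
  shows "\<exists>Q. (\<forall>b. coeff Q b = th b (coeff P b)) \<and> degree Q \<le> degree P"
proof (intro exI[of _ "\<Sum>b\<le>degree P. monom (th b (coeff P b)) b"] conjI allI)
  fix b
  show "coeff (\<Sum>b\<le>degree P. monom (th b (coeff P b)) b) b = th b (coeff P b)"
    by (cases "b \<le> degree P") (auto simp: coeff_sum coeff_eq_0 assms)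
  show "degree (\<Sum>b\<le>degree P. monom (th b (coeff P b)) b) \<le> degree P"
    by (rule degree_sum_le) (auto intro: order.trans[OF degree_monom_le])
qed

section \<open>Elimination with multiplication by x as the twisting operator\<close>

context
  fixes X :: "'b \<Rightarrow> 'b"
  assumes X_add: "\<And>u v. X (u + v) = X u + X v"
    and X_scale: "\<And>a v. X (scale a v) = scale a (X v)"
begin

interpretation X: Modules.additive X
  by (rule Modules.additive.intro) (rule X_add)

text \<open>Moving \<open>X\<close> to the left of P(T, S) replaces T by q1 T and S by q2 S, so the
  term T^d S^b acquires the weight \<open>q2 ^ b * q1 ^ d\<close>. The new polynomial is again a
  relation because \<open>X w\<close> torsion implies \<open>w\<close> torsion.\<close>

theorem all_tors_dilation:
  assumes TX: "\<And>v. T (X v) = scale q1 (X (T v))" and SX: "\<And>v. S (X v) = scale q2 (X (S v))"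
    and X_inj: "\<And>v. X v = 0 \<Longrightarrow> v = 0"
    and q: "q1 \<noteq> 0" "\<And>b b' d d'. b \<noteq> b' \<Longrightarrow> q2 ^ b * q1 ^ d \<noteq> q2 ^ b' * q1 ^ d'"
    and L: "subspace L" "\<And>v. v \<in> L \<Longrightarrow> T v \<in> L" "\<And>v. v \<in> L \<Longrightarrow> S v \<in> L" "\<And>v. v \<in> L \<Longrightarrow> X v \<in> L"
    and S_inj: "\<And>v. S v = 0 \<Longrightarrow> v = 0"
    and rank: "\<And>w. (\<And>i. i \<le> (m0::nat) \<Longrightarrow> w i \<in> L) \<Longrightarrow>
      \<exists>f. (\<exists>i\<le>m0. f i \<noteq> 0) \<and> (\<Sum>i\<le>m0. op_T.act (f i) (w i)) = 0"
    and "v \<in> L"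
  shows "tors v"
proof -
  have T_iter: "(T ^^ i) (X v) = scale (q1 ^ i) (X ((T ^^ i) v))" for i v
    by (induction i) (simp_all add: TX T_scale ac_simps)
  have S_iter: "(S ^^ i) (X v) = scale (q2 ^ i) (X ((S ^^ i) v))" for i v
    by (induction i) (simp_all add: SX S_scale ac_simps)
  define dil where "dil p = pcompose p [:0, q1:]" for p
  have dil_coeff: "coeff (dil p) i = q1 ^ i * coeff p i" for p i
    unfolding dil_def by (induction p arbitrary: i)
      (auto simp: pcompose_pCons coeff_pCons split: nat.splits)
  have dil_deg: "degree (dil p) \<le> degree p" for p
    by (rule degree_le) (simp add: dil_coeff coeff_eq_0)
  have act_X: "op_T.act p (X v) = X (op_T.act (dil p) v)" for p v
    unfolding op_T.act_eq_sum[OF dil_deg[of p]] op_T.act_eq_sum[OF order.refl[of "degree p"]]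
    by (simp add: X.sum T_iter dil_coeff X_scale ac_simps)
  define th where "th b p = smult (q2 ^ b) (dil p)" for b p
  show ?thesis
  proof (rule all_tors[where th = th and lam = "\<lambda>b d. q2 ^ b * q1 ^ d", OF L(1-3) S_inj rank])
    fix P assume P: "\<And>v. v \<in> L \<Longrightarrow> tors (op_TS.act P v)"
    have "th b 0 = 0" for b by (simp add: th_def dil_def)
    then obtain Q where Q: "\<forall>b. coeff Q b = th b (coeff P b)" "degree Q \<le> degree P"
      using twisted_poly_exists by blast
    have "op_TS.act P (X v) = X (op_TS.act Q v)" for v
    proof -
      have "op_TS.act Q v = (\<Sum>b\<le>degree P. op_T.act (th b (coeff P b)) ((S ^^ b) v))"
        using Q op_TS.act_eq_sum by simp
      moreover have "op_T.act p ((S ^^ b) (X v)) = X (op_T.act (th b p) ((S ^^ b) v))" for p b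
        by (simp add: S_iter op_T.act_scale th_def op_T.act_smult act_X X_scale)
      ultimately show ?thesis by (simp add: op_TS.act_def X.sum)
    qed
    moreover have "tors w" if "tors (X w)" for w
    proof -
      from that obtain g where "g \<noteq> 0" "op_T.act g (X w) = 0" unfolding tors_def by blast
      moreover from \<open>g \<noteq> 0\<close> have "dil g \<noteq> 0"
        using q(1) dil_coeff[of g "degree g"] by auto
      ultimately show ?thesis using act_X X_inj by (intro torsI[of "dil g"]) auto
    qed
    ultimately have "\<forall>v\<in>L. tors (op_TS.act Q v)" using P L(4) by metis
    then show "\<exists>Q. (\<forall>b. coeff Q b = th b (coeff P b)) \<and> (\<forall>v\<in>L. tors (op_TS.act Q v))"
      using Q by blast
  next
    show "degree (th b p) \<le> degree p" for b p
      using dil_deg order.trans[OF degree_smult_le] by (auto simp: th_def)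
    show "coeff (th b p) (degree p) = q2 ^ b * q1 ^ degree p * lead_coeff p" for b p
      by (simp add: th_def dil_coeff)
  qed (use q \<open>v \<in> L\<close> in auto)
qed

text \<open>The commutator of P(T, S) with \<open>X\<close> is T dP/dT + \<alpha> S dP/dS, so the
  term T^d S^b has weight b \<alpha> + d. Like P itself, this polynomial maps \<open>L\<close> to
  torsion vectors, since \<open>X\<close> preserves torsion.\<close>

theorem all_tors_translation:
  assumes TX: "\<And>v. T (X v) = X (T v) + T v" and SX: "\<And>v. S (X v) = X (S v) + scale \<alpha> (S v)"
    and \<alpha>: "\<And>b b' d d' :: nat. b \<noteq> b' \<Longrightarrow> of_nat b * \<alpha> + of_nat d \<noteq> of_nat b' * \<alpha> + of_nat d'"
    and L: "subspace L" "\<And>v. v \<in> L \<Longrightarrow> T v \<in> L" "\<And>v. v \<in> L \<Longrightarrow> S v \<in> L" "\<And>v. v \<in> L \<Longrightarrow> X v \<in> L"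
    and S_inj: "\<And>v. S v = 0 \<Longrightarrow> v = 0"
    and rank: "\<And>w. (\<And>i. i \<le> (m0::nat) \<Longrightarrow> w i \<in> L) \<Longrightarrow>
      \<exists>f. (\<exists>i\<le>m0. f i \<noteq> 0) \<and> (\<Sum>i\<le>m0. op_T.act (f i) (w i)) = 0"
    and "v \<in> L"
  shows "tors v"
proof -
  have S_iter: "(S ^^ i) (X v) = X ((S ^^ i) v) + scale (of_nat i * \<alpha>) ((S ^^ i) v)" for i v
    by (induction i) (simp_all add: SX S_scale S_add algebra_simps scale_left_distrib)
  define der where "der p = pCons 0 (pderiv p)" for p :: "'c poly"
  have der_coeff: "coeff (der p) i = of_nat i * coeff p i" for p i
    by (cases i) (auto simp: der_def coeff_pderiv)
  have der_deg: "degree (der p) \<le> degree p" for p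
    by (rule degree_le) (simp add: der_coeff coeff_eq_0)
  have T_iter: "(T ^^ i) (X v) = X ((T ^^ i) v) + scale (of_nat i) ((T ^^ i) v)" for i v
    by (induction i) (simp_all add: TX T_scale T_add algebra_simps scale_left_distrib)
  have act_X: "op_T.act p (X v) = X (op_T.act p v) + op_T.act (der p) v" for p v
    unfolding op_T.act_eq_sum[OF der_deg[of p]] op_T.act_eq_sum[OF order.refl[of "degree p"]]
    by (simp add: X.sum T_iter der_coeff X_scale ac_simps scale_right_distrib sum.distrib)
  define th where "th b p = smult (of_nat b * \<alpha>) p + der p" for b p
  \<comment> \<open>If g(T) kills w, then g(T) X w = T g'(T) w, and this is killed by g(T) once
    more.\<close>
  have tors_X: "tors (X w)" if "tors w" for w
  proof -
    from that obtain g where g: "g \<noteq> 0" "op_T.act g w = 0" unfolding tors_def by blast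
    have "op_T.act (g * g) (X w) = op_T.act g (X (op_T.act g w) + op_T.act (der g) w)"
      by (simp only: op_T.act_mult act_X[of g w])
    also have "\<dots> = op_T.act g (op_T.act (der g) w)" by (simp add: g X.zero)
    also have "\<dots> = op_T.act (der g) (op_T.act g w)" by (rule act_swap)
    also have "\<dots> = 0" by (simp only: g mod_T.scale_zero_right)
    finally show ?thesis using g(1) by (intro torsI[of "g * g"]) auto
  qed
  show ?thesis
  proof (rule all_tors[where th = th and lam = "\<lambda>b d. of_nat b * \<alpha> + of_nat d", OF L(1-3) S_inj rank])
    fix P assume P: "\<And>v. v \<in> L \<Longrightarrow> tors (op_TS.act P v)"
    have "th b 0 = 0" for b by (simp add: th_def der_def)
    then obtain Q where Q: "\<forall>b. coeff Q b = th b (coeff P b)" "degree Q \<le> degree P"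
      using twisted_poly_exists by blast
    have eq: "op_TS.act P (X v) = X (op_TS.act P v) + op_TS.act Q v" for v
    proof -
      have "op_TS.act Q v = (\<Sum>b\<le>degree P. op_T.act (th b (coeff P b)) ((S ^^ b) v))"
        using Q op_TS.act_eq_sum by simp
      moreover have "op_T.act p ((S ^^ b) (X v)) = X (op_T.act p ((S ^^ b) v)) + op_T.act (th b p) ((S ^^ b) v)" for p b
        by (simp add: S_iter op_T.act_scale op_T.act_add_right op_T.act_add_left th_def op_T.act_smult act_X X_scale)
      ultimately show ?thesis by (simp add: op_TS.act_def X.sum sum.distrib)
    qed
    have "tors (op_TS.act Q v)" if "v \<in> L" for v
      using tors_diff[OF P[OF L(4)[OF that]] tors_X[OF P[OF that]]] by (simp add: eq)
    then show "\<exists>Q. (\<forall>b. coeff Q b = th b (coeff P b)) \<and> (\<forall>v\<in>L. tors (op_TS.act Q v))"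
      using Q by blast
  next
    show "degree (th b p) \<le> degree p" for b p
      unfolding th_def by (intro degree_add_le der_deg degree_smult_le)
    show "coeff (th b p) (degree p) = (of_nat b * \<alpha> + of_nat (degree p)) * lead_coeff p" for b p
      by (simp add: th_def der_coeff algebra_simps)
  qed (use \<alpha> \<open>v \<in> L\<close> in auto)
qed

end

end

section \<open>Rational functions and vectors of rational functions\<close>

lemma k_const_0 [simp]: "k_const 0 = 0"
  and k_const_1 [simp]: "k_const 1 = 1"
  by (simp_all add: k_const_def flip: one_pCons)

lemma k_const_eq_0_iff [simp]: "k_const c = 0 \<longleftrightarrow> c = 0"
  by (simp add: k_const_def)

lemma k_const_inverse: "k_const (inverse c) = inverse (k_const c)"
proof (cases "c = 0")
  case False
  then have "k_const c * k_const (inverse c) = 1" by (simp flip: k_const_hom(3))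
  then show ?thesis by (simp add: inverse_unique)
qed simp

lemma k_const_minus [simp]: "k_const (- a) = - k_const a"
  by (simp add: k_const_def flip: to_fract_uminus)

lemma k_const_diff: "k_const (a - b) = k_const a - k_const b"
  using k_const_hom(2)[of a "- b"] by simp

lemma k_const_power: "k_const (a ^ n) = k_const a ^ n"
  by (induction n) (simp_all add: k_const_hom)

lemma k_const_eq_iff [simp]: "k_const a = k_const b \<longleftrightarrow> a = b"
  using k_const_eq_0_iff[of "a - b"] by (simp add: k_const_diff)

lemma k_var_neq_0 [simp]: "k_var \<noteq> 0"
  by (simp add: k_var_def)

lemma to_fract_power: "to_fract (p ^ n) = to_fract p ^ n"
  by (induction n) simp_all

lemma to_fract_smult: "to_fract (smult c p) = k_const c * to_fract p"
  by (simp add: k_const_def flip: to_fract_mult)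

lemma ratfun_cases:
  obtains a b where "b \<noteq> 0" "f = to_fract a / to_fract b"
  by (metis Fract_cases Fract_conv_to_fract)

interpretation C: vector_space "\<lambda>c v. k_const c *s (v :: 'c::field ratfun ^ 'n)"
  by standard (simp_all add: k_const_hom vec_eq_iff algebra_simps)

definition vmap :: "('a \<Rightarrow> 'b) \<Rightarrow> 'a ^ 'n \<Rightarrow> 'b ^ 'n"
  where "vmap \<sigma> v = (\<chi> i. \<sigma> (v $ i))"

lemma vmap_nth [simp]: "vmap \<sigma> v $ i = \<sigma> (v $ i)"
  by (simp add: vmap_def)

lemma vmap_comp: "vmap \<sigma> (vmap \<rho> v) = vmap (\<lambda>f. \<sigma> (\<rho> f)) v"
  by (simp add: vec_eq_iff)

lemma field_hom_simps:
  assumes "field_hom \<sigma>"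
  shows "\<sigma> (a + b) = \<sigma> a + \<sigma> b" "\<sigma> (a * b) = \<sigma> a * \<sigma> b" "\<sigma> 1 = 1" "\<sigma> 0 = 0"
    "\<sigma> (- a) = - \<sigma> a" "\<sigma> (a - b) = \<sigma> a - \<sigma> b" "\<sigma> (a / b) = \<sigma> a / \<sigma> b" "\<sigma> (a ^ m) = \<sigma> a ^ m"
    "\<sigma> (inverse a) = inverse (\<sigma> a)"
proof -
  show *: "\<sigma> (a + b) = \<sigma> a + \<sigma> b" "\<sigma> (a * b) = \<sigma> a * \<sigma> b" "\<sigma> 1 = 1" for a b
    using assms by (auto simp: field_hom_def)
  show 0: "\<sigma> 0 = 0" by (rule field_hom_0[OF assms])
  have "\<sigma> (- a) + \<sigma> a = 0" for a using *(1)[of "- a" a] 0 by simp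
  then show m: "\<sigma> (- a) = - \<sigma> a" for a by (simp add: add_eq_0_iff2)
  show "\<sigma> (a - b) = \<sigma> a - \<sigma> b" using *(1)[of a "- b"] m by simp
  show d: "\<sigma> (a / b) = \<sigma> a / \<sigma> b" for a b by (rule field_hom_divide[OF assms])
  show "\<sigma> (a ^ m) = \<sigma> a ^ m" by (induction m) (simp_all add: *)
  show "\<sigma> (inverse a) = inverse (\<sigma> a)" using d[of 1 a] * by (simp add: field_simps)
qed

lemma field_hom_sum: "field_hom \<sigma> \<Longrightarrow> \<sigma> (sum f A) = (\<Sum>i\<in>A. \<sigma> (f i))"
  by (induction A rule: infinite_finite_induct) (simp_all add: field_hom_simps)

lemma field_hom_eq_0_iff: "field_hom \<sigma> \<Longrightarrow> \<sigma> a = 0 \<longleftrightarrow> a = 0"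
  using field_hom_eq_0 field_hom_0 by metis

lemma vmap_add: "field_hom \<sigma> \<Longrightarrow> vmap \<sigma> (u + v) = vmap \<sigma> u + vmap \<sigma> v"
  by (simp add: vec_eq_iff field_hom_simps)

lemma vmap_scale: "field_hom \<sigma> \<Longrightarrow> vmap \<sigma> (a *s v) = \<sigma> a *s vmap \<sigma> v"
  by (simp add: vec_eq_iff field_hom_simps)

lemma vmap_sum: "field_hom \<sigma> \<Longrightarrow> vmap \<sigma> (sum f A) = (\<Sum>i\<in>A. vmap \<sigma> (f i))"
  by (simp add: vec_eq_iff field_hom_sum)

lemma vmap_eq_0_iff: "field_hom \<sigma> \<Longrightarrow> vmap \<sigma> v = 0 \<longleftrightarrow> v = 0"
  by (simp add: vec_eq_iff field_hom_eq_0_iff)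

lemma vmap_0: "field_hom \<sigma> \<Longrightarrow> vmap \<sigma> 0 = 0"
  by (simp add: vmap_eq_0_iff)

lemma vmap_mult:
  "field_hom \<sigma> \<Longrightarrow> vmap \<sigma> (A *v v) = map_matrix \<sigma> A *v vmap \<sigma> v"
  by (simp add: vec_eq_iff matrix_vector_mult_def map_matrix_def field_hom_sum field_hom_simps)

lemma map_matrix_mult:
  "field_hom \<sigma> \<Longrightarrow> map_matrix \<sigma> (A ** B) = map_matrix \<sigma> A ** map_matrix \<sigma> B"
  by (simp add: vec_eq_iff matrix_matrix_mult_def map_matrix_def field_hom_sum field_hom_simps)

lemma map_matrix_mat_1: "field_hom \<sigma> \<Longrightarrow> map_matrix \<sigma> (mat 1) = mat 1"
  by (simp add: vec_eq_iff map_matrix_def mat_def field_hom_simps)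

lemma map_matrix_comp: "map_matrix \<sigma> (map_matrix \<rho> A) = map_matrix (\<lambda>f. \<sigma> (\<rho> f)) A"
  by (simp add: vec_eq_iff map_matrix_def)

lemma map_matrix_nth [simp]: "map_matrix \<sigma> A $ i $ j = \<sigma> (A $ i $ j)"
  by (simp add: map_matrix_def)

lemma invertible_map_matrix:
  assumes "field_hom \<sigma>" "invertible A" shows "invertible (map_matrix \<sigma> A)"
proof -
  obtain B where "A ** B = mat 1" "B ** A = mat 1" using assms(2) by (auto simp: invertible_def)
  then show ?thesis unfolding invertible_def
    by (metis assms(1) map_matrix_mult map_matrix_mat_1)
qed

lemma invertible_mult_vec_eq_0:
  fixes A :: "'a::field ^ 'n ^ 'n"
  assumes "invertible A" shows "A *v v = 0 \<longleftrightarrow> v = 0"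
  by (metis assms invertible_def matrix_left_invertible_ker matrix_vector_mult_0_right)

text \<open>The vectors lie in the C-space spanned by \<open>(k_var ^ m / g) *s axis j 1\<close>
  with \<open>m \<le> e\<close>, of dimension at most n (e + 1). A family is used instead of a set
  because iterates of a vector may repeat.\<close>

lemma fd_dependent:
  fixes w :: "'i \<Rightarrow> 'c::field ratfun ^ 'n"
  assumes "g \<noteq> 0" "finite I"
    and poly: "\<And>i j. i \<in> I \<Longrightarrow> \<exists>p. g * w i $ j = to_fract p \<and> degree p \<le> e"
    and card: "card I > CARD('n) * (e + 1)"
  shows "\<exists>c. (\<exists>i\<in>I. c i \<noteq> 0) \<and> (\<Sum>i\<in>I. k_const (c i) *s w i) = 0"
proof (cases "inj_on w I")
  case False
  then obtain i i' where i: "i \<in> I" "i' \<in> I" "i \<noteq> i'" "w i = w i'" by (auto simp: inj_on_def)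
  define c where "c l = (if l = i then 1 else if l = i' then -1 else 0 :: 'c)" for l
  have "(\<Sum>l\<in>I. k_const (c l) *s w l) = (\<Sum>l\<in>{i,i'}. k_const (c l) *s w l)"
    by (rule sum.mono_neutral_right) (use i \<open>finite I\<close> in \<open>auto simp: c_def\<close>)
  also have "\<dots> = 0" using i by (simp add: c_def vec_eq_iff)
  finally show ?thesis using i by (intro exI[of _ c]) (auto simp: c_def)
next
  case True
  define b :: "nat \<times> 'n \<Rightarrow> 'c ratfun ^ 'n"
    where "b = (\<lambda>(m, j). (k_var ^ m / g) *s axis j 1)"
  define B where "B = b ` ({..e} \<times> UNIV)"
  have "finite B" by (simp add: B_def)
  have "card B \<le> card ({..e} \<times> (UNIV :: 'n set))" unfolding B_def by (rule card_image_le) simp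
  also have "\<dots> = CARD('n) * (e + 1)" by simp
  finally have cB: "card B < card (w ` I)" using card True by (simp add: card_image)
  have "w ` I \<subseteq> C.span B"
  proof
    fix u assume "u \<in> w ` I"
    then have "\<forall>j. \<exists>p. g * u $ j = to_fract p \<and> degree p \<le> e" using poly by auto
    then obtain p where p: "\<And>j. g * u $ j = to_fract (p j)" "\<And>j. degree (p j) \<le> e" by metis
    have "u = (\<Sum>j\<in>UNIV. \<Sum>m\<le>e. k_const (coeff (p j) m) *s b (m, j))"
    proof (rule vec_eq_iff[THEN iffD2], rule allI)
      fix l
      have "(\<Sum>j\<in>UNIV. \<Sum>m\<le>e. k_const (coeff (p j) m) *s b (m, j)) $ l
          = (\<Sum>j\<in>UNIV. if j = l then (\<Sum>m\<le>e. k_const (coeff (p j) m) * (k_var ^ m / g)) else 0)"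
        unfolding sum_component by (rule sum.cong) (auto simp: b_def axis_def)
      also have "\<dots> = (\<Sum>m\<le>e. k_const (coeff (p l) m) * k_var ^ m) / g"
        by (simp add: sum_divide_distrib)
      also have "(\<Sum>m\<le>e. k_const (coeff (p l) m) * k_var ^ m) = to_fract (\<Sum>m\<le>e. monom (coeff (p l) m) m)"
        unfolding to_fract_sum
        by (rule sum.cong) (simp_all add: monom_altdef to_fract_smult to_fract_power k_var_def)
      also have "(\<Sum>m\<le>e. monom (coeff (p l) m) m) = p l"
        using p(2)[of l] by (rule poly_as_sum_of_monoms')
      also have "to_fract (p l) / g = u $ l" using p(1)[of l] \<open>g \<noteq> 0\<close> by (simp add: field_simps)
      finally show "u $ l = (\<Sum>j\<in>UNIV. \<Sum>m\<le>e. k_const (coeff (p j) m) *s b (m, j)) $ l" by simp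
    qed
    moreover have "k_const (coeff (p j) m) *s b (m, j) \<in> C.span B" if "m \<le> e" for m j
      by (rule C.span_scale, rule C.span_base) (use that in \<open>auto simp: B_def\<close>)
    ultimately show "u \<in> C.span B" by (auto intro!: C.span_sum)
  qed
  then have "C.dependent (w ` I)"
    using C.independent_span_bound[OF \<open>finite B\<close>, of "w ` I"] cB by auto
  then obtain u where u: "\<exists>v\<in>w ` I. u v \<noteq> 0" "(\<Sum>v\<in>w ` I. k_const (u v) *s v) = 0"
    using C.dependent_finite[of "w ` I"] \<open>finite I\<close> by auto
  then show ?thesis using True
    by (intro exI[of _ "\<lambda>i. u (w i)"]) (auto simp: sum.reindex)
qed

subsection \<open>Valuations\<close>

text \<open>The axioms common to the order at 0 and to minus the degree, so that the points 0 and
  infinity are treated at once. Nonzero arguments are required because no integer is a sensible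
  valuation of 0.\<close>

locale poly_valuation =
  fixes w :: "'c::field poly \<Rightarrow> int"
  assumes w_mult: "p \<noteq> 0 \<Longrightarrow> q \<noteq> 0 \<Longrightarrow> w (p * q) = w p + w q"
    and w_add: "p \<noteq> 0 \<Longrightarrow> q \<noteq> 0 \<Longrightarrow> p + q \<noteq> 0 \<Longrightarrow> min (w p) (w q) \<le> w (p + q)"
    and w_const: "c \<noteq> 0 \<Longrightarrow> w [:c:] = 0"
begin

definition val :: "'c ratfun \<Rightarrow> int"
  where "val f = (THE i. \<exists>a b. a \<noteq> 0 \<and> b \<noteq> 0 \<and> f = to_fract a / to_fract b \<and> i = w a - w b)"

lemma val_quot:
  assumes "a \<noteq> 0" "b \<noteq> 0" shows "val (to_fract a / to_fract b) = w a - w b"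
  unfolding val_def
proof (rule the_equality)
  show "\<exists>a' b'. a' \<noteq> 0 \<and> b' \<noteq> 0 \<and> to_fract a / to_fract b = to_fract a' / to_fract b' \<and> w a - w b = w a' - w b'"
    using assms by blast
next
  fix i assume "\<exists>a' b'. a' \<noteq> 0 \<and> b' \<noteq> 0 \<and> to_fract a / to_fract b = to_fract a' / to_fract b' \<and> i = w a' - w b'"
  then obtain a' b' where *: "a' \<noteq> 0" "b' \<noteq> 0" "to_fract a / to_fract b = to_fract a' / to_fract b'"
    "i = w a' - w b'" by blast
  then have "to_fract (a * b') = to_fract (a' * b)" using assms by (simp add: field_simps)
  then have "a * b' = a' * b" by (simp only: to_fract_eq_iff)
  then have "w a + w b' = w a' + w b" using * assms by (metis w_mult)
  then show "i = w a - w b" using * by simp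
qed

lemma nz_cases:
  assumes "f \<noteq> 0" obtains a b where "a \<noteq> 0" "b \<noteq> 0" "f = to_fract a / to_fract b"
  using assms by (metis ratfun_cases div_0 to_fract_0)

lemma val_to_fract: "a \<noteq> 0 \<Longrightarrow> val (to_fract a) = w a"
  using val_quot[of a 1] w_const[of 1] by (simp flip: one_pCons)

lemma val_mult: assumes "f \<noteq> 0" "g \<noteq> 0" shows "val (f * g) = val f + val g"
proof -
  obtain a b c d where "a \<noteq> 0" "b \<noteq> 0" "f = to_fract a / to_fract b" "c \<noteq> 0" "d \<noteq> 0"
    "g = to_fract c / to_fract d" using assms nz_cases by metis
  then show ?thesis using val_quot[of "a * c" "b * d"] by (simp add: val_quot w_mult)
qed

lemma val_1 [simp]: "val 1 = 0"
  using val_mult[of 1 1] by simp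

lemma val_const: "c \<noteq> 0 \<Longrightarrow> val (k_const c) = 0"
  by (simp add: k_const_def val_to_fract w_const)

lemma val_power: "f \<noteq> 0 \<Longrightarrow> val (f ^ m) = int m * val f"
  by (induction m) (simp_all add: val_mult algebra_simps)

lemma val_minus [simp]: "val (- f) = val f"
proof (cases "f = 0")
  case False
  then have "val (k_const (-1) * f) = val f"
    using val_const[of "-1"] val_mult[of "k_const (-1)" f] by (simp del: k_const_minus)
  then show ?thesis by simp
qed simp

lemma val_add:
  assumes "f \<noteq> 0" "g \<noteq> 0" "f + g \<noteq> 0" shows "min (val f) (val g) \<le> val (f + g)"
proof -
  obtain a b c d where *: "a \<noteq> 0" "b \<noteq> 0" "f = to_fract a / to_fract b" "c \<noteq> 0" "d \<noteq> 0"
    "g = to_fract c / to_fract d" using assms nz_cases by metis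
  from * have e: "f + g = to_fract (a * d + c * b) / to_fract (b * d)" by (simp add: field_simps)
  have "a * d + c * b \<noteq> 0"
  proof
    assume "a * d + c * b = 0"
    then have "f + g = 0" unfolding e by simp
    then show False using assms by simp
  qed
  then have "val (f + g) = w (a * d + c * b) - w (b * d)" using * e val_quot[of "a * d + c * b" "b * d"] by simp
  moreover have "min (w (a * d)) (w (c * b)) \<le> w (a * d + c * b)"
    using * \<open>a * d + c * b \<noteq> 0\<close> by (intro w_add) auto
  ultimately show ?thesis using * by (simp add: val_quot w_mult)
qed

text \<open>\<open>vge t f\<close> expresses that the valuation of \<open>f\<close> is at least \<open>t\<close>, with value \<open>\<infinity>\<close> at \<open>0\<close>.\<close>
definition vge :: "real \<Rightarrow> 'c ratfun \<Rightarrow> bool"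
  where "vge t f \<longleftrightarrow> f = 0 \<or> t \<le> of_int (val f)"

lemma vge_0 [simp]: "vge t 0" by (simp add: vge_def)

lemma vge_mono: "vge t f \<Longrightarrow> s \<le> t \<Longrightarrow> vge s f"
  by (auto simp: vge_def)

lemma vge_add: assumes "vge t f" "vge t g" shows "vge t (f + g)"
proof (cases "f = 0 \<or> g = 0 \<or> f + g = 0")
  case False
  then have "min (val f) (val g) \<le> val (f + g)" using val_add by blast
  then show ?thesis using assms False by (auto simp: vge_def min_def split: if_splits)
qed (use assms in \<open>auto simp: vge_def\<close>)

lemma vge_sum: "(\<And>i. i \<in> A \<Longrightarrow> vge t (f i)) \<Longrightarrow> vge t (sum f A)"
  by (induction A rule: infinite_finite_induct) (auto intro: vge_add)

lemma vge_mult: "vge s f \<Longrightarrow> vge t g \<Longrightarrow> vge (s + t) (f * g)"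
  by (cases "f = 0 \<or> g = 0") (auto simp: vge_def val_mult)

lemma vge_minus [simp]: "vge t (- f) \<longleftrightarrow> vge t f"
  by (simp add: vge_def)

lemma vge_exists: "\<exists>e::nat. vge (- real e) f"
proof
  show "vge (- real (nat (- val f))) f" by (auto simp: vge_def)
qed

lemma vge_exists_finite: "finite A \<Longrightarrow> \<exists>e::nat. \<forall>f\<in>A. vge (- real e) f"
proof (induction A rule: finite_induct)
  case (insert f A)
  then obtain e e' where "\<forall>f\<in>A. vge (- real e) f" "vge (- real e') f" using vge_exists by metis
  then have "\<forall>g\<in>insert f A. vge (- real (max e e')) g" by (auto elim!: vge_mono)
  then show ?case by blast
qed simp

end

lemma order_0_add:
  fixes p q :: "'c::field poly"
  assumes "p \<noteq> 0" "q \<noteq> 0" "p + q \<noteq> 0"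
  shows "min (order 0 p) (order 0 q) \<le> order 0 (p + q)"
proof -
  have "[:- 0, 1:] ^ min (order 0 p) (order 0 q) dvd p + q"
    using assms order_divides[of 0 _ p] order_divides[of 0 _ q] by (intro dvd_add) auto
  then show ?thesis using assms order_divides by blast
qed

interpretation val0: poly_valuation "\<lambda>p :: 'c::field poly. int (order 0 p)"
proof
  fix p q :: "'c poly"
  show "p \<noteq> 0 \<Longrightarrow> q \<noteq> 0 \<Longrightarrow> int (order 0 (p * q)) = int (order 0 p) + int (order 0 q)"
    by (simp add: order_mult)
  show "p \<noteq> 0 \<Longrightarrow> q \<noteq> 0 \<Longrightarrow> p + q \<noteq> 0 \<Longrightarrow>
    min (int (order 0 p)) (int (order 0 q)) \<le> int (order 0 (p + q))"
    using order_0_add[of p q] by linarith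
qed (simp add: order_0I)

interpretation vali: poly_valuation "\<lambda>p :: 'c::field poly. - int (degree p)"
proof
  fix p q :: "'c poly"
  show "p \<noteq> 0 \<Longrightarrow> q \<noteq> 0 \<Longrightarrow> - int (degree (p * q)) = - int (degree p) + - int (degree q)"
    by (simp add: degree_mult_eq)
  show "p \<noteq> 0 \<Longrightarrow> q \<noteq> 0 \<Longrightarrow> p + q \<noteq> 0 \<Longrightarrow>
    min (- int (degree p)) (- int (degree q)) \<le> - int (degree (p + q))"
    using degree_add_le_max[of p q] by linarith
qed simp

lemma val0_k_var [simp]: "val0.val k_var = 1"
proof -
  have "order 0 [:0, 1 :: 'a:] = 1"
    using order_power_n_n[of "0::'a" 1] by simp
  then show ?thesis by (simp add: k_var_def val0.val_to_fract)
qed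

lemma vali_k_var [simp]: "vali.val k_var = - 1"
  by (simp add: k_var_def vali.val_to_fract)

section \<open>Polynomials and Laurent polynomials\<close>

definition Pol :: "'c::field ratfun set"
  where "Pol = range to_fract"

definition Lau :: "'c::field ratfun set"
  where "Lau = {f. \<exists>m. k_var ^ m * f \<in> Pol}"

lemma Pol_closed:
  fixes f g :: "'c::field ratfun"
  shows "to_fract (p :: 'c poly) \<in> Pol" "(0 :: 'c ratfun) \<in> Pol" "(1 :: 'c ratfun) \<in> Pol" "k_const (c :: 'c) \<in> Pol" "(k_var :: 'c ratfun) \<in> Pol"
  "f \<in> Pol \<Longrightarrow> g \<in> Pol \<Longrightarrow> f + g \<in> Pol"
  "f \<in> Pol \<Longrightarrow> g \<in> Pol \<Longrightarrow> f * g \<in> Pol"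
proof -
  show p: "to_fract p \<in> Pol" for p :: "'c poly" by (simp add: Pol_def)
  show "(0 :: 'c ratfun) \<in> Pol" "(1 :: 'c ratfun) \<in> Pol" "k_const c \<in> Pol" "(k_var :: 'c ratfun) \<in> Pol"
    using p[of 0] p[of 1] by (auto simp: k_const_def k_var_def p)
  show "f \<in> Pol \<Longrightarrow> g \<in> Pol \<Longrightarrow> f + g \<in> Pol" "f \<in> Pol \<Longrightarrow> g \<in> Pol \<Longrightarrow> f * g \<in> Pol"
    by (auto simp: Pol_def simp flip: to_fract_add to_fract_mult)
qed

lemma Pol_power: "f \<in> Pol \<Longrightarrow> f ^ m \<in> Pol"
  by (induction m) (auto intro: Pol_closed)

lemma LauI: "k_var ^ m * f \<in> Pol \<Longrightarrow> f \<in> Lau"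
  by (auto simp: Lau_def)

lemma Pol_Lau: "f \<in> Pol \<Longrightarrow> f \<in> Lau"
  using LauI[of 0 f] by simp

lemma Lau_add: assumes "f \<in> Lau" "g \<in> Lau" shows "f + g \<in> Lau"
proof -
  obtain l m where "k_var ^ l * f \<in> Pol" "k_var ^ m * g \<in> Pol" using assms by (auto simp: Lau_def)
  then have "k_var ^ m * (k_var ^ l * f) + k_var ^ l * (k_var ^ m * g) \<in> Pol"
    by (simp add: Pol_closed Pol_power)
  then show ?thesis by (intro LauI[of "m + l"]) (simp add: power_add algebra_simps)
qed

lemma Lau_mult: assumes "f \<in> Lau" "g \<in> Lau" shows "f * g \<in> Lau"
proof -
  obtain l m where "k_var ^ l * f \<in> Pol" "k_var ^ m * g \<in> Pol" using assms by (auto simp: Lau_def)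
  then have "(k_var ^ l * f) * (k_var ^ m * g) \<in> Pol"
    by (rule Pol_closed(7))
  then show ?thesis by (intro LauI[of "l + m"]) (simp add: power_add algebra_simps)
qed

lemma Lau_sum: "(\<And>i. i \<in> A \<Longrightarrow> f i \<in> Lau) \<Longrightarrow> sum f A \<in> Lau"
  by (induction A rule: infinite_finite_induct) (auto intro: Lau_add Pol_Lau Pol_closed)

lemma Lau_divide_k_var: "f \<in> Lau \<longleftrightarrow> f / k_var ^ m \<in> Lau"
proof
  assume "f \<in> Lau"
  then obtain l where "k_var ^ l * f \<in> Pol" by (auto simp: Lau_def)
  then show "f / k_var ^ m \<in> Lau" by (intro LauI[of "l + m"]) (simp add: power_add)
next
  assume "f / k_var ^ m \<in> Lau"
  then have "k_var ^ m * (f / k_var ^ m) \<in> Lau" by (simp add: Lau_mult Pol_Lau Pol_power Pol_closed del: times_divide_eq_right)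
  then show "f \<in> Lau" by simp
qed

lemma Lau_val0_Pol:
  assumes "f \<in> Lau" "val0.vge 0 f" shows "f \<in> Pol"
proof (cases "f = 0")
  case False
  obtain m p where p: "k_var ^ m * f = to_fract p" using assms(1) by (auto simp: Lau_def Pol_def)
  with False have "p \<noteq> 0" by auto
  have "int (order 0 p) = int m + val0.val f"
    using False val0.val_to_fract[OF \<open>p \<noteq> 0\<close>] p by (metis val0.val_mult val0.val_power val0_k_var k_var_neq_0 power_not_zero mult.right_neutral)
  then have "m \<le> order 0 p" using assms(2) False by (simp add: val0.vge_def)
  then have "[:0, 1:] ^ m dvd p" using order_divides[of 0 m p] by simp
  then obtain q where "p = [:0, 1:] ^ m * q" by blast
  then have "k_var ^ m * f = k_var ^ m * to_fract q" using p by (simp add: k_var_def to_fract_power)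
  then show ?thesis by (simp add: Pol_closed)
qed (simp add: Pol_closed)

lemma vali_to_fract: "vali.vge (- real e) (to_fract p) \<Longrightarrow> degree p \<le> e"
  by (cases "p = 0") (auto simp: vali.vge_def vali.val_to_fract)

text \<open>Bounded poles at 0 and at infinity confine a Laurent polynomial to a space of finite
  dimension; the conclusion has the form needed by \<open>fd_dependent\<close>.\<close>

lemma Lau_bounded:
  assumes "f \<in> Lau" "val0.vge (- real e) f" "vali.vge (- real e') f"
  shows "\<exists>p. k_var ^ e * f = to_fract p \<and> degree p \<le> e + e'"
proof -
  have "val0.vge (real e + - real e) (k_var ^ e * f)"
    using assms(2) by (intro val0.vge_mult) (auto simp: val0.vge_def val0.val_power)
  then have "k_var ^ e * f \<in> Pol"
    using assms(1) by (intro Lau_val0_Pol Lau_mult) (auto intro: Pol_Lau Pol_power Pol_closed)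
  then obtain p where p: "k_var ^ e * f = to_fract p" by (auto simp: Pol_def)
  have "vali.vge (- real e + - real e') (k_var ^ e * f)"
    using assms(3) by (intro vali.vge_mult) (auto simp: vali.vge_def vali.val_power)
  then have "degree p \<le> e + e'" unfolding p by (intro vali_to_fract) simp
  then show ?thesis using p by blast
qed

section \<open>Poles along the orbits of two shifts or dilations\<close>

text \<open>Coprimality in Bezout form: the coefficients \<open>u\<close> and \<open>v\<close> serve
  to combine two denominators of one function or two annihilators of one vector.\<close>

definition cop :: "'a::comm_ring_1 \<Rightarrow> 'a \<Rightarrow> bool"
  where "cop a b \<longleftrightarrow> (\<exists>u v. u * a + v * b = 1)"

lemma cop_1 [simp]: "cop 1 b"
  unfolding cop_def by (rule exI[of _ 1], rule exI[of _ 0]) simp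

lemma cop_sym: "cop a b \<Longrightarrow> cop b a"
  unfolding cop_def by (metis add.commute)

lemma cop_mult: assumes "cop a c" "cop b c" shows "cop (a * b) c"
proof -
  obtain u v u' v' where "u * a + v * c = 1" "u' * b + v' * c = 1"
    using assms unfolding cop_def by blast
  then have "(u * a + v * c) * (u' * b + v' * c) = 1" by simp
  then have "(u * u') * (a * b) + (u * a * v' + v * u' * b + v * c * v') * c = 1"
    by (simp add: algebra_simps)
  then show ?thesis unfolding cop_def by blast
qed

lemma cop_prod: "(\<And>i. i \<in> A \<Longrightarrow> cop (f i) c) \<Longrightarrow> cop (prod f A) c"
  by (induction A rule: infinite_finite_induct) (auto intro: cop_mult)

text \<open>Euclid's algorithm on the degree of \<open>q\<close>. A zero remainder means that
  \<open>q\<close> divides \<open>p\<close>, and a nonconstant \<open>q\<close> then shares a root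
  with \<open>p\<close>.\<close>

lemma cop_no_common_root:
  fixes p q :: "'c::alg_closed_field poly"
  assumes "p \<noteq> 0 \<or> q \<noteq> 0" "\<And>y. poly p y = 0 \<Longrightarrow> poly q y \<noteq> 0"
  shows "cop p q"
  using assms
proof (induction "degree q" arbitrary: p q rule: less_induct)
  case less
  have const: "cop p' q'" if "degree p' = 0" "p' \<noteq> 0" for p' q' :: "'c poly"
  proof -
    from that obtain c where "p' = [:c:]" "c \<noteq> 0" by (metis degree_eq_zeroE pCons_0_0)
    then have "[:inverse c:] * p' + 0 * q' = 1" by (simp add: one_pCons)
    then show ?thesis unfolding cop_def by blast
  qed
  show ?case
  proof (cases "degree q = 0")
    case True
    show ?thesis
    proof (cases "q = 0")
      case True
      then have "degree p = 0" using less.prems alg_closed_imp_poly_has_root[of p] by auto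
      then show ?thesis using const less.prems True by auto
    qed (use const cop_sym True in blast)
  next
    case False
    then have "q \<noteq> 0" by auto
    define r where "r = p mod q"
    have p: "p = p div q * q + r" by (simp add: r_def)
    have "cop q r"
    proof (cases "r = 0")
      case True
      then have "poly p y = 0" if "poly q y = 0" for y using that p by (metis add.right_neutral mult_zero_right poly_mult)
      moreover obtain y where "poly q y = 0" using alg_closed_imp_poly_has_root[of q] False by auto
      ultimately show ?thesis using less.prems by blast
    next
      case r: False
      have "degree r < degree q" using False \<open>q \<noteq> 0\<close> r unfolding r_def
        by (metis degree_mod_less)
      moreover have "poly r y \<noteq> 0" if "poly q y = 0" for y
        using that less.prems(2)[of y] p by (metis add_0 mult_zero_right poly_add poly_mult)
      ultimately show ?thesis using less.hyps[of r q] \<open>q \<noteq> 0\<close> by blast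
    qed
    then obtain u v where "u * q + v * r = 1" unfolding cop_def by blast
    then have "v * p + (u - v * (p div q)) * q = 1"
      by (subst (1) p) (simp add: algebra_simps)
    then show ?thesis unfolding cop_def by blast
  qed
qed

section \<open>Semilinear operators and consistent systems\<close>

definition semilin :: "'f::field ^ 'n ^ 'n \<Rightarrow> ('f \<Rightarrow> 'f) \<Rightarrow> 'f ^ 'n \<Rightarrow> 'f ^ 'n"
  where "semilin D \<sigma> v = D *v vmap \<sigma> v"

lemma semilin_add: "field_hom \<sigma> \<Longrightarrow> semilin D \<sigma> (u + v) = semilin D \<sigma> u + semilin D \<sigma> v"
  by (simp add: semilin_def vmap_add matrix_vector_right_distrib)

lemma semilin_scale: "field_hom \<sigma> \<Longrightarrow> semilin D \<sigma> (a *s v) = \<sigma> a *s semilin D \<sigma> v"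
  by (simp add: semilin_def vmap_scale vector_scalar_commute)

lemma semilin_eq_0_iff:
  assumes "field_hom \<sigma>" "invertible D" shows "semilin D \<sigma> v = 0 \<longleftrightarrow> v = 0"
  using assms by (simp add: semilin_def invertible_mult_vec_eq_0 vmap_eq_0_iff)

lemma semilin_nth: "semilin D \<sigma> v $ l = (\<Sum>a\<in>UNIV. D $ l $ a * \<sigma> (v $ a))"
  by (simp add: semilin_def matrix_vector_mult_def)

lemma semilin_commute:
  assumes hom: "field_hom \<sigma>1" "field_hom \<sigma>2" and "\<And>f. \<sigma>1 (\<sigma>2 f) = \<sigma>2 (\<sigma>1 f)"
    and "D1 ** map_matrix \<sigma>1 D2 = D2 ** map_matrix \<sigma>2 D1"
  shows "semilin D1 \<sigma>1 (semilin D2 \<sigma>2 v) = semilin D2 \<sigma>2 (semilin D1 \<sigma>1 v)"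
proof -
  have "semilin D1 \<sigma>1 (semilin D2 \<sigma>2 v) = (D1 ** map_matrix \<sigma>1 D2) *v vmap (\<lambda>f. \<sigma>1 (\<sigma>2 f)) v"
    by (simp add: semilin_def vmap_mult hom vmap_comp matrix_vector_mul_assoc)
  moreover have "semilin D2 \<sigma>2 (semilin D1 \<sigma>1 v) = (D2 ** map_matrix \<sigma>2 D1) *v vmap (\<lambda>f. \<sigma>2 (\<sigma>1 f)) v"
    by (simp add: semilin_def vmap_mult hom vmap_comp matrix_vector_mul_assoc)
  ultimately show ?thesis using assms by simp
qed

text \<open>\<open>D1\<close> and \<open>D2\<close> stand for the inverses of the matrices of the
  system; \<open>consistent\<close> is the inverted consistency condition and makes
  \<open>\<Phi>1\<close> and \<open>\<Phi>2\<close> commute.\<close>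

locale consistent_system =
  fixes \<sigma>1 \<sigma>2 :: "'c::{alg_closed_field,field_char_0} ratfun \<Rightarrow> 'c ratfun"
    and D1 D2 :: "'c ratfun ^ 'n ^ 'n"
  assumes alg1: "C_alg_hom k_const k_const \<sigma>1" and alg2: "C_alg_hom k_const k_const \<sigma>2"
    and \<sigma>_commute: "\<sigma>1 (\<sigma>2 f) = \<sigma>2 (\<sigma>1 f)"
    and inv1: "invertible D1" and inv2: "invertible D2"
    and consistent: "D1 ** map_matrix \<sigma>1 D2 = D2 ** map_matrix \<sigma>2 D1"
begin

lemma hom1: "field_hom \<sigma>1" and hom2: "field_hom \<sigma>2"
  and const1 [simp]: "\<sigma>1 (k_const c) = k_const c" and const2 [simp]: "\<sigma>2 (k_const c) = k_const c"
  using alg1 alg2 by (auto simp: C_alg_hom_def)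

abbreviation "\<Phi>1 \<equiv> semilin D1 \<sigma>1"
abbreviation "\<Phi>2 \<equiv> semilin D2 \<sigma>2"

sublocale ops: commuting_ops "\<lambda>c v. k_const c *s (v :: 'c ratfun ^ 'n)" \<Phi>1 \<Phi>2
  by standard (simp_all add: semilin_add semilin_scale hom1 hom2
      semilin_commute[OF hom1 hom2 \<sigma>_commute consistent])

lemma \<Phi>1_eq_0 [simp]: "\<Phi>1 v = 0 \<longleftrightarrow> v = 0" and \<Phi>2_eq_0 [simp]: "\<Phi>2 v = 0 \<longleftrightarrow> v = 0"
  by (simp_all add: semilin_eq_0_iff hom1 hom2 inv1 inv2)

lemma \<Phi>1_iter_scale: "(\<Phi>1 ^^ i) (a *s v) = (\<sigma>1 ^^ i) a *s (\<Phi>1 ^^ i) v"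
  by (induction i) (simp_all add: semilin_scale hom1)

lemma \<Phi>2_iter_scale: "(\<Phi>2 ^^ i) (a *s v) = (\<sigma>2 ^^ i) a *s (\<Phi>2 ^^ i) v"
  by (induction i) (simp_all add: semilin_scale hom2)

lemma \<Phi>1_iter_add: "(\<Phi>1 ^^ i) (u + v) = (\<Phi>1 ^^ i) u + (\<Phi>1 ^^ i) v"
  by (induction i) (simp_all add: semilin_add hom1)

lemma \<Phi>2_iter_add: "(\<Phi>2 ^^ i) (u + v) = (\<Phi>2 ^^ i) u + (\<Phi>2 ^^ i) v"
  by (induction i) (simp_all add: semilin_add hom2)

lemma \<Phi>1_iter_eq_0: "(\<Phi>1 ^^ i) v = 0 \<longleftrightarrow> v = 0"
  by (induction i) simp_all

lemma \<Phi>2_iter_eq_0: "(\<Phi>2 ^^ i) v = 0 \<longleftrightarrow> v = 0"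
  by (induction i) simp_all

lemma const_iter [simp]: "(\<sigma>1 ^^ i) (k_const c) = k_const c" "(\<sigma>2 ^^ i) (k_const c) = k_const c"
  by (induction i) simp_all

lemma \<Phi>12_commute: "\<Phi>1 (\<Phi>2 v) = \<Phi>2 (\<Phi>1 v)"
  by (simp add: ops.comm)

lemma \<Phi>12_iter_commute1: "(\<Phi>1 ^^ i) (\<Phi>2 v) = \<Phi>2 ((\<Phi>1 ^^ i) v)"
  by (induction i) (simp_all add: \<Phi>12_commute)

lemma \<Phi>12_iter_commute2: "\<Phi>1 ((\<Phi>2 ^^ i) v) = (\<Phi>2 ^^ i) (\<Phi>1 v)"
  by (induction i) (simp_all add: \<Phi>12_commute)

lemma \<Phi>12_iter_commute: "(\<Phi>1 ^^ i) ((\<Phi>2 ^^ j) v) = (\<Phi>2 ^^ j) ((\<Phi>1 ^^ i) v)"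
  by (induction j) (simp_all add: \<Phi>12_iter_commute1)

end

text \<open>The common frame of cases 2S and 2Q. \<open>\<phi>1\<close> and \<open>\<phi>2\<close>
  move the points of C, and the monoid they generate acts freely on \<open>Y\<close>: all of C for
  shifts, the nonzero points for dilations. \<open>R\<close> consists of the functions without poles
  in \<open>Y\<close>, and \<open>bd e\<close> bounds by \<open>e\<close> the poles at the remaining
  points of the projective line. The degree \<open>2 * e\<close> in \<open>bd_poly\<close> allows
  for a pole of order \<open>e\<close> both at 0 and at infinity.\<close>

locale free_system = consistent_system \<sigma>1 \<sigma>2 D1 D2
  for \<sigma>1 \<sigma>2 :: "'c::{alg_closed_field,field_char_0} ratfun \<Rightarrow> 'c ratfun"
    and D1 D2 :: "'c ratfun ^ 'n ^ 'n" +
  fixes s1 s2 :: "'c poly \<Rightarrow> 'c poly" and \<phi>1 \<phi>2 :: "'c \<Rightarrow> 'c"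
    and Y :: "'c set" and R :: "'c ratfun set" and bd :: "nat \<Rightarrow> 'c ratfun \<Rightarrow> bool"
  assumes s1: "\<sigma>1 (to_fract p) = to_fract (s1 p)" and s2: "\<sigma>2 (to_fract p) = to_fract (s2 p)"
    and poly_s1: "poly (s1 p) y = poly p (\<phi>1 y)" and poly_s2: "poly (s2 p) y = poly p (\<phi>2 y)"
    and s2_surj: "\<exists>p'. s2 p' = p"
    and \<phi>_commute: "\<phi>1 (\<phi>2 y) = \<phi>2 (\<phi>1 y)"
    and \<phi>_Y: "\<phi>1 y \<in> Y \<longleftrightarrow> y \<in> Y" "\<phi>2 y \<in> Y \<longleftrightarrow> y \<in> Y"
    and free: "y \<in> Y \<Longrightarrow> (\<phi>1 ^^ i) ((\<phi>2 ^^ j) y) = (\<phi>1 ^^ i') ((\<phi>2 ^^ j') y) \<Longrightarrow> i = i' \<and> j = j'"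
    and Pol_R: "Pol \<subseteq> R" and R_add: "f \<in> R \<Longrightarrow> g \<in> R \<Longrightarrow> f + g \<in> R"
    and R_mult: "f \<in> R \<Longrightarrow> g \<in> R \<Longrightarrow> f * g \<in> R"
    and R_\<sigma>: "f \<in> R \<Longrightarrow> \<sigma>1 f \<in> R" "f \<in> R \<Longrightarrow> \<sigma>2 f \<in> R"
    and den: "\<exists>d. d \<noteq> 0 \<and> {y. poly d y = 0} \<subseteq> Y \<and> to_fract d * f \<in> R"
    and bd_mono: "bd e f \<Longrightarrow> e \<le> e' \<Longrightarrow> bd e' f"
    and bd_0: "bd e 0"
    and bd_add: "bd e f \<Longrightarrow> bd e g \<Longrightarrow> bd e (f + g)"
    and bd_mult: "bd e f \<Longrightarrow> bd e' g \<Longrightarrow> bd (e + e') (f * g)"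
    and bd_\<sigma>: "bd e f \<Longrightarrow> bd e (\<sigma>1 f)"
    and bd_ex: "\<exists>e. bd e f"
    and bd_poly: "f \<in> R \<Longrightarrow> bd e f \<Longrightarrow> \<exists>p. k_var ^ e * f = to_fract p \<and> degree p \<le> 2 * e"
begin

lemma R_sum: "(\<And>i. i \<in> A \<Longrightarrow> f i \<in> R) \<Longrightarrow> sum f A \<in> R"
  by (induction A rule: infinite_finite_induct) (use Pol_R in \<open>auto intro: R_add Pol_closed\<close>)

lemma R_to_fract [simp]: "to_fract p \<in> R"
  using Pol_R Pol_closed by blast

lemma s_simps: "s1 (p * q) = s1 p * s1 q" "s2 (p * q) = s2 p * s2 q" "s1 1 = 1" "s2 1 = 1"
  "s1 p = 0 \<longleftrightarrow> p = 0" "s2 p = 0 \<longleftrightarrow> p = 0"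
proof -
  have "to_fract (s1 (p * q)) = to_fract (s1 p * s1 q)" "to_fract (s2 (p * q)) = to_fract (s2 p * s2 q)"
    "to_fract (s1 1) = to_fract 1" "to_fract (s2 1) = to_fract 1"
    by (simp_all add: field_hom_simps hom1 hom2 flip: s1 s2)
  then show "s1 (p * q) = s1 p * s1 q" "s2 (p * q) = s2 p * s2 q" "s1 1 = 1" "s2 1 = 1"
    by (simp_all only: to_fract_eq_iff)
  have "to_fract (s1 p) = 0 \<longleftrightarrow> p = 0" "to_fract (s2 p) = 0 \<longleftrightarrow> p = 0"
    by (simp_all add: field_hom_eq_0_iff hom1 hom2 flip: s1 s2)
  then show "s1 p = 0 \<longleftrightarrow> p = 0" "s2 p = 0 \<longleftrightarrow> p = 0" by simp_all
qed

lemma s_commute: "s1 (s2 p) = s2 (s1 p)"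
proof -
  have "to_fract (s1 (s2 p)) = to_fract (s2 (s1 p))" by (simp only: s1[symmetric] s2[symmetric] \<sigma>_commute)
  then show ?thesis by (simp only: to_fract_eq_iff)
qed

lemma s_iter_simps: "(s1 ^^ i) (p * q) = (s1 ^^ i) p * (s1 ^^ i) q" "(s2 ^^ i) (p * q) = (s2 ^^ i) p * (s2 ^^ i) q"
  "(s1 ^^ i) 1 = 1" "(s2 ^^ i) 1 = 1"
  "(s1 ^^ i) p = 0 \<longleftrightarrow> p = 0" "(s2 ^^ i) p = 0 \<longleftrightarrow> p = 0"
  by (induction i) (simp_all add: s_simps)

lemma s_iter_prod: "(s1 ^^ i) (prod f A) = (\<Prod>t\<in>A. (s1 ^^ i) (f t))"
  "(s2 ^^ i) (prod f A) = (\<Prod>t\<in>A. (s2 ^^ i) (f t))"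
  by (induction A rule: infinite_finite_induct) (simp_all add: s_iter_simps)

lemma s_iter_commute: "(s2 ^^ j) ((s1 ^^ i) p) = (s1 ^^ i) ((s2 ^^ j) p)"
proof -
  have 1: "s2 ((s1 ^^ i) p) = (s1 ^^ i) (s2 p)" for i p
    by (induction i) (simp_all add: s_commute[symmetric])
  show ?thesis by (induction j) (simp_all add: 1)
qed

lemma \<sigma>_iter: "(\<sigma>1 ^^ i) (to_fract p) = to_fract ((s1 ^^ i) p)"
  "(\<sigma>2 ^^ i) (to_fract p) = to_fract ((s2 ^^ i) p)"
  by (induction i) (simp_all add: s1 s2)

lemma s2_iter_surj: "\<exists>p'. (s2 ^^ r) p' = p"
proof (induction r arbitrary: p)
  case (Suc r)
  obtain q where "s2 q = p" using s2_surj by blast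
  moreover obtain p' where "(s2 ^^ r) p' = q" using Suc by blast
  ultimately show ?case by auto
qed simp

lemma poly_s_iter: "poly ((s1 ^^ i) ((s2 ^^ j) p)) y = poly p ((\<phi>1 ^^ i) ((\<phi>2 ^^ j) y))"
proof -
  have 1: "poly ((s1 ^^ i) p) y = poly p ((\<phi>1 ^^ i) y)" for i p y
    by (induction i arbitrary: y) (simp_all add: poly_s1 funpow_swap1[of \<phi>1])
  have 2: "poly ((s2 ^^ i) p) y = poly p ((\<phi>2 ^^ i) y)" for i p y
    by (induction i arbitrary: y) (simp_all add: poly_s2 funpow_swap1[of \<phi>2])
  have 3: "(\<phi>2 ^^ j) (\<phi>1 y) = \<phi>1 ((\<phi>2 ^^ j) y)" for j y
    by (induction j) (simp_all add: \<phi>_commute)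
  have "(\<phi>2 ^^ j) ((\<phi>1 ^^ i) y) = (\<phi>1 ^^ i) ((\<phi>2 ^^ j) y)"
    by (induction i) (simp_all add: 3)
  then show ?thesis by (simp add: 1 2)
qed

text \<open>A common root of two transforms of \<open>d\<close> gives a point whose orbit passes
  through two zeros of \<open>d\<close>. By freeness the displacement between the two passages
  depends only on the pair of zeros, and there are finitely many pairs.\<close>

lemma eventually_cop:
  assumes d: "d \<noteq> 0" "{y. poly d y = 0} \<subseteq> Y"
  shows "\<exists>r. \<forall>i j i' j'. i + r \<le> i' \<or> i' + r \<le> i \<or> j + r \<le> j' \<or> j' + r \<le> j \<longrightarrow>
    cop ((s1 ^^ i) ((s2 ^^ j) d)) ((s1 ^^ i') ((s2 ^^ j') d))"
proof -
  define Z where "Z = {y. poly d y = 0}"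
  define \<phi> where "\<phi> i j y = (\<phi>1 ^^ i) ((\<phi>2 ^^ j) y)" for i j y
  have c2: "(\<phi>2 ^^ j) ((\<phi>1 ^^ i) y) = (\<phi>1 ^^ i) ((\<phi>2 ^^ j) y)" for i j y
  proof -
    have 3: "(\<phi>2 ^^ j) (\<phi>1 y) = \<phi>1 ((\<phi>2 ^^ j) y)" for j y
      by (induction j) (simp_all add: \<phi>_commute)
    show ?thesis by (induction i) (simp_all add: 3)
  qed
  have \<phi>_add: "\<phi> i j (\<phi> i' j' y) = \<phi> (i + i') (j + j') y" for i j i' j' y
    by (simp add: \<phi>_def funpow_add c2)
  have \<phi>_Y': "\<phi> i j y \<in> Y \<longleftrightarrow> y \<in> Y" for i j y
  proof -
    have "(\<phi>1 ^^ i) y \<in> Y \<longleftrightarrow> y \<in> Y" "(\<phi>2 ^^ i) y \<in> Y \<longleftrightarrow> y \<in> Y" for i y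
      by (induction i) (simp_all add: \<phi>_Y)
    then show ?thesis by (simp add: \<phi>_def)
  qed
  define rel where "rel s s' i j i' j' \<longleftrightarrow> (\<exists>y. \<phi> i j y = s \<and> \<phi> i' j' y = s')" for s s' i j i' j'
  have unique: "i + k' = i' + k \<and> j + l' = j' + l"
    if s: "s \<in> Z" and "rel s s' i j i' j'" "rel s s' k l k' l'" for s s' i j i' j' k l k' l'
  proof -
    from that obtain y z where *: "\<phi> i j y = s" "\<phi> i' j' y = s'" "\<phi> k l z = s" "\<phi> k' l' z = s'"
      unfolding rel_def by blast
    have "\<phi> (i + k') (j + l') y = \<phi> (i' + k) (j' + l) y"
      using * \<phi>_add by (metis add.commute)
    moreover have "y \<in> Y" using s d * \<phi>_Y' unfolding Z_def by blast
    ultimately show ?thesis using free[of y] unfolding \<phi>_def by blast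
  qed
  have "finite Z" unfolding Z_def by (rule poly_roots_finite[OF d(1)])
  have ex: "\<exists>r. \<forall>i j i' j'. rel s s' i j i' j' \<longrightarrow> i < i' + r \<and> i' < i + r \<and> j < j' + r \<and> j' < j + r"
    if "s \<in> Z" for s s'
  proof (cases "\<exists>i j i' j'. rel s s' i j i' j'")
    case True
    then obtain k l k' l' where k: "rel s s' k l k' l'" by blast
    show ?thesis
      by (rule exI[of _ "Suc (k + l + k' + l')"]) (use unique[OF that _ k] in fastforce)
  qed auto
  then obtain rr where rr: "\<And>s s' i j i' j'. s \<in> Z \<Longrightarrow> rel s s' i j i' j' \<Longrightarrow>
      i < i' + rr s s' \<and> i' < i + rr s s' \<and> j < j' + rr s s' \<and> j' < j + rr s s'" by metis
  define r where "r = Max (insert 0 ((\<lambda>(s, s'). rr s s') ` (Z \<times> Z)))"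
  have r: "rr s s' \<le> r" if "s \<in> Z" "s' \<in> Z" for s s'
    unfolding r_def by (rule Max_ge) (use that \<open>finite Z\<close> in auto)
  have "cop ((s1 ^^ i) ((s2 ^^ j) d)) ((s1 ^^ i') ((s2 ^^ j') d))"
    if far: "i + r \<le> i' \<or> i' + r \<le> i \<or> j + r \<le> j' \<or> j' + r \<le> j" for i j i' j'
  proof (rule cop_no_common_root)
    show "(s1 ^^ i) ((s2 ^^ j) d) \<noteq> 0 \<or> (s1 ^^ i') ((s2 ^^ j') d) \<noteq> 0"
      using d by (simp add: s_iter_simps)
    fix y assume 1: "poly ((s1 ^^ i) ((s2 ^^ j) d)) y = 0"
    show "poly ((s1 ^^ i') ((s2 ^^ j') d)) y \<noteq> 0"
    proof
      assume 2: "poly ((s1 ^^ i') ((s2 ^^ j') d)) y = 0"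
      have "\<phi> i j y \<in> Z" "\<phi> i' j' y \<in> Z" using 1 2 by (simp_all add: poly_s_iter Z_def \<phi>_def)
      moreover have "rel (\<phi> i j y) (\<phi> i' j' y) i j i' j'" by (auto simp: rel_def)
      ultimately show False using rr r far by (meson add_le_mono le_refl less_le_trans not_le)
    qed
  qed
  then show ?thesis by blast
qed

lemma common_den:
  assumes "finite A"
  shows "\<exists>d. d \<noteq> 0 \<and> {y. poly d y = 0} \<subseteq> Y \<and> (\<forall>f\<in>A. to_fract d * f \<in> R)"
  using assms
proof (induction A rule: finite_induct)
  case empty
  show ?case by (intro exI[of _ 1]) auto
next
  case (insert f A)
  obtain d where d: "d \<noteq> 0" "{y. poly d y = 0} \<subseteq> Y" "\<forall>f\<in>A. to_fract d * f \<in> R"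
    using insert by blast
  obtain d' where d': "d' \<noteq> 0" "{y. poly d' y = 0} \<subseteq> Y" "to_fract d' * f \<in> R"
    using den by blast
  have "to_fract (d * d') * g \<in> R" if "g \<in> insert f A" for g
  proof (cases "g = f")
    case True
    then show ?thesis using R_mult[OF R_to_fract d'(3), of d] by (simp add: ac_simps)
  next
    case False
    then show ?thesis using that d(3) R_mult[OF R_to_fract, of "to_fract d * g" d'] by (simp add: ac_simps)
  qed
  then show ?case using d d' by (intro exI[of _ "d * d'"]) auto
qed

text \<open>Along either of the two monotone lattice paths from the origin to \<open>(i, j)\<close> only steps close
  to one of the two end points lie close to the other path, so the poles picked up in the
  middle of the paths cancel.\<close>
lemma bounded_denominators:
  "\<exists>h h' r. h \<noteq> 0 \<and> h' \<noteq> 0 \<and> (\<forall>i\<ge>r. \<forall>j\<ge>r. \<forall>l m.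
    to_fract h * (\<Phi>1 ^^ i) ((\<Phi>2 ^^ j) (to_fract h' *s axis m 1)) $ l \<in> R)"
proof -
  define ent where "ent = (\<lambda>(a, b). D1 $ a $ b) ` UNIV \<union> (\<lambda>(a, b). D2 $ a $ b) ` UNIV"
  have "finite ent" by (simp add: ent_def)
  from common_den[OF this] obtain d where d: "d \<noteq> 0" "{y. poly d y = 0} \<subseteq> Y"
    and dent: "\<forall>f\<in>ent. to_fract d * f \<in> R" by blast
  have dD: "to_fract d * D1 $ a $ b \<in> R" "to_fract d * D2 $ a $ b \<in> R" for a b
    by (rule dent[rule_format], auto simp: ent_def intro!: rev_image_eqI[of "(a, b)"])+
  obtain r where r: "\<And>i j i' j'. i + r \<le> i' \<or> i' + r \<le> i \<or> j + r \<le> j' \<or> j' + r \<le> j \<Longrightarrow>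
    cop ((s1 ^^ i) ((s2 ^^ j) d)) ((s1 ^^ i') ((s2 ^^ j') d))"
    using eventually_cop[OF d] by blast
  define RV where "RV v \<longleftrightarrow> (\<forall>l. v $ l \<in> R)" for v :: "'c ratfun ^ 'n"
  \<comment> \<open>\<open>A1 i\<close> and \<open>A2 i\<close> collect the denominators along
    \<open>i\<close> steps in a single direction. A path that turns once has one of them times a
    transform of the other.\<close>
  define A1 where "A1 i = (\<Prod>t<i. (s1 ^^ t) d)" for i
  define A2 where "A2 i = (\<Prod>t<i. (s2 ^^ t) d)" for i
  have RV_scale: "RV (f *s v)" if "f \<in> R" "RV v" for f v
    using that by (simp add: RV_def R_mult)
  have step1: "RV (to_fract d *s \<Phi>1 v)" and step2: "RV (to_fract d *s \<Phi>2 v)" if "RV v" for v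
  proof -
    have "(to_fract d *s \<Phi>1 v) $ l = (\<Sum>a\<in>UNIV. (to_fract d * D1 $ l $ a) * \<sigma>1 (v $ a))"
      "(to_fract d *s \<Phi>2 v) $ l = (\<Sum>a\<in>UNIV. (to_fract d * D2 $ l $ a) * \<sigma>2 (v $ a))" for l
      by (simp_all add: semilin_def matrix_vector_mult_def sum_distrib_left mult.assoc)
    then show "RV (to_fract d *s \<Phi>1 v)" "RV (to_fract d *s \<Phi>2 v)"
      using that by (auto simp: RV_def intro!: R_sum R_mult R_\<sigma> dD)
  qed
  have A1_Suc: "A1 (Suc i) = d * s1 (A1 i)" for i
    unfolding A1_def prod.lessThan_Suc_shift by (simp add: s_iter_prod(1)[of 1, simplified])
  have A2_Suc: "A2 (Suc i) = d * s2 (A2 i)" for i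
    unfolding A2_def prod.lessThan_Suc_shift by (simp add: s_iter_prod(2)[of 1, simplified])
  have path1: "RV (to_fract (A1 i) *s (\<Phi>1 ^^ i) v)" if "RV v" for i v
  proof (induction i)
    case (Suc i)
    from step1[OF this] show ?case
      by (simp add: semilin_scale hom1 s1 A1_Suc vector_smult_assoc)
  qed (use that in \<open>simp add: A1_def RV_def\<close>)
  have path2: "RV (to_fract (A2 i) *s (\<Phi>2 ^^ i) v)" if "RV v" for i v
  proof (induction i)
    case (Suc i)
    from step2[OF this] show ?case
      by (simp add: semilin_scale hom2 s2 A2_Suc vector_smult_assoc)
  qed (use that in \<open>simp add: A2_def RV_def\<close>)
  have path12: "RV (to_fract (A1 i * (s1 ^^ i) (A2 j)) *s (\<Phi>1 ^^ i) ((\<Phi>2 ^^ j) v))" if "RV v" for i j v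
    using path1[OF path2[OF that], of i j] by (simp add: \<Phi>1_iter_scale \<sigma>_iter vector_smult_assoc)
  have path21: "RV (to_fract (A2 j * (s2 ^^ j) (A1 i)) *s (\<Phi>1 ^^ i) ((\<Phi>2 ^^ j) v))" if "RV v" for i j v
    using path2[OF path1[OF that], of j i]
    by (simp add: \<Phi>2_iter_scale \<sigma>_iter vector_smult_assoc \<Phi>12_iter_commute)
  \<comment> \<open>Multiplying the starting vector by \<open>h'\<close> supplies, after
    \<open>j\<close> steps, exactly the last \<open>r\<close> factors of
    \<open>A2 j\<close>.\<close>
  obtain h' where h': "(s2 ^^ r) h' = A2 r" using s2_iter_surj by blast
  have nz: "A1 r \<noteq> 0" "A2 r \<noteq> 0" using d by (auto simp: A1_def A2_def s_iter_simps)
  then have "h' \<noteq> 0" using h' s_iter_simps(6)[of r h'] by auto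
  have main: "RV (to_fract (A1 r) *s (\<Phi>1 ^^ i) ((\<Phi>2 ^^ j) (to_fract h' *s v)))"
    if "RV v" "i \<ge> r" "j \<ge> r" for i j v
  proof -
    \<comment> \<open>The denominators of the first path that stay away from its two ends; they are
      coprime to the whole denominator \<open>B\<close> of the second path. The remaining ones are
      the fixed \<open>A1 r\<close> and the factor \<open>E\<close> supplied by
      \<open>h'\<close>.\<close>
    define mid where "mid = (\<Prod>t\<in>{r..<i}. (s1 ^^ t) d) * (s1 ^^ i) (A2 (j - r))"
    define B where "B = A2 j * (s2 ^^ j) (A1 i)"
    define E where "E = (s1 ^^ i) ((s2 ^^ j) h')"
    define u where "u = (\<Phi>1 ^^ i) ((\<Phi>2 ^^ j) v)"
    have "A1 i = A1 r * (\<Prod>t\<in>{r..<i}. (s1 ^^ t) d)"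
      unfolding A1_def using that by (subst prod.union_disjoint[symmetric]) (auto intro!: prod.cong)
    moreover have "A2 j = A2 (j - r) * (s2 ^^ (j - r)) (A2 r)"
    proof -
      have "A2 j = A2 (j - r) * (\<Prod>t\<in>{j-r..<j}. (s2 ^^ t) d)"
        unfolding A2_def using that by (subst prod.union_disjoint[symmetric]) (auto intro!: prod.cong)
      also have "(\<Prod>t\<in>{j-r..<j}. (s2 ^^ t) d) = (\<Prod>t<r. (s2 ^^ (j - r + t)) d)"
        by (rule prod.reindex_bij_witness[of _ "\<lambda>t. j - r + t" "\<lambda>t. t - (j - r)"]) (use that in auto)
      also have "\<dots> = (s2 ^^ (j - r)) (A2 r)"
        by (simp add: A2_def s_iter_prod funpow_add)
      finally show ?thesis .
    qed
    moreover have "(s2 ^^ (j - r)) (A2 r) = (s2 ^^ j) h'"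
      using that by (simp flip: h' add: funpow_add[symmetric, THEN fun_cong, simplified])
    ultimately have A: "A1 i * (s1 ^^ i) (A2 j) = A1 r * mid * E"
      by (simp add: mid_def E_def s_iter_simps ac_simps)
    have copB: "cop c B" if "\<And>t. t < j \<Longrightarrow> cop c ((s1 ^^ 0) ((s2 ^^ t) d))"
      "\<And>t. t < i \<Longrightarrow> cop c ((s1 ^^ t) ((s2 ^^ j) d))" for c
    proof -
      have "(s2 ^^ j) (A1 i) = (\<Prod>t<i. (s1 ^^ t) ((s2 ^^ j) d))"
        by (simp add: A1_def s_iter_prod s_iter_commute)
      then show ?thesis unfolding B_def A2_def
        using that by (auto intro!: cop_sym[of _ c] cop_mult cop_prod intro: cop_sym)
    qed
    have "cop mid B" unfolding mid_def
    proof (intro cop_mult cop_prod)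
      fix t assume "t \<in> {r..<i}"
      then have "cop ((s1 ^^ t) ((s2 ^^ 0) d)) B"
        using that by (intro copB r) auto
      then show "cop ((s1 ^^ t) d) B" by simp
    next
      have "(s1 ^^ i) (A2 (j - r)) = (\<Prod>t<j-r. (s1 ^^ i) ((s2 ^^ t) d))"
        by (simp add: A2_def s_iter_prod)
      moreover have "cop ((s1 ^^ i) ((s2 ^^ t) d)) B" if "t < j - r" for t
        using that \<open>i \<ge> r\<close> by (intro copB r) auto
      ultimately show "cop ((s1 ^^ i) (A2 (j - r))) B" by (auto intro: cop_prod)
    qed
    then obtain a b where ab: "a * mid + b * B = 1" unfolding cop_def by blast
    have "RV (to_fract (A1 r * E) *s u)"
    proof -
      have "to_fract (A1 r * E) *s u = to_fract (A1 r * E * (a * mid + b * B)) *s u" by (simp add: ab)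
      also have "A1 r * E * (a * mid + b * B) = a * (A1 r * mid * E) + b * A1 r * E * B"
        by (simp add: algebra_simps)
      also have "to_fract \<dots> *s u = to_fract a *s (to_fract (A1 r * mid * E) *s u)
          + to_fract (b * A1 r * E) *s (to_fract B *s u)"
        by (simp add: vec_eq_iff algebra_simps)
      finally show ?thesis
        using RV_scale[OF R_to_fract path12[OF \<open>RV v\<close>], of a i j]
          RV_scale[OF R_to_fract path21[OF \<open>RV v\<close>], of "b * A1 r * E" j i]
        unfolding A[symmetric] B_def[symmetric] u_def[symmetric] RV_def by (auto intro: R_add)
    qed
    moreover have "to_fract (A1 r) *s (\<Phi>1 ^^ i) ((\<Phi>2 ^^ j) (to_fract h' *s v)) = to_fract (A1 r * E) *s u"
      by (simp add: \<Phi>1_iter_scale \<Phi>2_iter_scale \<sigma>_iter E_def u_def vector_smult_assoc)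
    ultimately show ?thesis by simp
  qed
  show ?thesis
    by (rule exI[of _ "A1 r"], rule exI[of _ h'], rule exI[of _ r])
      (use main[unfolded RV_def] nz \<open>h' \<noteq> 0\<close> in \<open>auto simp: axis_def RV_def Pol_R[THEN subsetD] Pol_closed\<close>)
qed

text \<open>Each application of \<open>\<Phi>1\<close> raises the pole bound by a constant
  \<open>c\<close>, so the iterates up to \<open>N\<close> of \<open>m0 + 1\<close> vectors lie in a
  C-space whose dimension grows like \<open>2 * n * c * N\<close>. Their number is
  \<open>(m0 + 1) * (N + 1)\<close>, which wins for \<open>m0 = 2 * n * c\<close> and large
  \<open>N\<close>.\<close>

lemma rank_bound:
  fixes r :: nat
  assumes "h \<noteq> 0"
  defines "L \<equiv> {v. \<forall>i\<ge>r. \<forall>j\<ge>r. \<forall>l. to_fract h * (\<Phi>1 ^^ i) ((\<Phi>2 ^^ j) v) $ l \<in> R}"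
  shows "\<exists>m0::nat. \<forall>w. (\<forall>i\<le>m0. w i \<in> L) \<longrightarrow>
    (\<exists>f. (\<exists>i\<le>m0. f i \<noteq> 0) \<and> (\<Sum>i\<le>m0. ops.op_T.act (f i) (w i)) = 0)"
proof -
  have bd_sum: "bd e (sum f A)" if "\<And>i. i \<in> A \<Longrightarrow> bd e (f i)" for e A and f :: "'n \<Rightarrow> _"
    using that by (induction A rule: infinite_finite_induct) (auto intro: bd_add bd_0)
  have bd_fin: "\<exists>e. \<forall>f\<in>A. bd e f" if "finite A" for A
    using that
  proof (induction A rule: finite_induct)
    case (insert f A)
    then obtain e e' where "\<forall>g\<in>A. bd e g" "bd e' f" using bd_ex by blast
    then have "\<forall>g\<in>insert f A. bd (max e e') g"
      by (metis bd_mono insert_iff max.cobounded1 max.cobounded2)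
    then show ?case by blast
  qed simp
  have "finite (range (\<lambda>(a, b). D1 $ a $ b))" by simp
  from bd_fin[OF this] obtain c where c: "\<And>a b. bd c (D1 $ a $ b)" by auto
  obtain eh where eh: "bd eh (to_fract h)" using bd_ex by blast
  define n where "n = CARD('n)"
  define m0 where "m0 = 2 * n * c"
  show ?thesis
  proof (intro exI[of _ m0] allI impI)
    fix w assume w: "\<forall>i\<le>m0. w i \<in> L"
    \<comment> \<open>Regularity after multiplication by \<open>h\<close> is known only from
      \<open>r\<close> steps on. The shift is undone at the end by injectivity of
      \<open>\<Phi>1\<close> and \<open>\<Phi>2\<close>.\<close>
    define u where "u i = (\<Phi>1 ^^ r) ((\<Phi>2 ^^ r) (w i))" for i
    have "finite ((\<lambda>(i, l). u i $ l) ` ({..m0} \<times> (UNIV :: 'n set)))" by simp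
    from bd_fin[OF this] obtain e where "\<forall>f\<in>((\<lambda>(i, l). u i $ l) ` ({..m0} \<times> (UNIV :: 'n set))). bd e f"
      by blast
    then have e: "bd e (u i $ l)" if "i \<le> m0" for i l
      using that by auto
    define e' where "e' = e + eh"
    \<comment> \<open>With this value the dimension bound equals \<open>m0 * N + N\<close>, just
      below \<open>(m0 + 1) * (N + 1)\<close>.\<close>
    define N where "N = n * (2 * e' + 1)"
    have bdu: "bd (e + c * k) ((\<Phi>1 ^^ k) (u i) $ l)" if "i \<le> m0" for i k l
    proof (induction k arbitrary: l)
      case (Suc k)
      have "bd (c + (e + c * k)) (D1 $ l $ a * \<sigma>1 ((\<Phi>1 ^^ k) (u i) $ a))" for a
        by (intro bd_mult c bd_\<sigma> Suc)
      then show ?case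
        by (auto simp: semilin_nth algebra_simps intro!: bd_sum)
    qed (use e that in simp)
    have hR: "to_fract h * (\<Phi>1 ^^ k) (u i) $ l \<in> R" if "i \<le> m0" for i k l
    proof -
      have "(\<Phi>1 ^^ k) (u i) = (\<Phi>1 ^^ (k + r)) ((\<Phi>2 ^^ r) (w i))" by (simp add: u_def funpow_add)
      then show ?thesis using w that unfolding L_def by (auto dest!: spec[of _ i])
    qed
    have poly: "\<exists>p. (k_var ^ (e' + c * N) * to_fract h) * (\<Phi>1 ^^ k) (u i) $ l = to_fract p
        \<and> degree p \<le> 2 * (e' + c * N)" if "i \<le> m0" "k \<le> N" for i k l
    proof -
      have "bd (eh + (e + c * k)) (to_fract h * (\<Phi>1 ^^ k) (u i) $ l)"
        using that by (intro bd_mult eh bdu)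
      then have "bd (e' + c * N) (to_fract h * (\<Phi>1 ^^ k) (u i) $ l)"
        by (rule bd_mono) (use that in \<open>simp add: e'_def\<close>)
      from bd_poly[OF hR[OF that(1)] this] show ?thesis by (simp add: mult.assoc)
    qed
    have "n * (2 * (e' + c * N) + 1) = m0 * N + N"
      by (simp add: N_def m0_def algebra_simps)
    also have "\<dots> < (m0 + 1) * (N + 1)" by simp
    finally have card: "CARD('n) * (2 * (e' + c * N) + 1) < card ({..m0} \<times> {..N})"
      by (simp add: n_def)
    have "\<exists>a. (\<exists>q\<in>{..m0} \<times> {..N}. a q \<noteq> 0) \<and>
      (\<Sum>q\<in>{..m0} \<times> {..N}. k_const (a q) *s (\<Phi>1 ^^ snd q) (u (fst q))) = 0"
      by (rule fd_dependent[OF _ _ _ card, of "k_var ^ (e' + c * N) * to_fract h"])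
        (use \<open>h \<noteq> 0\<close> poly in auto)
    then obtain a where a: "\<exists>q\<in>{..m0} \<times> {..N}. a q \<noteq> 0"
      "(\<Sum>q\<in>{..m0} \<times> {..N}. k_const (a q) *s (\<Phi>1 ^^ snd q) (u (fst q))) = 0" by blast
    define f where "f i = (\<Sum>k\<le>N. monom (a (i, k)) k)" for i
    have fc: "coeff (f i) k = (if k \<le> N then a (i, k) else 0)" for i k
      by (simp add: f_def coeff_sum)
    have fdeg: "degree (f i) \<le> N" for i by (rule degree_le) (simp add: fc)
    have "(\<Sum>i\<le>m0. ops.op_T.act (f i) (u i)) = 0"
      using a(2) by (simp add: ops.op_T.act_eq_sum[OF fdeg] fc sum.cartesian_product split_beta)
    moreover have "ops.op_T.act (f i) (u i) = (\<Phi>1 ^^ r) ((\<Phi>2 ^^ r) (ops.op_T.act (f i) (w i)))" for i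
      unfolding u_def
      by (rule ops.op_T.act_commute[where S = "\<lambda>v. (\<Phi>1 ^^ r) ((\<Phi>2 ^^ r) v)", symmetric])
        (simp_all add: \<Phi>1_iter_add \<Phi>2_iter_add \<Phi>1_iter_scale \<Phi>2_iter_scale \<Phi>12_iter_commute2[symmetric]
          const_iter funpow_swap1)
    ultimately have "(\<Sum>i\<le>m0. (\<Phi>1 ^^ r) ((\<Phi>2 ^^ r) (ops.op_T.act (f i) (w i)))) = 0" by simp
    also have "(\<Sum>i\<le>m0. (\<Phi>1 ^^ r) ((\<Phi>2 ^^ r) (ops.op_T.act (f i) (w i))))
        = (\<Phi>1 ^^ r) ((\<Phi>2 ^^ r) (\<Sum>i\<le>m0. ops.op_T.act (f i) (w i)))"
      by (rule Modules.additive.sum[symmetric], rule Modules.additive.intro)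
        (simp add: \<Phi>1_iter_add \<Phi>2_iter_add)
    finally have "(\<Sum>i\<le>m0. ops.op_T.act (f i) (w i)) = 0"
      by (simp add: \<Phi>1_iter_eq_0 \<Phi>2_iter_eq_0)
    moreover have "\<exists>i\<le>m0. f i \<noteq> 0"
    proof -
      obtain i k where ik: "i \<le> m0" "k \<le> N" "a (i, k) \<noteq> 0" using a(1) by auto
      then have "coeff (f i) k \<noteq> 0" by (simp add: fc)
      then have "f i \<noteq> 0" by auto
      then show ?thesis using ik by blast
    qed
    ultimately show "\<exists>f. (\<exists>i\<le>m0. f i \<noteq> 0) \<and> (\<Sum>i\<le>m0. ops.op_T.act (f i) (w i)) = 0" by blast
  qed
qed

text \<open>The hypothesis is the shape shared by \<open>all_tors_dilation\<close> and
  \<open>all_tors_translation\<close>. It is applied to the vectors whose far iterates become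
  regular after multiplication by \<open>h\<close>: they are stable under both operators and under
  x, have bounded rank, and include a polynomial multiple of every basis vector.\<close>

lemma torsion_lattice:
  assumes all_tors: "\<And>L (m0 :: nat) v. C.subspace L \<Longrightarrow> (\<And>v. v \<in> L \<Longrightarrow> \<Phi>1 v \<in> L) \<Longrightarrow> (\<And>v. v \<in> L \<Longrightarrow> \<Phi>2 v \<in> L) \<Longrightarrow>
      (\<And>v. v \<in> L \<Longrightarrow> k_var *s v \<in> L) \<Longrightarrow> (\<And>w. (\<And>i. i \<le> m0 \<Longrightarrow> w i \<in> L) \<Longrightarrow>
      \<exists>f. (\<exists>i\<le>m0. f i \<noteq> 0) \<and> (\<Sum>i\<le>m0. ops.op_T.act (f i) (w i)) = 0) \<Longrightarrow> v \<in> L \<Longrightarrow> ops.tors v"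
  shows "\<exists>g. g \<noteq> 0 \<and> (\<forall>m. ops.tors (g *s axis m 1))"
proof -
  obtain h h' r where h: "h \<noteq> 0" "h' \<noteq> 0" "\<And>i j l m. i \<ge> r \<Longrightarrow> j \<ge> r \<Longrightarrow>
    to_fract h * (\<Phi>1 ^^ i) ((\<Phi>2 ^^ j) (to_fract h' *s axis m 1)) $ l \<in> R"
    using bounded_denominators by blast
  define L where "L = {v. \<forall>i\<ge>r. \<forall>j\<ge>r. \<forall>l. to_fract h * (\<Phi>1 ^^ i) ((\<Phi>2 ^^ j) v) $ l \<in> R}"
  have const_R: "k_const c \<in> R" for c using Pol_R Pol_closed by blast
  have scale: "(to_fract p) *s v \<in> L" if "v \<in> L" for p v
  proof -
    have "to_fract h * (to_fract q * x) \<in> R" if "to_fract h * x \<in> R" for q x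
      using R_mult[OF R_to_fract[of q] that] by (simp add: ac_simps)
    then show ?thesis using that unfolding L_def
      by (auto simp: \<Phi>1_iter_scale \<Phi>2_iter_scale \<sigma>_iter)
  qed
  obtain m0 :: nat where m0: "\<And>w. (\<forall>i\<le>m0. w i \<in> L) \<Longrightarrow>
    (\<exists>f. (\<exists>i\<le>m0. f i \<noteq> 0) \<and> (\<Sum>i\<le>m0. ops.op_T.act (f i) (w i)) = 0)"
    using rank_bound[OF h(1), of r] unfolding L_def by blast
  have "ops.tors v" if "v \<in> L" for v
  proof (rule all_tors[of L m0 v])
    show "C.subspace L"
    proof (rule C.subspaceI)
      show "0 \<in> L" by (simp add: L_def \<Phi>1_iter_eq_0[THEN iffD2] \<Phi>2_iter_eq_0[THEN iffD2] R_to_fract[of 0, simplified])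
      show "u + v \<in> L" if "u \<in> L" "v \<in> L" for u v
        using that by (auto simp: L_def \<Phi>1_iter_add \<Phi>2_iter_add distrib_left intro: R_add)
      show "k_const c *s v \<in> L" if "v \<in> L" for c v
        using scale[OF that, of "[:c:]"] by (simp add: k_const_def)
    qed
    show "k_var *s v \<in> L" if "v \<in> L" for v
      using scale[OF that, of "[:0, 1:]"] by (simp add: k_var_def)
    show "\<Phi>1 v \<in> L" if "v \<in> L" for v
    proof -
      have "(\<Phi>1 ^^ i) ((\<Phi>2 ^^ j) (\<Phi>1 v)) = (\<Phi>1 ^^ Suc i) ((\<Phi>2 ^^ j) v)" for i j
        by (simp add: \<Phi>12_iter_commute2[symmetric] funpow_swap1)
      then show ?thesis using that unfolding L_def by (simp del: funpow.simps)
    qed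
    show "\<Phi>2 v \<in> L" if "v \<in> L" for v
    proof -
      have "(\<Phi>1 ^^ i) ((\<Phi>2 ^^ j) (\<Phi>2 v)) = (\<Phi>1 ^^ i) ((\<Phi>2 ^^ Suc j) v)" for i j
        by (simp add: funpow_swap1)
      then show ?thesis using that unfolding L_def by (simp del: funpow.simps)
    qed
    show "\<exists>f. (\<exists>i\<le>m0. f i \<noteq> 0) \<and> (\<Sum>i\<le>m0. ops.op_T.act (f i) (w i)) = 0"
      if "\<And>i. i \<le> m0 \<Longrightarrow> w i \<in> L" for w
      by (rule m0) (use that in simp)
  qed (rule that)
  moreover have "to_fract h' *s axis m 1 \<in> L" for m using h by (simp add: L_def)
  ultimately show ?thesis using h(2) by (intro exI[of _ "to_fract h'"]) auto
qed

end

section \<open>Constant bases\<close>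

lemma k_const_sum: "k_const (sum f A) = (\<Sum>i\<in>A. k_const (f i))"
  by (induction A rule: infinite_finite_induct) (simp_all add: k_const_hom)

lemma matrix_inv:
  assumes "invertible A"
  shows matrix_inv_right: "A ** matrix_inv A = mat 1" and matrix_inv_left: "matrix_inv A ** A = mat 1"
  using someI_ex[of "\<lambda>B. A ** B = mat 1 \<and> B ** A = mat 1"] assms
  unfolding matrix_inv_def invertible_def by auto

lemma matrix_inv_unique:
  assumes "A ** B = mat 1" "B ** A = mat 1" shows "matrix_inv A = B"
proof -
  have "invertible A" using assms by (auto simp: invertible_def)
  have "B ** (A ** matrix_inv A) = B" using matrix_inv_right[OF \<open>invertible A\<close>] by simp
  then show ?thesis using assms(2) by (simp add: matrix_mul_assoc)
qed

lemma invertible_matrix_inv: "invertible A \<Longrightarrow> invertible (matrix_inv A)"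
  using matrix_inv by (auto simp: invertible_def)

lemma matrix_inv_involution: "invertible A \<Longrightarrow> matrix_inv (matrix_inv A) = A"
  by (rule matrix_inv_unique) (simp_all add: matrix_inv)

lemma matrix_inv_mult:
  assumes "invertible A" "invertible B" shows "matrix_inv (A ** B) = matrix_inv B ** matrix_inv A"
proof (rule matrix_inv_unique)
  have "A ** B ** (matrix_inv B ** matrix_inv A) = A ** (B ** matrix_inv B) ** matrix_inv A"
    by (simp only: matrix_mul_assoc)
  then show "A ** B ** (matrix_inv B ** matrix_inv A) = mat 1" using assms by (simp add: matrix_inv)
  have "matrix_inv B ** matrix_inv A ** (A ** B) = matrix_inv B ** (matrix_inv A ** A) ** B"
    by (simp only: matrix_mul_assoc)
  then show "matrix_inv B ** matrix_inv A ** (A ** B) = mat 1" using assms by (simp add: matrix_inv)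
qed

section \<open>Torsion and stable spaces of finite dimension\<close>

context commuting_ops
begin

text \<open>A count of dimensions replaces the Cayley-Hamilton theorem: the first
  \<open>card S0 + 1\<close> iterates of \<open>v\<close> lie in the span of
  \<open>S0\<close>.\<close>

lemma tors_of_finite_span:
  assumes "finite S0" "\<And>s. s \<in> S0 \<Longrightarrow> T s \<in> span S0" "v \<in> span S0"
  shows "tors v"
proof -
  have "T u \<in> span S0" if "u \<in> span S0" for u
    using that by (induction rule: span_induct_alt)
      (auto simp: T_add T_scale op_T.T_0 span_zero intro!: span_add span_scale assms)
  then have iter: "(T ^^ i) v \<in> span S0" for i
    using assms(3) by (induction i) auto
  define N where "N = card S0"
  have "\<exists>c. (\<exists>i\<le>N. c i \<noteq> 0) \<and> (\<Sum>i\<le>N. scale (c i) ((T ^^ i) v)) = 0"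
  proof (cases "inj_on (\<lambda>i. (T ^^ i) v) {..N}")
    case True
    then have "card ((\<lambda>i. (T ^^ i) v) ` {..N}) = Suc N" by (simp add: card_image)
    then have "dependent ((\<lambda>i. (T ^^ i) v) ` {..N})"
      using independent_span_bound[OF assms(1), of "(\<lambda>i. (T ^^ i) v) ` {..N}"] iter
      by (auto simp: N_def)
    then obtain u where u: "\<exists>w\<in>(\<lambda>i. (T ^^ i) v) ` {..N}. u w \<noteq> 0"
      "(\<Sum>w\<in>(\<lambda>i. (T ^^ i) v) ` {..N}. scale (u w) w) = 0"
      using dependent_finite[of "(\<lambda>i. (T ^^ i) v) ` {..N}"] by auto
    then show ?thesis using True
      by (intro exI[of _ "\<lambda>i. u ((T ^^ i) v)"]) (auto simp: sum.reindex)
  next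
    case False
    then obtain i j where ij: "i \<le> N" "j \<le> N" "i \<noteq> j" "(T ^^ i) v = (T ^^ j) v"
      by (auto simp: inj_on_def)
    define c where "c l = (if l = i then 1 else if l = j then -1 else 0 :: 'c)" for l
    have "(\<Sum>l\<le>N. scale (c l) ((T ^^ l) v)) = (\<Sum>l\<in>{i,j}. scale (c l) ((T ^^ l) v))"
      by (rule sum.mono_neutral_right) (use ij in \<open>auto simp: c_def\<close>)
    also have "\<dots> = 0" using ij by (simp add: c_def)
    finally show ?thesis using ij by (intro exI[of _ c]) (auto simp: c_def)
  qed
  then obtain c where c: "\<exists>i\<le>N. c i \<noteq> 0" "(\<Sum>i\<le>N. scale (c i) ((T ^^ i) v)) = 0" by blast
  define P where "P = (\<Sum>i\<le>N. monom (c i) i)"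
  have Pc: "coeff P i = (if i \<le> N then c i else 0)" for i by (simp add: P_def coeff_sum)
  have "degree P \<le> N" by (rule degree_le) (simp add: Pc)
  then have "op_T.act P v = 0" using c by (simp add: op_T.act_eq_sum[of P N] Pc)
  moreover have "P \<noteq> 0" using c(1) Pc by (metis coeff_0)
  ultimately show ?thesis by (rule torsI[rotated])
qed

text \<open>Factors \<open>T\<close> of an annihilating polynomial can be cancelled since
  \<open>T\<close> is injective.\<close>

lemma tors_coeff_0:
  assumes "tors v" "\<And>v. T v = 0 \<Longrightarrow> v = 0"
  shows "\<exists>P. coeff P 0 \<noteq> 0 \<and> op_T.act P v = 0"
proof -
  have "\<exists>P. coeff P 0 \<noteq> 0 \<and> op_T.act P v = 0" if "P \<noteq> 0" "op_T.act P v = 0" for P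
    using that
  proof (induction P)
    case (pCons a P)
    show ?case
    proof (cases "a = 0")
      case True
      then have "T (op_T.act P v) = 0" using pCons.prems by (simp add: op_T.act_pCons)
      then show ?thesis using pCons assms(2) True by auto
    qed (use pCons in \<open>auto intro!: exI[of _ "pCons a P"]\<close>)
  qed simp
  then show ?thesis using assms(1) unfolding tors_def by blast
qed

text \<open>An annihilating polynomial with nonzero constant term expresses \<open>v\<close> through
  T v, T^2 v and so on; iterating pushes the expression beyond any power of
  \<open>T\<close>.\<close>

lemma tors_eq_power:
  assumes "tors v" "\<And>v. T v = 0 \<Longrightarrow> v = 0"
  shows "\<exists>G. v = op_T.act (monom 1 N * G) v"
proof (induction N)
  case 0
  show ?case by (intro exI[of _ 1]) (simp flip: one_pCons add: monom_0)
next
  case (Suc N)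
  obtain P where P: "coeff P 0 \<noteq> 0" "op_T.act P v = 0" using tors_coeff_0[OF assms] by blast
  obtain a Q where PQ: "P = pCons a Q" by (cases P)
  define H where "H = smult (- inverse a) Q"
  have "scale a v = - T (op_T.act Q v)"
    using P PQ by (simp add: op_T.act_pCons eq_neg_iff_add_eq_0)
  then have "scale (inverse a) (scale a v) = scale (inverse a) (- T (op_T.act Q v))" by simp
  then have "v = scale (- inverse a) (T (op_T.act Q v))" using P PQ by simp
  also have "\<dots> = T (op_T.act H v)" by (simp only: H_def op_T.act_smult T_scale)
  finally have v1: "v = T (op_T.act H v)" .
  have H: "op_T.act (monom 1 1 * H) v = v"
    using v1 by (simp add: monom_Suc monom_0 op_T.act_pCons)
  obtain G where "v = op_T.act (monom 1 N * G) v" using Suc by blast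
  also have "\<dots> = op_T.act (monom 1 N * G) (op_T.act (monom 1 1 * H) v)" by (simp only: H)
  also have "\<dots> = op_T.act (monom 1 N * G * (monom 1 1 * H)) v" by (simp only: op_T.act_mult)
  also have "monom 1 N * G * (monom 1 1 * H) = monom 1 (Suc N) * (G * H)"
    using mult_monom[of "1::'c" N 1 1] by (simp add: ac_simps) 
  finally show ?case by blast
qed

lemma tors_in_image:
  assumes "tors v" "\<And>v. T v = 0 \<Longrightarrow> v = 0"
  shows "\<exists>H. v = T (op_T.act H v)"
proof -
  obtain G where "v = op_T.act (monom 1 1 * G) v" using tors_eq_power[OF assms, of 1] by blast
  then show ?thesis by (auto simp: monom_Suc monom_0 op_T.act_pCons)
qed

lemma subspace_tors: "subspace {v. tors v}"
  by (rule subspaceI) (auto intro: tors_add tors_scale)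

end

context consistent_system
begin

text \<open>\<open>\<sigma>1\<close> fills both operator slots, so that \<open>scal.tors f\<close>
  says that the iterates of the scalar \<open>f\<close> under \<open>\<sigma>1\<close> satisfy a
  linear relation over C.\<close>

sublocale scal: commuting_ops "\<lambda>c f. k_const c * f" \<sigma>1 \<sigma>1
  by standard (simp_all add: field_hom_simps hom1 k_const_hom algebra_simps)

text \<open>Writing \<open>\<Phi>1 v - c v\<close> in a basis of a \<open>\<Phi>1\<close>-stable space of constants shows that the
  coordinates of \<open>v\<close> span a \<open>\<sigma>1\<close>-stable space, since \<open>\<Phi>1\<close> acts on that basis by an invertible
  constant matrix.\<close>
lemma coordinates_tors:
  assumes W: "finite W" "vec.independent W" "\<And>w. w \<in> W \<Longrightarrow> \<Phi>1 w \<in> C.span W"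
    and v: "v = (\<Sum>w\<in>W. f w *s w)" "\<Phi>1 v - k_const c *s v \<in> C.span W"
    and "w \<in> W"
  shows "scal.tors (f w)"
proof -
  have indep: "g w = h w" if "(\<Sum>w\<in>W. g w *s w) = (\<Sum>w\<in>W. h w *s w)" "w \<in> W" for g h w
  proof -
    have "(\<Sum>w\<in>W. (g w - h w) *s w) = 0"
      using that(1) by (simp add: vec.scale_left_diff_distrib sum_subtractf)
    from vec.independentD[where u = "\<lambda>w. g w - h w", OF W(2,1) order.refl this that(2)]
    show ?thesis by simp
  qed
  have span: "\<exists>a. u = (\<Sum>w\<in>W. k_const (a w) *s w)" if "u \<in> C.span W" for u
    using that C.span_finite[OF W(1)] by auto
  have "\<forall>w\<in>W. \<exists>a. \<Phi>1 w = (\<Sum>w'\<in>W. k_const (a w') *s w')" using span W(3) by blast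
  from bchoice[OF this] obtain A where A: "\<And>w. w \<in> W \<Longrightarrow> \<Phi>1 w = (\<Sum>w'\<in>W. k_const (A w w') *s w')"
    by blast
  \<comment> \<open>\<open>\<Phi>1\<close> maps the C-span of \<open>W\<close> onto itself: the
    elements of \<open>W\<close> are torsion, and \<open>tors_in_image\<close> gives preimages
    inside the span.\<close>
  have "\<forall>w\<in>W. \<exists>b. w = \<Phi>1 (\<Sum>w'\<in>W. k_const (b w') *s w')"
  proof
    fix w assume "w \<in> W"
    have "ops.tors w" using ops.tors_of_finite_span[OF W(1,3)] \<open>w \<in> W\<close> C.span_base by blast
    then obtain H where H: "w = \<Phi>1 (ops.op_T.act H w)" using ops.tors_in_image by auto
    have "\<Phi>1 u \<in> C.span W" if "u \<in> C.span W" for u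
      using that by (induction rule: C.span_induct_alt)
        (auto simp: semilin_add semilin_scale hom1 C.span_zero intro!: C.span_add C.span_scale W(3))
    then have "ops.op_T.act H w \<in> C.span W"
      using ops.op_T.act_closed[OF C.subspace_span] \<open>w \<in> W\<close> C.span_base by blast
    then obtain b where "ops.op_T.act H w = (\<Sum>w'\<in>W. k_const (b w') *s w')" using span by blast
    then show "\<exists>b. w = \<Phi>1 (\<Sum>w'\<in>W. k_const (b w') *s w')" using H by (intro exI[of _ b]) simp
  qed
  from bchoice[OF this] obtain b where b: "\<And>w. w \<in> W \<Longrightarrow> w = \<Phi>1 (\<Sum>w'\<in>W. k_const (b w w') *s w')"
    by blast
  define t where "t w = (\<Sum>w'\<in>W. k_const (b w w') *s w')" for w
  have \<Phi>_sum: "\<Phi>1 (sum g W) = (\<Sum>w\<in>W. \<Phi>1 (g w))" for g by (rule ops.op_T.T_sum)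
  have AB: "(\<Sum>w'\<in>W. A w w' * b w' w'') = (if w = w'' then 1 else 0)" if "w \<in> W" "w'' \<in> W" for w w''
  proof -
    have "\<Phi>1 (\<Sum>w'\<in>W. k_const (A w w') *s t w') = (\<Sum>w'\<in>W. k_const (A w w') *s \<Phi>1 (t w'))"
      by (simp add: \<Phi>_sum semilin_scale hom1)
    also have "\<dots> = \<Phi>1 w" using A[OF \<open>w \<in> W\<close>] b by (simp add: t_def)
    finally have "\<Phi>1 ((\<Sum>w'\<in>W. k_const (A w w') *s t w') - w) = 0"
      using semilin_add[OF hom1, of D1 "(\<Sum>w'\<in>W. k_const (A w w') *s t w') - w" w] by simp
    then have "w = (\<Sum>w'\<in>W. k_const (A w w') *s t w')" by simp
    also have "\<dots> = (\<Sum>w'\<in>W. \<Sum>w''\<in>W. k_const (A w w' * b w' w'') *s w'')"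
      by (simp add: t_def vec.scale_sum_right vector_smult_assoc k_const_hom)
    also have "\<dots> = (\<Sum>w''\<in>W. k_const (\<Sum>w'\<in>W. A w w' * b w' w'') *s w'')"
      by (subst sum.swap) (simp add: vec.scale_sum_left[symmetric] k_const_sum)
    finally have "(\<Sum>w''\<in>W. (if w = w'' then 1 else 0) *s w'') = (\<Sum>w''\<in>W. k_const (\<Sum>w'\<in>W. A w w' * b w' w'') *s w'')"
      using \<open>w \<in> W\<close> W(1) by (simp add: if_distrib[of "\<lambda>a. a *s _"] cong: if_cong)
    from indep[OF this \<open>w'' \<in> W\<close>] show ?thesis
      by (metis k_const_0 k_const_1 k_const_eq_iff)
  qed
  obtain u where u: "\<Phi>1 v - k_const c *s v = (\<Sum>w\<in>W. k_const (u w) *s w)" using span v(2) by blast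
  have "(\<Sum>w'\<in>W. (\<Sum>w\<in>W. \<sigma>1 (f w) * k_const (A w w')) *s w')
      = (\<Sum>w'\<in>W. \<Sum>w\<in>W. (\<sigma>1 (f w) * k_const (A w w')) *s w')"
    by (simp add: vec.scale_sum_left)
  also have "\<dots> = (\<Sum>w\<in>W. \<Sum>w'\<in>W. (\<sigma>1 (f w) * k_const (A w w')) *s w')" by (rule sum.swap)
  also have "\<dots> = (\<Sum>w\<in>W. \<sigma>1 (f w) *s \<Phi>1 w)"
    by (rule sum.cong) (simp_all add: A vec.scale_sum_right vector_smult_assoc)
  also have "\<dots> = \<Phi>1 v" by (simp add: v(1) \<Phi>_sum semilin_scale hom1)
  also have "\<dots> = k_const c *s v + (\<Sum>w\<in>W. k_const (u w) *s w)" using u by (simp add: algebra_simps)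
  also have "\<dots> = (\<Sum>w\<in>W. (k_const c * f w + k_const (u w)) *s w)"
    by (simp add: v(1) vec.scale_sum_right vector_smult_assoc vec.scale_left_distrib sum.distrib)
  finally have eq: "(\<Sum>w\<in>W. \<sigma>1 (f w) * k_const (A w w')) = k_const c * f w' + k_const (u w')"
    if "w' \<in> W" for w'
    using indep[where g = "\<lambda>w'. \<Sum>w\<in>W. \<sigma>1 (f w) * k_const (A w w')"
        and h = "\<lambda>w. k_const c * f w + k_const (u w)"] that by simp
  \<comment> \<open>The element 1 absorbs the constants \<open>u w\<close> of the inhomogeneous
    term.\<close>
  define S0 where "S0 = insert 1 (f ` W)"
  have \<sigma>f: "\<sigma>1 (f w'') \<in> scal.span S0" if "w'' \<in> W" for w''
  proof -
    have "(\<Sum>w'\<in>W. (k_const c * f w' + k_const (u w')) * k_const (b w' w''))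
        = (\<Sum>w'\<in>W. (\<Sum>w\<in>W. \<sigma>1 (f w) * k_const (A w w')) * k_const (b w' w''))"
      by (simp add: eq)
    also have "\<dots> = (\<Sum>w\<in>W. \<sigma>1 (f w) * k_const (\<Sum>w'\<in>W. A w w' * b w' w''))"
      by (simp add: sum_distrib_right sum_distrib_left k_const_sum k_const_hom mult.assoc)
        (rule sum.swap)
    also have "\<dots> = (\<Sum>w\<in>W. \<sigma>1 (f w) * (if w = w'' then 1 else 0))"
      by (rule sum.cong) (use that AB in auto)
    also have "\<dots> = \<sigma>1 (f w'')" using that W(1) by (simp add: if_distrib cong: if_cong)
    finally have "\<sigma>1 (f w'') = (\<Sum>w'\<in>W. k_const (b w' w'' * c) * f w' + k_const (b w' w'' * u w') * 1)"
      by (simp add: k_const_hom algebra_simps)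
    also have "\<dots> \<in> scal.span S0"
      by (intro scal.span_sum scal.span_add scal.span_scale scal.span_base) (auto simp: S0_def)
    finally show ?thesis .
  qed
  have "\<sigma>1 s \<in> scal.span S0" if "s \<in> S0" for s
    using that \<sigma>f scal.span_base[of 1 S0] by (auto simp: S0_def field_hom_simps hom1)
  moreover have "f w \<in> scal.span S0" using \<open>w \<in> W\<close> by (intro scal.span_base) (auto simp: S0_def)
  ultimately show ?thesis using scal.tors_of_finite_span[of S0 "f w"] W(1) by (simp add: S0_def)
qed

text \<open>Among the k-independent sets \<open>W\<close> in \<open>V\<close> with stable C-span
  take one of maximal size. If a vector of \<open>V\<close> lay outside the C-span, a polynomial of
  minimal degree moving some such vector into the span, with one linear factor split off, would give
  \<open>u'\<close> outside the span with \<open>\<Phi>1 u' - k_const c *s u'\<close> inside it.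
  Then \<open>key\<close> excludes \<open>u'\<close> from the k-span, and adjoining
  \<open>u'\<close> contradicts maximality.\<close>

lemma maximal_constant_basis:
  assumes V: "C.subspace V" "\<And>v. v \<in> V \<Longrightarrow> \<Phi>1 v \<in> V" "\<And>v. v \<in> V \<Longrightarrow> ops.tors v"
    and key: "\<And>W v c. finite W \<Longrightarrow> W \<subseteq> V \<Longrightarrow> vec.independent W \<Longrightarrow> (\<And>w. w \<in> W \<Longrightarrow> \<Phi>1 w \<in> C.span W) \<Longrightarrow>
      v \<in> V \<Longrightarrow> \<Phi>1 v - k_const c *s v \<in> C.span W \<Longrightarrow> v \<in> vec.span W \<Longrightarrow> v \<in> C.span W"
  shows "\<exists>W. finite W \<and> vec.independent W \<and> C.span W = V"
proof -
  define good where "good W \<longleftrightarrow> finite W \<and> W \<subseteq> V \<and> vec.independent W \<and> (\<forall>w\<in>W. \<Phi>1 w \<in> C.span W)" for W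
  have "good {}" by (simp add: good_def vec.independent_empty)
  moreover have "\<forall>W. good W \<longrightarrow> card W < Suc (CARD('n))"
    using vec.independent_bound_general dim_subset_UNIV_cart_gen
    by (metis good_def le_trans less_Suc_eq_le)
  ultimately obtain W where W: "good W" "\<And>W'. good W' \<Longrightarrow> card W' \<le> card W"
    using ex_has_greatest_nat[of good "{}" card "Suc (CARD('n))"] by blast
  have stable: "\<Phi>1 u \<in> C.span W" if "u \<in> C.span W" for u
    using that W(1) unfolding good_def by (induction rule: C.span_induct_alt)
      (auto simp: semilin_add semilin_scale hom1 C.span_zero intro!: C.span_add C.span_scale)
  have sub: "C.span W \<subseteq> V" using W(1) V(1) C.span_minimal unfolding good_def by blast
  have "V \<subseteq> C.span W"
  proof
    fix v assume "v \<in> V"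
    show "v \<in> C.span W"
    proof (rule ccontr)
      assume v: "v \<notin> C.span W"
      define Q where "Q d \<longleftrightarrow> (\<exists>f u. f \<noteq> 0 \<and> degree f = d \<and> u \<in> V \<and> u \<notin> C.span W \<and> ops.op_T.act f u \<in> C.span W)" for d
      obtain f where "f \<noteq> 0" "ops.op_T.act f v = 0" using V(3)[OF \<open>v \<in> V\<close>] unfolding ops.tors_def by blast
      then have "Q (degree f)" using v \<open>v \<in> V\<close> C.span_zero unfolding Q_def by metis
      then obtain d where d: "Q d" "\<forall>d'<d. \<not> Q d'" using exists_least_iff[of Q] by blast
      then obtain f u where fu: "f \<noteq> 0" "degree f = d" "u \<in> V" "u \<notin> C.span W" "ops.op_T.act f u \<in> C.span W"
        unfolding Q_def by blast
      have "d \<noteq> 0"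
      proof
        assume "d = 0"
        then obtain a where "f = [:a:]" "a \<noteq> 0" using fu by (metis degree_eq_zeroE pCons_0_0)
        then have "k_const a *s u \<in> C.span W" using fu(5) by simp
        then have "k_const (inverse a) *s (k_const a *s u) \<in> C.span W" by (rule C.span_scale)
        moreover have "k_const (inverse a) *s (k_const a *s u) = u"
          using \<open>a \<noteq> 0\<close> by (simp add: vector_smult_assoc k_const_inverse)
        ultimately show False using fu(4) by simp
      qed
      then obtain c where "poly f c = 0" using alg_closed_imp_poly_has_root[of f] fu(2) by auto
      then obtain g where g: "f = [:- c, 1:] * g" by (auto simp: poly_eq_0_iff_dvd)
      then have "g \<noteq> 0" using fu by auto
      then have "degree f = 1 + degree g" unfolding g by (subst degree_mult_eq) auto
      then have "degree g < d" using fu by simp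
      define u' where "u' = ops.op_T.act g u"
      have u'V: "u' \<in> V" unfolding u'_def using V(1,2) fu(3) by (rule ops.op_T.act_closed)
      have u'W: "u' \<notin> C.span W" using d(2) \<open>degree g < d\<close> \<open>g \<noteq> 0\<close> fu unfolding Q_def u'_def by blast
      have eq: "ops.op_T.act f u = \<Phi>1 u' - k_const c *s u'"
        unfolding g ops.op_T.act_mult u'_def[symmetric] by (simp add: ops.op_T.act_pCons)
      have "u' \<notin> vec.span W"
        using key[of W u' c] W(1) u'V u'W fu(5) unfolding good_def eq by blast
      then have "vec.independent (insert u' W)" "u' \<notin> W"
        using W(1) vec.span_base by (auto simp: good_def vec.independent_insert)
      moreover have "\<Phi>1 w \<in> C.span (insert u' W)" if "w \<in> insert u' W" for w
      proof (cases "w = u'")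
        case True
        have "\<Phi>1 u' = k_const c *s u' + ops.op_T.act f u" by (simp add: eq)
        also have "\<dots> \<in> C.span (insert u' W)"
        proof (rule C.span_add)
          show "k_const c *s u' \<in> C.span (insert u' W)" by (intro C.span_scale C.span_base) simp
          show "ops.op_T.act f u \<in> C.span (insert u' W)"
            using fu(5) C.span_mono[of W "insert u' W"] by blast
        qed
        finally show ?thesis using True by simp
      next
        case False
        then show ?thesis using that W(1) C.span_mono[of W "insert u' W"] by (auto simp: good_def)
      qed
      ultimately have "good (insert u' W)" using W(1) u'V by (simp add: good_def)
      then show False using W(2)[of "insert u' W"] W(1) \<open>u' \<notin> W\<close> by (simp add: good_def)
    qed
  qed
  then show ?thesis using W(1) sub unfolding good_def by blast
qed

text \<open>The columns of \<open>P\<close> are the elements of \<open>W\<close>. Since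
  \<open>\<sigma>1\<close> and \<open>\<sigma>2\<close> fix constants, consistency shows that
  \<open>P\<close> times either product of the constant matrices is the same, and \<open>P\<close>
  can be cancelled.\<close>

lemma constant_form:
  assumes W: "finite W" "vec.independent W" "vec.span W = UNIV"
    "\<And>w. w \<in> W \<Longrightarrow> \<Phi>1 w \<in> C.span W" "\<And>w. w \<in> W \<Longrightarrow> \<Phi>2 w \<in> C.span W"
  shows "\<exists>P (A1 :: 'c^'n^'n) (A2 :: 'c^'n^'n). invertible P \<and> A1 ** A2 = A2 ** A1 \<and>
    D1 ** map_matrix \<sigma>1 P = P ** map_matrix k_const A1 \<and>
    D2 ** map_matrix \<sigma>2 P = P ** map_matrix k_const A2"
proof -
  have "card W = CARD('n)" using vec.dim_eq_card[OF _ W(2), of UNIV] W(3) by (simp add: vec_dim_card[unfolded vec.dim_UNIV] vec.dim_UNIV)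
  then obtain p :: "'n \<Rightarrow> 'c ratfun ^ 'n" where p: "bij_betw p UNIV W"
    using finite_same_card_bij[of "UNIV :: 'n set" W] W(1) by auto
  define P where "P = (\<chi> i j. p j $ i)"
  have col: "column j P = p j" for j by (simp add: P_def column_def vec_eq_iff)
  have colP: "columns P = W" using p by (auto simp: columns_def col bij_betw_def)
  have "invertible P"
    using W(3) unfolding colP[symmetric] using matrix_right_invertible_span_columns[of P] invertible_right_inverse by metis
  have mult_col: "column j (D ** map_matrix \<sigma> P) = semilin D \<sigma> (p j)" for j D \<sigma>
    by (simp add: vec_eq_iff column_def matrix_matrix_mult_def semilin_nth P_def)
  have "\<exists>A :: 'c^'n^'n. D ** map_matrix \<sigma> P = P ** map_matrix k_const A"
    if "\<And>w. w \<in> W \<Longrightarrow> semilin D \<sigma> w \<in> C.span W" for D \<sigma>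
  proof -
    have "\<forall>j. \<exists>a. semilin D \<sigma> (p j) = (\<Sum>i\<in>UNIV. k_const (a i) *s p i)"
    proof
      fix j
      have "semilin D \<sigma> (p j) \<in> C.span W" using that p by (auto simp: bij_betw_def)
      then obtain a where "semilin D \<sigma> (p j) = (\<Sum>w\<in>W. k_const (a w) *s w)"
        using C.span_finite[OF W(1)] by auto
      also have "\<dots> = (\<Sum>i\<in>UNIV. k_const (a (p i)) *s p i)"
        using sum.reindex_bij_betw[OF p, of "\<lambda>w. k_const (a w) *s w"] by simp
      finally show "\<exists>a. semilin D \<sigma> (p j) = (\<Sum>i\<in>UNIV. k_const (a i) *s p i)"
        by (intro exI[of _ "\<lambda>i. a (p i)"])
    qed
    from choice[OF this] obtain a where a: "\<And>j. semilin D \<sigma> (p j) = (\<Sum>i\<in>UNIV. k_const (a j i) *s p i)"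
      by blast
    have "D ** map_matrix \<sigma> P = P ** map_matrix k_const (\<chi> i j. a j i)"
    proof -
      have "column j (D ** map_matrix \<sigma> P) = column j (P ** map_matrix k_const (\<chi> i j. a j i))" for j
        unfolding mult_col a by (simp add: vec_eq_iff column_def matrix_matrix_mult_def P_def mult.commute)
      then show ?thesis by (simp add: vec_eq_iff column_def)
    qed
    then show ?thesis by blast
  qed
  from this[OF W(4)] this[OF W(5)] obtain A1 A2 :: "'c^'n^'n" where
    A: "D1 ** map_matrix \<sigma>1 P = P ** map_matrix k_const A1"
       "D2 ** map_matrix \<sigma>2 P = P ** map_matrix k_const A2" by blast
  have k1: "map_matrix \<sigma>1 (map_matrix k_const A) = map_matrix k_const A"
    and k2: "map_matrix \<sigma>2 (map_matrix k_const A) = map_matrix k_const A" for A :: "'c^'n^'n"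
    by (simp_all add: vec_eq_iff)
  have kmult: "map_matrix k_const (A ** B) = map_matrix k_const A ** map_matrix k_const B" for A B :: "'c^'n^'n"
    by (simp add: vec_eq_iff matrix_matrix_mult_def k_const_hom k_const_sum)
  have "P ** map_matrix k_const (A1 ** A2) = D1 ** map_matrix \<sigma>1 (D2 ** map_matrix \<sigma>2 P)"
    unfolding A by (simp add: map_matrix_mult hom1 k1 kmult matrix_mul_assoc A(1))
  also have "\<dots> = (D1 ** map_matrix \<sigma>1 D2) ** map_matrix \<sigma>1 (map_matrix \<sigma>2 P)"
    by (simp add: map_matrix_mult hom1 matrix_mul_assoc)
  also have "\<dots> = (D2 ** map_matrix \<sigma>2 D1) ** map_matrix \<sigma>2 (map_matrix \<sigma>1 P)"
    by (simp add: consistent map_matrix_comp \<sigma>_commute)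
  also have "\<dots> = D2 ** map_matrix \<sigma>2 (D1 ** map_matrix \<sigma>1 P)"
    by (simp add: map_matrix_mult hom2 matrix_mul_assoc)
  also have "\<dots> = P ** map_matrix k_const (A2 ** A1)"
    unfolding A by (simp add: map_matrix_mult hom2 k2 kmult matrix_mul_assoc A(2))
  finally have "matrix_inv P ** (P ** map_matrix k_const (A1 ** A2)) = matrix_inv P ** (P ** map_matrix k_const (A2 ** A1))"
    by (rule arg_cong)
  then have "map_matrix k_const (A1 ** A2) = map_matrix k_const (A2 ** A1)"
    by (simp add: matrix_mul_assoc matrix_inv_left[OF \<open>invertible P\<close>])
  then have "A1 ** A2 = A2 ** A1" by (simp add: vec_eq_iff)
  then show ?thesis using A \<open>invertible P\<close> by blast
qed

end

section \<open>From a constant basis to a gauge transformation\<close>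

lemma det_map_matrix:
  assumes "field_hom h" shows "det (map_matrix h A) = h (det A)"
proof -
  have prod: "h (prod f S) = (\<Prod>i\<in>S. h (f i))" for f :: "_ \<Rightarrow> _" and S
    by (induction S rule: infinite_finite_induct) (simp_all add: field_hom_simps assms)
  have int: "h (of_int z) = of_int z" for z
  proof -
    have "h (of_nat m) = of_nat m" for m by (induction m) (simp_all add: field_hom_simps assms)
    then show ?thesis by (cases z) (simp_all add: field_hom_simps assms)
  qed
  show ?thesis
    by (simp add: det_def field_hom_sum field_hom_simps assms prod int)
qed

text \<open>The gauge matrix is the inverse of \<open>P\<close>. The new system has the inverses of
  \<open>A1\<close> and \<open>A2\<close> as its matrices, because \<open>P\<close> reduces the
  inverses of \<open>B1\<close> and \<open>B2\<close>. Determinants show that \<open>A1\<close> and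
  \<open>A2\<close> are invertible already over C.\<close>

lemma gauge_equivalent_constant:
  fixes B1 B2 P :: "'f::field^'n^'n" and A1 A2 :: "'c::field^'n^'n"
  assumes \<kappa>: "field_hom \<kappa>" and hom: "field_hom \<sigma>1" "field_hom \<sigma>2"
    and inv: "invertible B1" "invertible B2" "invertible P"
    and A: "A1 ** A2 = A2 ** A1"
    and 1: "matrix_inv B1 ** map_matrix \<sigma>1 P = P ** map_matrix \<kappa> A1"
    and 2: "matrix_inv B2 ** map_matrix \<sigma>2 P = P ** map_matrix \<kappa> A2"
  shows "\<exists>A1 A2 :: 'c^'n^'n. invertible A1 \<and> invertible A2 \<and> A2 ** A1 = A1 ** A2 \<and>
    gauge_equivalent \<sigma>1 \<sigma>2 B1 B2 (map_matrix \<kappa> A1) (map_matrix \<kappa> A2)"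
proof -
  have *: "invertible A \<and> map_matrix \<kappa> (matrix_inv A) = map_matrix \<sigma> (matrix_inv P) ** B ** P"
    if "field_hom \<sigma>" "invertible B" and eq: "matrix_inv B ** map_matrix \<sigma> P = P ** map_matrix \<kappa> A"
    for \<sigma> B and A :: "'c^'n^'n"
  proof -
    have BP: "map_matrix \<sigma> P = B ** P ** map_matrix \<kappa> A"
      using arg_cong[OF eq, of "(**) B"] matrix_inv_right[OF \<open>invertible B\<close>]
      by (simp add: matrix_mul_assoc)
    have iP: "map_matrix \<sigma> (matrix_inv P) ** map_matrix \<sigma> P = mat 1"
      using matrix_inv_left[OF inv(3)] by (simp flip: map_matrix_mult[OF that(1)] add: map_matrix_mat_1 that(1))
    have "(map_matrix \<sigma> (matrix_inv P) ** B ** P) ** map_matrix \<kappa> A = mat 1"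
      using iP unfolding BP by (simp add: matrix_mul_assoc)
    then have left: "map_matrix \<kappa> A ** (map_matrix \<sigma> (matrix_inv P) ** B ** P) = mat 1"
      by (simp add: matrix_left_right_inverse)
    then have "det (map_matrix \<kappa> A) * det (map_matrix \<sigma> (matrix_inv P) ** B ** P) = 1"
      by (metis det_mul det_I)
    then have "det (map_matrix \<kappa> A) \<noteq> 0" by auto
    then have "det A \<noteq> 0" using det_map_matrix[OF \<kappa>, of A] field_hom_0[OF \<kappa>] by auto
    then have "invertible A" by (simp add: invertible_det_nz)
    then have "map_matrix \<kappa> (matrix_inv A) ** map_matrix \<kappa> A = mat 1"
      by (simp flip: map_matrix_mult[OF \<kappa>] add: map_matrix_mat_1[OF \<kappa>] matrix_inv_left)
    then have "map_matrix \<kappa> (matrix_inv A) = map_matrix \<sigma> (matrix_inv P) ** B ** P"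
      using arg_cong[OF left, of "(**) (map_matrix \<kappa> (matrix_inv A))"] by (simp add: matrix_mul_assoc)
    then show ?thesis using \<open>invertible A\<close> by blast
  qed
  note a1 = *[OF hom(1) inv(1) 1] and a2 = *[OF hom(2) inv(2) 2]
  define G where "G = matrix_inv P"
  have "invertible G" "matrix_inv G = P"
    using inv(3) unfolding G_def by (auto simp: invertible_matrix_inv matrix_inv_involution)
  have "gauge_equivalent \<sigma>1 \<sigma>2 B1 B2 (map_matrix \<kappa> (matrix_inv A1)) (map_matrix \<kappa> (matrix_inv A2))"
    unfolding gauge_equivalent_def using a1 a2 \<open>invertible G\<close> \<open>matrix_inv G = P\<close>
    by (intro exI[of _ G]) (simp add: G_def)
  moreover have "matrix_inv A2 ** matrix_inv A1 = matrix_inv A1 ** matrix_inv A2"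
    using a1 a2 A by (metis matrix_inv_mult)
  moreover have "invertible (matrix_inv A1)" "invertible (matrix_inv A2)"
    using a1 a2 by (auto simp: invertible_matrix_inv)
  ultimately show ?thesis by blast
qed

lemma (in op_module) act_dilate:
  assumes "\<And>u v. X (u + v) = X u + X v" "\<And>a v. X (scale a v) = scale a (X v)"
    and "\<And>v. T (X v) = scale q (X (T v))"
  shows "act p (X v) = X (act (pcompose p [:0, q:]) v)"
proof (induction p)
  case 0
  have "X 0 = 0" using assms(1)[of 0 0] by simp
  then show ?case by simp
next
  case (pCons a p)
  then show ?case by (simp add: act_pCons pcompose_pCons act_add_left assms act_smult T_scale)
qed

text \<open>By \<open>tors_eq_power\<close>, \<open>f\<close> is a combination of iterates of index
  at least \<open>r\<close>, so it has a denominator \<open>e\<close> made of far transforms of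
  \<open>d\<close>. As \<open>e\<close> is coprime to the denominator \<open>d\<close>, a Bezout
  relation shows that \<open>f\<close> has no pole in \<open>Y\<close>.\<close>

lemma (in free_system) scal_tors_R:
  assumes "scal.tors f" shows "f \<in> R"
proof -
  obtain d where d: "d \<noteq> 0" "{y. poly d y = 0} \<subseteq> Y" "to_fract d * f \<in> R" using den by blast
  obtain r where r: "\<And>i j i' j'. i + r \<le> i' \<or> i' + r \<le> i \<or> j + r \<le> j' \<or> j' + r \<le> j \<Longrightarrow>
    cop ((s1 ^^ i) ((s2 ^^ j) d)) ((s1 ^^ i') ((s2 ^^ j') d))"
    using eventually_cop[OF d(1,2)] by blast
  obtain G where G: "f = scal.op_T.act (monom 1 r * G) f"
    using scal.tors_eq_power[OF assms, of r] field_hom_eq_0_iff[OF hom1] by blast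
  define N where "N = degree (monom 1 r * G)"
  define e where "e = (\<Prod>i\<in>{r..N}. (s1 ^^ i) d)"
  have "to_fract e * (\<sigma>1 ^^ i) f \<in> R" if "i \<in> {r..N}" for i
  proof -
    have "e = (s1 ^^ i) d * (\<Prod>j\<in>{r..N}-{i}. (s1 ^^ j) d)"
      unfolding e_def by (rule prod.remove) (use that in auto)
    moreover have "(\<sigma>1 ^^ i) (to_fract d * f) \<in> R"
      using d(3) by (induction i) (auto intro: R_\<sigma>)
    moreover have "(\<sigma>1 ^^ i) (to_fract d * f) = to_fract ((s1 ^^ i) d) * (\<sigma>1 ^^ i) f"
      by (induction i) (simp_all add: field_hom_simps hom1 s1)
    ultimately show ?thesis
      using R_mult[OF R_to_fract, of "to_fract ((s1 ^^ i) d) * (\<sigma>1 ^^ i) f" "\<Prod>j\<in>{r..N}-{i}. (s1 ^^ j) d"]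
      by (simp add: ac_simps)
  qed
  then have R1: "k_const c * (to_fract e * (\<sigma>1 ^^ i) f) \<in> R" if "i \<in> {r..N}" for i c
    using R_mult that Pol_R Pol_closed(4) by blast
  have c0: "coeff (monom 1 r * G) i = 0" if "i < r" for i
    using that by (simp add: coeff_monom_mult)
  have "to_fract e * f = to_fract e * scal.op_T.act (monom 1 r * G) f" using G by simp
  also have "\<dots> = (\<Sum>i\<le>N. k_const (coeff (monom 1 r * G) i) * (to_fract e * (\<sigma>1 ^^ i) f))"
    by (simp add: scal.op_T.act_def N_def sum_distrib_left mult.left_commute)
  also have "\<dots> \<in> R"
  proof (rule R_sum)
    fix i assume "i \<in> {..N}"
    then show "k_const (coeff (monom 1 r * G) i) * (to_fract e * (\<sigma>1 ^^ i) f) \<in> R"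
      using R1[of i] c0[of i] R_to_fract[of 0] by (cases "i < r") auto
  qed
  finally have e: "to_fract e * f \<in> R" .
  have "cop e d" unfolding e_def
  proof (rule cop_prod)
    fix i assume "i \<in> {r..N}"
    then show "cop ((s1 ^^ i) d) d" using r[of 0 i 0 0] r[of i 0 0 0] by simp
  qed
  then obtain u v where "u * e + v * d = 1" unfolding cop_def by blast
  then have "to_fract (u * e + v * d) * f = f" by simp
  then have "f = to_fract u * (to_fract e * f) + to_fract v * (to_fract d * f)"
    by (simp add: algebra_simps)
  then show ?thesis using e d(3) R_add R_mult R_to_fract by metis
qed

lemma poly_map_k_const: "poly (map_poly k_const p) (to_fract g) = to_fract (pcompose p g)"
  by (induction p) (simp_all add: map_poly_pCons pcompose_pCons k_const_def)

lemma consistent_system_matrix_inv: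
  fixes B1 B2 :: "'c::{alg_closed_field,field_char_0} ratfun ^ 'n ^ 'n"
  assumes "commuting_endos \<sigma>1 \<sigma>2" "invertible B1" "invertible B2"
    and B: "map_matrix \<sigma>1 B2 ** B1 = map_matrix \<sigma>2 B1 ** B2"
  shows "consistent_system \<sigma>1 \<sigma>2 (matrix_inv B1) (matrix_inv B2)"
proof
  show "C_alg_hom k_const k_const \<sigma>1" "C_alg_hom k_const k_const \<sigma>2" "\<sigma>1 (\<sigma>2 f) = \<sigma>2 (\<sigma>1 f)" for f
    using assms(1) unfolding commuting_endos_def by (auto dest: fun_cong)
  then have hom: "field_hom \<sigma>1" "field_hom \<sigma>2" by (auto simp: C_alg_hom_def)
  show "invertible (matrix_inv B1)" "invertible (matrix_inv B2)" using assms by (auto intro: invertible_matrix_inv)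
  have inv: "matrix_inv (map_matrix \<sigma> B) = map_matrix \<sigma> (matrix_inv B)"
    if "field_hom \<sigma>" "invertible B" for \<sigma> and B :: "'c ratfun ^ 'n ^ 'n"
    by (rule matrix_inv_unique) (simp_all add: that matrix_inv map_matrix_mat_1 flip: map_matrix_mult)
  from B have "matrix_inv (map_matrix \<sigma>1 B2 ** B1) = matrix_inv (map_matrix \<sigma>2 B1 ** B2)" by simp
  then show "matrix_inv B1 ** map_matrix \<sigma>1 (matrix_inv B2) = matrix_inv B2 ** map_matrix \<sigma>2 (matrix_inv B1)"
    using assms(2,3) hom by (simp add: matrix_inv_mult invertible_map_matrix inv)
qed

lemma vec_span_axis:
  fixes V :: "('a::field ^ 'n) set"
  assumes "g \<noteq> 0" "\<And>m. g *s axis m 1 \<in> vec.span V"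
  shows "vec.span V = UNIV"
proof -
  have "(axis m 1 :: 'a ^ 'n) \<in> vec.span V" for m
    using vec.span_scale[OF assms(2)[of m], of "inverse g"] assms(1) by (simp add: vector_smult_assoc)
  then have "v \<in> vec.span V" for v
    using basis_expansion[of v] by (metis (no_types, lifting) vec.span_scale vec.span_sum)
  then show ?thesis by blast
qed

section \<open>Two shifts\<close>

lemma pcompose_power: "pcompose (p ^ m) q = pcompose p q ^ m"
  by (induction m) (simp_all add: pcompose_mult pcompose_1)

text \<open>Surjectivity by induction on the degree. The operator keeps the degree if a and c
  differ. If they agree it lowers the degree of x^(n + 1) by exactly one, with leading coefficient a
  (n + 1), nonzero in characteristic 0.\<close>

lemma shift_equation_solvable:
  fixes g :: "'c::field_char_0 poly"
  assumes "a \<noteq> 0"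
  shows "\<exists>y. smult a (pcompose y [:1, 1:]) - smult c y = g"
proof (induction "degree g" arbitrary: g rule: less_induct)
  case less
  define L where "L y = smult a (pcompose y [:1, 1:]) - smult c y" for y
  have L_add: "L (y + z) = L y + L z" for y z
    by (simp add: L_def pcompose_add smult_add_right)
  have pc: "coeff (pcompose y [:1, 1:]) (degree y) = lead_coeff y" for y :: "'c poly"
    using lead_coeff_comp[of "[:1, 1::'c:]" y] by (simp add: degree_pcompose)
  show ?case
  proof (cases "g = 0")
    case True
    then show ?thesis by (intro exI[of _ 0]) simp
  next
    case False
    define n where "n = degree g"
    have "\<exists>y0. degree (L y0) \<le> n \<and> coeff (L y0) n \<noteq> 0"
    proof (cases "a = c")
      case False
      have "degree (L (monom 1 n)) \<le> n" unfolding L_def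
        by (intro degree_diff_le order.trans[OF degree_smult_le]) (simp_all add: degree_pcompose degree_monom_eq)
      moreover have "coeff (L (monom 1 n)) n = a - c"
        using pc[of "monom 1 n"] by (simp add: L_def degree_monom_eq)
      ultimately show ?thesis using False by auto
    next
      case True
      define q where "q = pcompose (monom 1 (Suc n)) [:1, 1::'c:]"
      have q: "q = [:1, 1:] ^ Suc n" by (simp add: q_def monom_altdef pcompose_power pcompose_pCons)
      have c: "coeff (L (monom 1 (Suc n))) i = a * (coeff q i - (if i = Suc n then 1 else 0))" for i
        by (simp add: L_def True q_def algebra_simps)
      have qd: "degree q = Suc n" by (simp add: q_def degree_pcompose degree_monom_eq)
      have "coeff q (Suc n) = 1"
        using pc[of "monom 1 (Suc n)"] by (simp add: q_def degree_monom_eq)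
      moreover have "coeff q n = of_nat (Suc n)"
        unfolding q by (simp add: coeff_linear_poly_power del: power_Suc)
      ultimately have "coeff (L (monom 1 (Suc n))) n = a * of_nat (Suc n)"
        "degree (L (monom 1 (Suc n))) \<le> n"
        by (simp add: c, intro degree_le) (auto simp: c qd coeff_eq_0 not_less_eq less_Suc_eq_le dest: Suc_leI le_imp_less_or_eq)
      then show ?thesis using assms of_nat_neq_0[of n] by (metis mult_eq_0_iff)
    qed
    then obtain y0 where y0: "degree (L y0) \<le> n" "coeff (L y0) n \<noteq> 0" by blast
    define b where "b = lead_coeff g / coeff (L y0) n"
    have L_smult: "L (smult t y) = smult t (L y)" for t y
      by (simp add: L_def pcompose_smult smult_diff_right mult.commute)
    have "\<exists>y. L y = g - L (smult b y0)"
    proof (cases "g - L (smult b y0) = 0")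
      case True
      then show ?thesis by (intro exI[of _ 0]) (simp add: L_def)
    next
      case nz: False
      have "coeff (g - L (smult b y0)) i = 0" if "i \<ge> n" for i
        using that y0 by (cases "i = n") (auto simp: L_smult b_def n_def coeff_eq_0)
      then have "degree (g - L (smult b y0)) < degree g"
        using nz by (metis leading_coeff_0_iff n_def not_le)
      from less[OF this] show ?thesis by (simp add: L_def)
    qed
    then obtain y where "L y = g - L (smult b y0)" by blast
    then have "L (y + smult b y0) = g" by (simp add: L_add)
    then show ?thesis unfolding L_def by blast
  qed
qed

text \<open>Leading coefficients give a = 1 for nonzero p, and then p takes one value at all natural
  numbers.\<close>

lemma periodic_poly_const:
  fixes p :: "'c::field_char_0 poly"
  assumes "pcompose p [:1, 1:] = smult a p"
  shows "\<exists>c. p = [:c:]"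
proof (cases "p = 0")
  case False
  have "lead_coeff (pcompose p [:1, 1:]) = lead_coeff p" by (subst lead_coeff_comp) auto
  then have "a * lead_coeff p = lead_coeff p" unfolding assms lead_coeff_smult .
  then have "a = 1" using False by simp
  then have eq: "pcompose p [:1, 1:] = p" using assms by simp
  have "poly p (of_nat i) = poly p 0" for i
  proof (induction i)
    case (Suc i)
    have "poly p (of_nat (Suc i)) = poly (pcompose p [:1, 1:]) (of_nat i)" by (simp add: poly_pcompose)
    then show ?case using Suc eq by simp
  qed simp
  then have "range (of_nat :: nat \<Rightarrow> 'c) \<subseteq> {y. poly (p - [:poly p 0:]) y = 0}" by auto
  moreover have "infinite (range (of_nat :: nat \<Rightarrow> 'c))" by (simp add: finite_image_iff inj_of_nat)
  ultimately have "p - [:poly p 0:] = 0" using poly_roots_finite finite_subset by blast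
  then show ?thesis by auto
qed (intro exI[of _ 0], simp)

lemma irrational_independent:
  fixes \<alpha> :: "'c::field_char_0"
  assumes "\<alpha> \<notin> \<rat>" "of_nat i + of_nat j * \<alpha> = of_nat i' + of_nat j' * \<alpha>"
  shows "i = i' \<and> j = j'"
proof -
  have eq: "(of_int (int j - int j')) * \<alpha> = of_int (int i' - int i)"
    using assms(2) by (simp add: algebra_simps)
  have "j = j'"
  proof (rule ccontr)
    assume "j \<noteq> j'"
    then have "(of_int (int j - int j') :: 'c) \<noteq> 0" by simp
    then have "\<alpha> = of_int (int i' - int i) / of_int (int j - int j')"
      using eq by (simp add: field_simps)
    then show False using assms(1) Rats_divide Rats_of_int by metis
  qed
  then show ?thesis using assms(2) by simp
qed

text \<open>Let \<open>E\<close> be the eigenvectors of \<open>\<Phi>1\<close> with constant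
  eigenvalue. Solving difference equations in polynomials shows that polynomial combinations of
  \<open>E\<close> include all torsion vectors, so \<open>E\<close> spans over k. The coordinates of
  an eigenvector in a basis of eigenvectors are torsion scalars, hence polynomials, and satisfy f(x
  + 1) = b f(x), hence are constant. As \<open>\<Phi>2\<close> preserves \<open>E\<close>, the
  C-span of the basis is stable.\<close>

theorem constant_form_2S:
  fixes \<sigma>1 \<sigma>2 :: "'c::{alg_closed_field,field_char_0} ratfun \<Rightarrow> 'c ratfun"
    and D1 D2 :: "'c ratfun ^ 'n ^ 'n"
  assumes "consistent_system \<sigma>1 \<sigma>2 D1 D2" "case_2S \<sigma>1 \<sigma>2"
  shows "\<exists>P (A1 :: 'c^'n^'n) (A2 :: 'c^'n^'n). invertible P \<and> A1 ** A2 = A2 ** A1 \<and>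
    D1 ** map_matrix \<sigma>1 P = P ** map_matrix k_const A1 \<and>
    D2 ** map_matrix \<sigma>2 P = P ** map_matrix k_const A2"
proof -
  interpret consistent_system \<sigma>1 \<sigma>2 D1 D2 by fact
  obtain \<alpha> where \<alpha>: "\<alpha> \<notin> \<rat>" and v1: "\<sigma>1 k_var = k_var + 1" and v2: "\<sigma>2 k_var = k_var + k_const \<alpha>"
    using assms(2) unfolding case_2S_def by blast
  define s where "s a p = pcompose p [:a, 1:]" for a :: 'c and p
  have s1: "\<sigma>1 (to_fract p) = to_fract (s 1 p)" and s2: "\<sigma>2 (to_fract p) = to_fract (s \<alpha> p)" for p
  proof -
    have "\<sigma>1 k_var = to_fract [:1, 1:]" "\<sigma>2 k_var = to_fract [:\<alpha>, 1:]"
      unfolding v1 v2 by (simp_all add: k_var_def k_const_def one_pCons flip: to_fract_1 to_fract_add)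
    then show "\<sigma>1 (to_fract p) = to_fract (s 1 p)" "\<sigma>2 (to_fract p) = to_fract (s \<alpha> p)"
      by (simp_all add: C_alg_hom_k_eval[OF alg1] C_alg_hom_k_eval[OF alg2] poly_map_k_const s_def)
  qed
  have s_inv: "s a (s (- a) p) = p" for a p
    by (simp add: s_def pcompose_assoc[symmetric] pcompose_pCons pcompose_idR)
  have iter: "((\<lambda>y. y + a) ^^ i) y = y + of_nat i * a" for a y :: 'c and i
    by (induction i) (simp_all add: algebra_simps)
  have vali_\<sigma>1: "vali.vge e (\<sigma>1 f)" if "vali.vge e f" for e f
  proof (cases "f = 0")
    case False
    then obtain a b where ab: "a \<noteq> 0" "b \<noteq> 0" "f = to_fract a / to_fract b" using vali.nz_cases by metis
    have nz: "s 1 p \<noteq> 0" if "p \<noteq> 0" for p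
      using that field_hom_eq_0_iff[OF hom1, of "to_fract p"] by (auto simp: s1)
    have "vali.val (\<sigma>1 f) = vali.val f"
      using ab nz by (simp add: field_hom_simps hom1 s1 vali.val_quot)
        (simp add: s_def degree_pcompose)
    then show ?thesis using that False by (simp add: vali.vge_def)
  qed (simp add: field_hom_simps hom1)
  \<comment> \<open>The only point outside \<open>Y\<close> is infinity, where the valuation bounds
    the pole.\<close>
  interpret free_system \<sigma>1 \<sigma>2 D1 D2 "s 1" "s \<alpha>" "\<lambda>y. y + 1" "\<lambda>y. y + \<alpha>" UNIV Pol "\<lambda>e. vali.vge (- real e)"
  proof (unfold_locales, goal_cases)
    case (1 p) show ?case by (rule s1)
  next
    case (2 p) show ?case by (rule s2)
  next
    case (3 p y) show ?case by (simp add: s_def poly_pcompose add.commute)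
  next
    case (4 p y) show ?case by (simp add: s_def poly_pcompose add.commute)
  next
    case (5 p) show ?case using s_inv by blast
  next
    case (9 y i j i' j')
    then have "of_nat i + of_nat j * \<alpha> = of_nat i' + of_nat j' * \<alpha>" by (simp add: iter algebra_simps)
    then show ?case using irrational_independent[OF \<alpha>] by blast
  next
    case (13 f)
    then obtain p where p: "f = to_fract p" by (auto simp: Pol_def)
    show ?case unfolding p s1 by (rule Pol_closed)
  next
    case (14 f)
    then obtain p where p: "f = to_fract p" by (auto simp: Pol_def)
    show ?case unfolding p s2 by (rule Pol_closed)
  next
    case (15 f)
    obtain a b where "b \<noteq> 0" "f = to_fract a / to_fract b" by (rule ratfun_cases)
    then show ?case by (intro exI[of _ b]) (simp add: Pol_closed)
  next
    case (16 e f e') then show ?case by (auto elim: vali.vge_mono)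
  next
    case (19 e f e' g) then show ?case using vali.vge_mult[OF 19] by simp
  next
    case (21 f) show ?case by (rule vali.vge_exists)
  next
    case (22 f e)
    then obtain p where p: "f = to_fract p" by (auto simp: Pol_def)
    then have "degree p \<le> e" using 22 vali_to_fract by blast
    then have "degree ([:0, 1:] ^ e * p) \<le> 2 * e"
      using degree_mult_le[of "[:0, 1:] ^ e" p] degree_power_le[of "[:0, 1::'c:]" e] by simp
    then show ?case unfolding p
      by (intro exI[of _ "[:0, 1:] ^ e * p"]) (simp add: k_var_def to_fract_power)
  qed (auto simp: Pol_closed vali.vge_add vali_\<sigma>1 algebra_simps)
  have "\<exists>g. g \<noteq> 0 \<and> (\<forall>m. ops.tors (g *s axis m 1))"
  proof (rule torsion_lattice)
    fix L m0 v
    assume *: "C.subspace L" "\<And>v. v \<in> L \<Longrightarrow> \<Phi>1 v \<in> L" "\<And>v. v \<in> L \<Longrightarrow> \<Phi>2 v \<in> L" "\<And>v. v \<in> L \<Longrightarrow> k_var *s v \<in> L"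
      "\<And>w. (\<And>i. i \<le> (m0::nat) \<Longrightarrow> w i \<in> L) \<Longrightarrow> \<exists>f. (\<exists>i\<le>m0. f i \<noteq> 0) \<and> (\<Sum>i\<le>m0. ops.op_T.act (f i) (w i)) = 0"
      "v \<in> L"
    show "ops.tors v"
    proof (rule ops.all_tors_translation[where X = "\<lambda>v. k_var *s v" and \<alpha> = \<alpha>, OF _ _ _ _ _ *(1-4) _ *(5,6)])
      show "of_nat b * \<alpha> + of_nat d \<noteq> of_nat b' * \<alpha> + of_nat d'" if "b \<noteq> b'" for b b' d d'
        using irrational_independent[OF \<alpha>, of d b d' b'] that by (auto simp: add.commute)
      show "v = 0" if "\<Phi>2 v = 0" for v using that by simp
    qed (simp_all add: semilin_scale hom1 hom2 v1 v2 vec_eq_iff algebra_simps)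
  qed
  then obtain g where g: "g \<noteq> 0" "\<And>m. ops.tors (g *s axis m 1)" by blast
  define E where "E = {v. \<exists>c. \<Phi>1 v = k_const c *s v}"
  \<comment> \<open>Polynomial combinations of eigenvectors, kept as lists so that equations are
    solved one summand at a time.\<close>
  define PE where "PE = {v. \<exists>M. set M \<subseteq> UNIV \<times> E \<and> v = (\<Sum>(y, p)\<leftarrow>M. to_fract y *s p)}"
  have PE_0: "0 \<in> PE" unfolding PE_def by (auto intro: exI[of _ "[]"])
  have PE_Cons: "to_fract y *s p + v \<in> PE" if "p \<in> E" "v \<in> PE" for y p v
  proof -
    from that(2) obtain M where "set M \<subseteq> UNIV \<times> E" "v = (\<Sum>(y, p)\<leftarrow>M. to_fract y *s p)" by (auto simp: PE_def)
    then show ?thesis unfolding PE_def using that(1) by (auto intro!: exI[of _ "(y, p) # M"])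
  qed
  have solve: "\<exists>z\<in>PE. \<Phi>1 z - k_const c *s z = v" if "v \<in> PE" for v c
  proof -
    from that obtain M where "set M \<subseteq> UNIV \<times> E" "v = (\<Sum>(y, p)\<leftarrow>M. to_fract y *s p)" by (auto simp: PE_def)
    then show ?thesis
    proof (induction M arbitrary: v)
      case Nil
      then show ?case using PE_0 by (intro bexI[of _ 0]) (auto simp: ops.op_T.T_0)
    next
      case (Cons yp M)
      obtain y p where yp: "yp = (y, p)" by (cases yp)
      define u where "u = (\<Sum>(y, p)\<leftarrow>M. to_fract y *s p)"
      obtain z where z: "z \<in> PE" "\<Phi>1 z - k_const c *s z = u"
        using Cons unfolding u_def by auto
      have "p \<in> E" using Cons yp by auto
      then obtain a where a: "\<Phi>1 p = k_const a *s p" unfolding E_def by blast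
      show ?case
      proof (cases "p = 0")
        case True
        then show ?thesis using z Cons yp u_def by auto
      next
        case False
        have "a \<noteq> 0"
        proof
          assume "a = 0"
          then have "\<Phi>1 p = 0" using a by simp
          then show False using False by simp
        qed
        then obtain t where t: "smult a (pcompose t [:1, 1:]) - smult c t = y"
          using shift_equation_solvable by blast
        have "\<Phi>1 (to_fract t *s p) - k_const c *s (to_fract t *s p)
            = to_fract (smult a (s 1 t) - smult c t) *s p"
          by (simp add: semilin_scale hom1 s1 a vector_smult_assoc to_fract_smult mult.commute
              vec.scale_left_diff_distrib)
        also have "\<dots> = to_fract y *s p" using t by (simp add: s_def)
        finally have "\<Phi>1 (to_fract t *s p + z) - k_const c *s (to_fract t *s p + z) = to_fract y *s p + u"
          using z(2) by (simp add: semilin_add hom1 vec.scale_right_distrib algebra_simps)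
        moreover have "v = to_fract y *s p + u" using Cons yp by (simp add: u_def)
        ultimately show ?thesis using PE_Cons[OF \<open>p \<in> E\<close> z(1)] by blast
      qed
    qed
  qed
  \<comment> \<open>Split a linear factor X - c off f. By induction u = \<Phi>1 v - c v lies in
    \<open>PE\<close>, and subtracting from v a solution z in \<open>PE\<close> of the same equation
    leaves an eigenvector.\<close>
  have tors_PE: "v \<in> PE" if "f \<noteq> 0" "ops.op_T.act f v = 0" for f v
    using that
  proof (induction "degree f" arbitrary: f v)
    case 0
    then obtain a where "f = [:a:]" "a \<noteq> 0" by (metis degree_eq_zeroE pCons_0_0)
    then have "v = 0" using 0 by simp
    then show ?case using PE_0 by simp
  next
    case (Suc d)
    then obtain c where "poly f c = 0" using alg_closed_imp_poly_has_root[of f] by auto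
    then obtain h where h: "f = [:- c, 1:] * h" by (auto simp: poly_eq_0_iff_dvd)
    then have "h \<noteq> 0" using Suc by auto
    then have "degree f = 1 + degree h" unfolding h by (subst degree_mult_eq) auto
    then have "d = degree h" using Suc by simp
    define u where "u = ops.op_T.act [:- c, 1:] v"
    have u: "u = \<Phi>1 v - k_const c *s v" by (simp add: u_def ops.op_T.act_pCons)
    have "ops.op_T.act h u = ops.op_T.act (h * [:- c, 1:]) v"
      unfolding u_def by (simp only: ops.op_T.act_mult)
    also have "\<dots> = 0" using Suc.prems h by (simp add: mult.commute)
    finally have "u \<in> PE" using Suc.hyps(1)[OF \<open>d = degree h\<close> \<open>h \<noteq> 0\<close>] by blast
    then obtain z where z: "z \<in> PE" "\<Phi>1 z - k_const c *s z = u" using solve by blast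
    have "\<Phi>1 (v - z) = \<Phi>1 v - \<Phi>1 z"
      using semilin_add[OF hom1, of D1 "v - z" z] by (simp add: algebra_simps)
    also have "\<dots> = k_const c *s (v - z)" using z(2) u by (simp add: vec.scale_right_diff_distrib algebra_simps)
    finally have "v - z \<in> E" unfolding E_def by blast
    from PE_Cons[OF this z(1), of 1] show ?case by simp
  qed
  have "PE \<subseteq> vec.span E"
  proof
    fix v assume "v \<in> PE"
    then obtain M where "set M \<subseteq> UNIV \<times> E" "v = (\<Sum>(y, p)\<leftarrow>M. to_fract y *s p)" by (auto simp: PE_def)
    then show "v \<in> vec.span E"
      by (induction M arbitrary: v) (auto simp: vec.span_zero vec.span_base intro!: vec.span_add vec.span_scale)
  qed
  then have "vec.span E = UNIV"
    using g tors_PE unfolding ops.tors_def by (intro vec_span_axis[OF g(1)]) blast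
  obtain W where W: "W \<subseteq> E" "vec.independent W" "E \<subseteq> vec.span W"
    using vec.maximal_independent_subset by blast
  have "finite W" using W(2) vec.independent_bound_general by blast
  have "vec.span W = UNIV" using W(3) \<open>vec.span E = UNIV\<close> by (metis vec.span_minimal vec.subspace_span top.extremum_uniqueI)
  have key: "v \<in> C.span W" if "v \<in> E" for v
  proof -
    have "v \<in> vec.span W" using that W(3) by blast
    then obtain f where f: "v = (\<Sum>w\<in>W. f w *s w)"
      unfolding vec.span_finite[OF \<open>finite W\<close>] by blast
    obtain c where c: "\<Phi>1 v = k_const c *s v" using \<open>v \<in> E\<close> unfolding E_def by blast
    have "\<forall>w\<in>W. \<exists>a. \<Phi>1 w = k_const a *s w" using W(1) unfolding E_def by blast
    from bchoice[OF this] obtain a where a: "\<And>w. w \<in> W \<Longrightarrow> \<Phi>1 w = k_const (a w) *s w" by blast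
    have "(\<Sum>w\<in>W. (\<sigma>1 (f w) * k_const (a w)) *s w) = \<Phi>1 v"
      unfolding f ops.op_T.T_sum by (rule sum.cong) (simp_all add: semilin_scale hom1 a vector_smult_assoc)
    also have "\<dots> = (\<Sum>w\<in>W. (k_const c * f w) *s w)" unfolding c by (simp add: f vec.scale_sum_right vector_smult_assoc)
    finally have 0: "(\<Sum>w\<in>W. (\<sigma>1 (f w) * k_const (a w) - k_const c * f w) *s w) = 0"
      by (simp add: vec.scale_left_diff_distrib sum_subtractf)
    have eq: "\<sigma>1 (f w) * k_const (a w) = k_const c * f w" if "w \<in> W" for w
      using vec.independentD[where u = "\<lambda>w. \<sigma>1 (f w) * k_const (a w) - k_const c * f w", OF W(2) \<open>finite W\<close> order.refl 0 that] by simp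
    have "\<exists>b. f w = k_const b" if "w \<in> W" for w
    proof -
      have "w \<noteq> 0" using W(2) that vec.dependent_zero by blast
      then have "a w \<noteq> 0" using a[OF that] \<Phi>1_eq_0[of w] by auto
      have "k_const (inverse (a w)) * k_const (a w) = 1"
        using \<open>a w \<noteq> 0\<close> by (simp flip: k_const_hom(3))
      then have "\<sigma>1 (f w) = (k_const (inverse (a w)) * k_const (a w)) * \<sigma>1 (f w)" by simp
      also have "\<dots> = k_const (inverse (a w)) * (\<sigma>1 (f w) * k_const (a w))" by (simp only: ac_simps)
      also have "\<dots> = k_const (c / a w) * f w"
        unfolding eq[OF that] by (simp only: divide_inverse k_const_hom ac_simps)
      finally have \<sigma>f: "\<sigma>1 (f w) = k_const (c / a w) * f w" .
      have "scal.op_T.act [:- (c / a w), 1:] (f w) = 0" by (simp add: scal.op_T.act_pCons \<sigma>f)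
      then have "scal.tors (f w)" by (intro scal.torsI[of "[:- (c / a w), 1:]"]) auto
      then obtain p where p: "f w = to_fract p" using scal_tors_R by (auto simp: Pol_def)
      have "to_fract (s 1 p) = to_fract (smult (c / a w) p)" using \<sigma>f unfolding p s1 by (simp add: to_fract_smult)
      then have "pcompose p [:1, 1:] = smult (c / a w) p" by (simp only: to_fract_eq_iff s_def)
      from periodic_poly_const[OF this] show ?thesis by (auto simp: p k_const_def)
    qed
    then show ?thesis unfolding f
      by (intro C.span_sum) (metis C.span_base C.span_scale)
  qed
  show ?thesis
  proof (rule constant_form[OF \<open>finite W\<close> W(2) \<open>vec.span W = UNIV\<close>])
    fix w assume "w \<in> W"
    then obtain c where c: "\<Phi>1 w = k_const c *s w" using W(1) unfolding E_def by blast
    then show "\<Phi>1 w \<in> C.span W" using \<open>w \<in> W\<close> by (simp add: C.span_base C.span_scale)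
    have "\<Phi>1 (\<Phi>2 w) = k_const c *s \<Phi>2 w" unfolding \<Phi>12_commute c by (simp add: semilin_scale hom2)
    then show "\<Phi>2 w \<in> C.span W" using key unfolding E_def by blast
  qed
qed

section \<open>Two dilations\<close>

text \<open>\<open>mult_independent\<close> excludes only relations with both exponents nonzero; the
  remaining ones would make \<open>q1\<close> or \<open>q2\<close> a root of unity.\<close>

lemma multiplicatively_free:
  fixes q1 q2 :: "'a::field"
  assumes "q1 \<noteq> 0" "q2 \<noteq> 0" "\<not> root_of_unity q1" "\<not> root_of_unity q2" "mult_independent q1 q2"
    and eq: "q1 ^ i * q2 ^ j = q1 ^ i' * q2 ^ j'"
  shows "i = i' \<and> j = j'"
proof -
  have root: "k = 0" if "q powi k = 1" "q \<noteq> 0" "\<not> root_of_unity q" for q :: 'a and k :: int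
  proof (rule ccontr)
    assume "k \<noteq> 0"
    have "q ^ nat \<bar>k\<bar> = 1"
      using that by (cases "k \<ge> 0") (auto simp: power_int_def power_inverse)
    then show False using that(3) \<open>k \<noteq> 0\<close> unfolding root_of_unity_def by (metis zero_less_abs_iff zero_less_nat_eq)
  qed
  have "q2 powi (int j - int j') = q2 ^ j / q2 ^ j'" "q1 powi (int i' - int i) = q1 ^ i' / q1 ^ i"
    using assms(1,2) by (simp_all add: power_int_diff)
  moreover have "q2 ^ j / q2 ^ j' = q1 ^ i' / q1 ^ i"
    using eq assms(1,2) by (simp add: field_simps)
  ultimately have e: "q2 powi (int j - int j') = q1 powi (int i' - int i)" by simp
  then have "int j - int j' = 0 \<or> int i' - int i = 0"
    using assms(5) unfolding mult_independent_def by blast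
  then have "int j - int j' = 0 \<and> int i' - int i = 0"
    using e root[OF _ assms(1,3), of "int i' - int i"] root[OF _ assms(2,4), of "int j - int j'"] by auto
  then show ?thesis by simp
qed

lemma order_0_dilate:
  assumes "q \<noteq> 0" "p \<noteq> 0"
  shows "order 0 (pcompose p [:0, q :: 'c::field:]) = order 0 p" "pcompose p [:0, q:] \<noteq> 0"
proof -
  show nz: "pcompose p [:0, q:] \<noteq> 0" using assms pcompose_eq_0[of p "[:0, q:]"] by auto
  obtain r where r: "p = [:- 0, 1:] ^ order 0 p * r" "\<not> [:- 0, 1:] dvd r"
    using order_decomp[OF assms(2)] by blast
  then have "r \<noteq> 0" "poly r 0 \<noteq> 0" by (auto simp: poly_eq_0_iff_dvd)
  have "pcompose p [:0, q:] = smult (q ^ order 0 p) ([:- 0, 1:] ^ order 0 p * pcompose r [:0, q:])"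
  proof -
    have "[:0, q:] = smult q [:0, 1:]" by simp
    then have "[:0, q:] ^ order 0 p = smult (q ^ order 0 p) ([:0, 1:] ^ order 0 p)" by (simp only: smult_power)
    then show ?thesis
      by (subst (1) r(1)) (simp add: pcompose_mult pcompose_power pcompose_pCons)
  qed
  then have "order 0 (pcompose p [:0, q:]) = order 0 ([:- 0, 1:] ^ order 0 p * pcompose r [:0, q:])"
    using assms by (simp add: order_smult)
  also have "\<dots> = order 0 ([:- 0, 1::'c:] ^ order 0 p) + order 0 (pcompose r [:0, q:])"
    using \<open>r \<noteq> 0\<close> assms pcompose_eq_0[of r "[:0, q:]"] by (intro order_mult) auto
  also have "order 0 (pcompose r [:0, q:]) = 0" using \<open>poly r 0 \<noteq> 0\<close> by (intro order_0I) (simp add: poly_pcompose)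
  finally show "order 0 (pcompose p [:0, q:]) = order 0 p"
    using order_power_n_n[of "0 :: 'c" "order 0 p"] by simp
qed

lemma Lau_cases: "f \<in> Lau \<Longrightarrow> \<exists>m p. k_var ^ m * f = to_fract p"
  unfolding Lau_def Pol_def by auto

text \<open>Fixing one representative in each class of nonzero scalars modulo powers of
  \<open>q1\<close> singles out the space \<open>V\<close> of torsion vectors with eigenvalues among
  the representatives. Shifting eigenvalues by powers of x shows that \<open>V\<close> spans over k.
  A vector of \<open>V\<close> expressed in other elements of \<open>V\<close> with Laurent
  coefficients splits by powers of x, and only the power 0 is compatible with the representatives;
  so \<open>V\<close> has finite dimension over C.\<close>

theorem constant_form_2Q:
  fixes \<sigma>1 \<sigma>2 :: "'c::{alg_closed_field,field_char_0} ratfun \<Rightarrow> 'c ratfun"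
    and D1 D2 :: "'c ratfun ^ 'n ^ 'n"
  assumes "consistent_system \<sigma>1 \<sigma>2 D1 D2" "case_2Q \<sigma>1 \<sigma>2"
  shows "\<exists>P (A1 :: 'c^'n^'n) (A2 :: 'c^'n^'n). invertible P \<and> A1 ** A2 = A2 ** A1 \<and>
    D1 ** map_matrix \<sigma>1 P = P ** map_matrix k_const A1 \<and>
    D2 ** map_matrix \<sigma>2 P = P ** map_matrix k_const A2"
proof -
  interpret consistent_system \<sigma>1 \<sigma>2 D1 D2 by fact
  obtain q1 q2 where q: "q1 \<noteq> 0" "q2 \<noteq> 0" "\<not> root_of_unity q1" "\<not> root_of_unity q2" "mult_independent q1 q2"
    and v1: "\<sigma>1 k_var = k_const q1 * k_var" and v2: "\<sigma>2 k_var = k_const q2 * k_var"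
    using assms(2) unfolding case_2Q_def by blast
  note q_free = multiplicatively_free[OF q]
  define s where "s a p = pcompose p [:0, a:]" for a :: 'c and p
  have s1: "\<sigma>1 (to_fract p) = to_fract (s q1 p)" and s2: "\<sigma>2 (to_fract p) = to_fract (s q2 p)" for p
  proof -
    have "\<sigma>1 k_var = to_fract [:0, q1:]" "\<sigma>2 k_var = to_fract [:0, q2:]"
      unfolding v1 v2 by (simp_all add: k_var_def k_const_def flip: to_fract_mult)
    then show "\<sigma>1 (to_fract p) = to_fract (s q1 p)" "\<sigma>2 (to_fract p) = to_fract (s q2 p)"
      by (simp_all add: C_alg_hom_k_eval[OF alg1] C_alg_hom_k_eval[OF alg2] poly_map_k_const s_def)
  qed
  have s_inv: "s a (s (inverse a) p) = p" if "a \<noteq> 0" for a p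
    using that by (simp add: s_def pcompose_assoc[symmetric] pcompose_pCons pcompose_idR)
  have iter: "((\<lambda>y. a * y) ^^ i) y = a ^ i * y" for a y :: 'c and i
    by (induction i) (simp_all add: algebra_simps)
  have vals: "val0.vge e (\<sigma>1 f) \<longleftrightarrow> val0.vge e f" "vali.vge e (\<sigma>1 f) \<longleftrightarrow> vali.vge e f" for e f
  proof -
    have "f = 0 \<or> val0.val (\<sigma>1 f) = val0.val f \<and> vali.val (\<sigma>1 f) = vali.val f"
    proof (cases "f = 0")
      case False
      then obtain a b where ab: "a \<noteq> 0" "b \<noteq> 0" "f = to_fract a / to_fract b" using vali.nz_cases by metis
      have "degree (s q1 p) = degree p" for p using q(1) by (simp add: s_def degree_pcompose)
      moreover have "s q1 p \<noteq> 0 \<and> order 0 (s q1 p) = order 0 p" if "p \<noteq> 0" for p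
        using order_0_dilate[OF q(1) that] by (simp add: s_def)
      ultimately show ?thesis
        using ab by (simp add: field_hom_simps hom1 s1 vali.val_quot val0.val_quot)
    qed simp
    then show "val0.vge e (\<sigma>1 f) \<longleftrightarrow> val0.vge e f" "vali.vge e (\<sigma>1 f) \<longleftrightarrow> vali.vge e f"
      by (auto simp: val0.vge_def vali.vge_def field_hom_eq_0_iff hom1 field_hom_simps)
  qed
  have Lau_hom: "\<sigma> f \<in> Lau" if "f \<in> Lau" "field_hom \<sigma>" "\<sigma> k_var = k_const a * k_var" "a \<noteq> 0"
    "\<And>p. \<sigma> (to_fract p) = to_fract (s a p)" for \<sigma> f a
  proof -
    from Lau_cases[OF that(1)] obtain m p where m: "k_var ^ m * f = to_fract p" by blast
    have "\<sigma> (k_var ^ m * f) = to_fract (s a p)" unfolding m that(5) ..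
    then have "k_const a ^ m * k_var ^ m * \<sigma> f = to_fract (s a p)"
      by (simp add: field_hom_simps that(2,3) power_mult_distrib)
    then have "k_const (inverse a ^ m) * (k_const (a ^ m) * (k_var ^ m * \<sigma> f)) = k_const (inverse a ^ m) * to_fract (s a p)"
      by (simp add: k_const_power ac_simps)
    also have "k_const (inverse a ^ m) * (k_const (a ^ m) * (k_var ^ m * \<sigma> f)) = k_var ^ m * \<sigma> f"
      using \<open>a \<noteq> 0\<close> by (simp add: mult.assoc[symmetric] power_mult_distrib[symmetric] flip: k_const_hom(3))
    finally have "k_var ^ m * \<sigma> f \<in> Pol" by (simp add: Pol_closed)
    then show ?thesis by (rule LauI)
  qed
  \<comment> \<open>The points 0 and infinity lie outside \<open>Y\<close>, so both valuations enter
    the bound.\<close>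
  interpret free_system \<sigma>1 \<sigma>2 D1 D2 "s q1" "s q2" "\<lambda>y. q1 * y" "\<lambda>y. q2 * y" "{y. y \<noteq> 0}" Lau
    "\<lambda>e f. val0.vge (- real e) f \<and> vali.vge (- real e) f"
  proof (unfold_locales, goal_cases)
    case (1 p) show ?case by (rule s1)
  next
    case (2 p) show ?case by (rule s2)
  next
    case (3 p y) show ?case by (simp add: s_def poly_pcompose mult.commute)
  next
    case (4 p y) show ?case by (simp add: s_def poly_pcompose mult.commute)
  next
    case (5 p) show ?case using s_inv[OF q(2)] by blast
  next
    case (9 y i j i' j')
    then have "q1 ^ i * q2 ^ j = q1 ^ i' * q2 ^ j'" by (simp add: iter)
    then show ?case by (rule q_free)
  next
    case 10 show ?case using Pol_Lau by blast
  next
    case (11 f g) then show ?case by (rule Lau_add)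
  next
    case (12 f g) then show ?case by (rule Lau_mult)
  next
    case (13 f) show ?case by (rule Lau_hom[OF 13 hom1 v1 q(1) s1])
  next
    case (14 f) show ?case by (rule Lau_hom[OF 14 hom2 v2 q(2) s2])
  next
    case (15 f)
    obtain a b where ab: "b \<noteq> 0" "f = to_fract a / to_fract b" by (rule ratfun_cases)
    obtain d where d: "b = [:- 0, 1:] ^ order 0 b * d" "\<not> [:- 0, 1:] dvd d"
      using order_decomp[OF ab(1)] by blast
    then have "d \<noteq> 0" "poly d 0 \<noteq> 0" by (auto simp: poly_eq_0_iff_dvd)
    have "f = to_fract a / (k_var ^ order 0 b * to_fract d)"
      unfolding ab(2) by (subst d(1)) (simp add: k_var_def to_fract_power)
    then have "k_var ^ order 0 b * (to_fract d * f) = to_fract a" using \<open>d \<noteq> 0\<close> by simp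
    then have "to_fract d * f \<in> Lau" by (intro LauI[of "order 0 b"]) (simp add: Pol_closed)
    then show ?case using \<open>d \<noteq> 0\<close> \<open>poly d 0 \<noteq> 0\<close> by (intro exI[of _ d]) auto
  next
    case (16 e f e') then show ?case by (auto elim: vali.vge_mono val0.vge_mono)
  next
    case (19 e f e' g)
    then show ?case using vali.vge_mult[of "- real e" f "- real e'" g] val0.vge_mult[of "- real e" f "- real e'" g] by simp
  next
    case (21 f)
    obtain e e' where "val0.vge (- real e) f" "vali.vge (- real e') f" using val0.vge_exists vali.vge_exists by metis
    then show ?case by (intro exI[of _ "max e e'"]) (auto elim: vali.vge_mono val0.vge_mono)
  next
    case (22 f e)
    then show ?case using Lau_bounded[of f e e] by (simp add: mult_2)
  qed (auto simp: vali.vge_add val0.vge_add vals q)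
  have "\<exists>g. g \<noteq> 0 \<and> (\<forall>m. ops.tors (g *s axis m 1))"
  proof (rule torsion_lattice)
    fix L m0 v
    assume *: "C.subspace L" "\<And>v. v \<in> L \<Longrightarrow> \<Phi>1 v \<in> L" "\<And>v. v \<in> L \<Longrightarrow> \<Phi>2 v \<in> L" "\<And>v. v \<in> L \<Longrightarrow> k_var *s v \<in> L"
      "\<And>w. (\<And>i. i \<le> (m0::nat) \<Longrightarrow> w i \<in> L) \<Longrightarrow> \<exists>f. (\<exists>i\<le>m0. f i \<noteq> 0) \<and> (\<Sum>i\<le>m0. ops.op_T.act (f i) (w i)) = 0"
      "v \<in> L"
    show "ops.tors v"
    proof (rule ops.all_tors_dilation[where X = "\<lambda>v. k_var *s v" and ?q1.0 = q1 and ?q2.0 = q2, OF _ _ _ _ _ q(1) _ *(1-4) _ *(5,6)])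
      show "q2 ^ b * q1 ^ d \<noteq> q2 ^ b' * q1 ^ d'" if "b \<noteq> b'" for b b' d d'
        using q_free[of d b d' b'] that by (auto simp: mult.commute)
      show "v = 0" if "\<Phi>2 v = 0" for v using that by simp
      show "v = 0" if "k_var *s v = 0" for v using that by (simp add: vec_eq_iff)
    qed (simp_all add: semilin_scale hom1 hom2 v1 v2 vec_eq_iff algebra_simps)
  qed
  then obtain g where g: "g \<noteq> 0" "\<And>m. ops.tors (g *s axis m 1)" by blast
  \<comment> \<open>The predicate depends only on the class of \<open>c\<close> modulo powers of
    \<open>q1\<close>, so the choice is constant on classes.\<close>
  define rep where "rep c = (SOME c'. \<exists>k::int. c' = c * q1 powi k)" for c
  define reps where "reps = {c. c \<noteq> 0 \<and> rep c = c}"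
  have powi_eq_1: "k = 0" if "q1 powi k = 1" for k :: int
  proof -
    have "q1 ^ nat k * q2 ^ 0 = q1 ^ nat (- k) * q2 ^ 0"
      using that q(1) by (cases "k \<ge> 0") (auto simp: power_int_def power_inverse)
    from q_free[OF this] show ?thesis by auto
  qed
  have rep: "\<exists>k::int. rep c = c * q1 powi k" for c
    unfolding rep_def by (rule someI_ex) (auto intro: exI[of _ c])
  have rep_mult: "rep (c * q1 powi k) = rep c" for c k
  proof -
    have "(\<exists>l::int. c' = c * q1 powi k * q1 powi l) \<longleftrightarrow> (\<exists>l::int. c' = c * q1 powi l)" for c'
    proof
      assume "\<exists>l::int. c' = c * q1 powi k * q1 powi l"
      then show "\<exists>l::int. c' = c * q1 powi l" using q(1) by (metis mult.assoc power_int_add)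
    next
      assume "\<exists>l::int. c' = c * q1 powi l"
      then obtain l :: int where "c' = c * q1 powi l" by blast
      then have "c' = c * q1 powi k * q1 powi (l - k)" using q(1) by (simp add: mult.assoc flip: power_int_add)
      then show "\<exists>l::int. c' = c * q1 powi k * q1 powi l" by blast
    qed
    then show ?thesis by (simp add: rep_def)
  qed
  have reps_ex: "\<exists>k::int. c * q1 powi k \<in> reps" if "c \<noteq> 0" for c
  proof -
    obtain k :: int where k: "rep c = c * q1 powi k" using rep by blast
    then have "c * q1 powi k \<in> reps" using that q(1) rep_mult[of c k] by (simp add: reps_def)
    then show ?thesis by blast
  qed
  have reps_unique: "k = 0" if "c \<in> reps" "c * q1 powi k \<in> reps" for c k
  proof -
    have "c * q1 powi k = c" using that rep_mult[of c k] by (simp add: reps_def)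
    then show ?thesis using that(1) powi_eq_1 by (auto simp: reps_def)
  qed
  define V where "V = {v. \<exists>f. f \<noteq> 0 \<and> (\<forall>z. poly f z = 0 \<longrightarrow> z \<in> reps) \<and> ops.op_T.act f v = 0}"
  have act_0: "ops.op_T.act f 0 = 0" for f by (rule ops.mod_T.scale_zero_right)
  have V: "C.subspace V" "\<And>v. v \<in> V \<Longrightarrow> \<Phi>1 v \<in> V" "\<And>v. v \<in> V \<Longrightarrow> \<Phi>2 v \<in> V"
  proof -
    show "C.subspace V"
    proof (rule C.subspaceI)
      show "0 \<in> V" unfolding V_def using act_0 by (auto intro!: exI[of _ 1])
    next
      fix u v assume "u \<in> V" "v \<in> V"
      then obtain f h where f: "f \<noteq> 0" "\<forall>z. poly f z = 0 \<longrightarrow> z \<in> reps" "ops.op_T.act f u = 0"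
        and h: "h \<noteq> 0" "\<forall>z. poly h z = 0 \<longrightarrow> z \<in> reps" "ops.op_T.act h v = 0" unfolding V_def by blast
      have "ops.op_T.act (f * h) v = 0" "ops.op_T.act (h * f) u = 0"
        using f h act_0 by (simp_all only: ops.op_T.act_mult)
      then have "ops.op_T.act (f * h) (u + v) = 0" by (simp add: ops.op_T.act_add_right mult.commute)
      then show "u + v \<in> V" unfolding V_def using f h by (auto intro!: exI[of _ "f * h"])
    next
      fix c v assume "v \<in> V"
      then show "k_const c *s v \<in> V" unfolding V_def by (auto simp: ops.op_T.act_scale)
    qed
    show "\<Phi>1 v \<in> V" if "v \<in> V" for v
      using that unfolding V_def
      by (auto simp: ops.op_T.act_commute[of \<Phi>1, symmetric] ops.T_add ops.T_scale)
    show "\<Phi>2 v \<in> V" if "v \<in> V" for v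
      using that unfolding V_def by (auto simp: ops.S_act[symmetric])
  qed
  have powi1: "\<sigma>1 (k_var powi k) = k_const (q1 powi k) * k_var powi k" for k
  proof -
    have "\<sigma>1 (k_var ^ m) = k_const (q1 ^ m) * k_var ^ m" for m
      by (simp add: field_hom_simps hom1 v1 power_mult_distrib k_const_power)
    then show ?thesis by (simp add: power_int_def field_hom_simps hom1 k_const_inverse k_const_power power_inverse)
  qed
  have act_powi: "ops.op_T.act p (k_var powi k *s v) = k_var powi k *s ops.op_T.act (pcompose p [:0, q1 powi k:]) v" for p k v
    by (rule ops.op_T.act_dilate)
      (simp_all add: vec_eq_iff algebra_simps semilin_scale hom1 powi1)
  \<comment> \<open>Primary decomposition: the part belonging to a root c is moved into
    \<open>V\<close> by a power of x if c is nonzero, and vanishes for c = 0 because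
    \<open>\<Phi>1\<close> is injective. The other part has an annihilator of smaller
    degree.\<close>
  have span_V: "v \<in> vec.span V" if "f \<noteq> 0" "ops.op_T.act f v = 0" for f v
    using that
  proof (induction "degree f" arbitrary: f v rule: less_induct)
    case less
    show ?case
    proof (cases "degree f = 0")
      case True
      then obtain a where "f = [:a:]" "a \<noteq> 0" using less by (metis degree_eq_zeroE pCons_0_0)
      then have "v = 0" using less by simp
      then show ?thesis by (simp add: vec.span_zero)
    next
      case False
      then obtain c where c: "poly f c = 0" using alg_closed_imp_poly_has_root[of f] by auto
      define m where "m = order c f"
      obtain h where h: "f = [:- c, 1:] ^ m * h" "\<not> [:- c, 1:] dvd h"
        using order_decomp[OF less.prems(1)] unfolding m_def by blast
      have "m > 0" using c less.prems(1) order_root[of f c] by (simp add: m_def)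
      have "h \<noteq> 0" "poly h c \<noteq> 0" using h(2) by (auto simp: poly_eq_0_iff_dvd)
      have "degree f = m + degree h"
        unfolding h(1) using \<open>h \<noteq> 0\<close> by (subst degree_mult_eq) (auto simp: degree_linear_power)
      then have "degree h < degree f" using \<open>m > 0\<close> by simp
      have "cop ([:- c, 1:] ^ m) h"
        by (rule cop_no_common_root) (use \<open>poly h c \<noteq> 0\<close> in \<open>auto simp: poly_power\<close>)
      then obtain a b where ab: "a * [:- c, 1:] ^ m + b * h = 1" unfolding cop_def by blast
      define v1 where "v1 = ops.op_T.act (b * h) v"
      define v2 where "v2 = ops.op_T.act (a * [:- c, 1:] ^ m) v"
      have "v = ops.op_T.act (a * [:- c, 1:] ^ m + b * h) v" unfolding ab by simp
      then have v: "v = v2 + v1" unfolding ops.op_T.act_add_left v1_def v2_def .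
      have "ops.op_T.act h v2 = ops.op_T.act (a * f) v"
        unfolding v2_def ops.op_T.act_mult[symmetric] h(1) by (simp only: ac_simps)
      also have "\<dots> = 0" using less.prems(2) act_0 by (simp only: ops.op_T.act_mult)
      finally have 2: "v2 \<in> vec.span V"
        using less.hyps[OF \<open>degree h < degree f\<close> \<open>h \<noteq> 0\<close>] by blast
      have "ops.op_T.act ([:- c, 1:] ^ m) v1 = ops.op_T.act (b * f) v"
        unfolding v1_def ops.op_T.act_mult[symmetric] h(1) by (simp only: ac_simps)
      also have "\<dots> = 0" using less.prems(2) act_0 by (simp only: ops.op_T.act_mult)
      finally have v1_0: "ops.op_T.act ([:- c, 1:] ^ m) v1 = 0" .
      have "v1 \<in> vec.span V"
      proof (cases "c = 0")
        case True
        then have "(\<Phi>1 ^^ m) v1 = 0"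
          using v1_0 ops.op_T.act_monom[of 1 m v1] by (simp add: monom_altdef)
        then have "v1 = 0" by (simp add: \<Phi>1_iter_eq_0)
        then show ?thesis by (simp add: vec.span_zero)
      next
        case False
        then obtain k :: int where k: "c * q1 powi k \<in> reps" using reps_ex by blast
        define c' where "c' = c * q1 powi k"
        have "pcompose ([:- c', 1:] ^ m) [:0, q1 powi k:] = smult ((q1 powi k) ^ m) ([:- c, 1:] ^ m)"
          by (simp add: pcompose_power pcompose_pCons c'_def mult.commute flip: smult_power)
        then have "ops.op_T.act ([:- c', 1:] ^ m) (k_var powi k *s v1) = 0"
          by (simp add: act_powi ops.op_T.act_smult v1_0)
        moreover have "z \<in> reps" if "poly ([:- c', 1:] ^ m) z = 0" for z
          using that k by (auto simp: poly_power c'_def)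
        ultimately have "k_var powi k *s v1 \<in> V" unfolding V_def by (auto intro!: exI[of _ "[:- c', 1:] ^ m"])
        then have "inverse (k_var powi k) *s (k_var powi k *s v1) \<in> vec.span V"
          by (intro vec.span_scale vec.span_base)
        then show ?thesis by (simp add: vector_smult_assoc)
      qed
      then show ?thesis unfolding v using 2 vec.span_add by blast
    qed
  qed
  have "vec.span V = UNIV"
    using g span_V unfolding ops.tors_def by (intro vec_span_axis[OF g(1)]) blast
  have V_tors: "ops.tors v" if "v \<in> V" for v using that unfolding V_def ops.tors_def by blast
  have "\<exists>W. finite W \<and> vec.independent W \<and> C.span W = V"
  proof (rule maximal_constant_basis[OF V(1,2) V_tors])
    fix W v c
    assume W: "finite W" "W \<subseteq> V" "vec.independent W" "\<And>w. w \<in> W \<Longrightarrow> \<Phi>1 w \<in> C.span W"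
      and v: "v \<in> V" "\<Phi>1 v - k_const c *s v \<in> C.span W" "v \<in> vec.span W"
    obtain f where f: "v = (\<Sum>w\<in>W. f w *s w)"
      using v(3) unfolding vec.span_finite[OF W(1)] by blast
    have "f w \<in> Lau" if "w \<in> W" for w
      by (rule scal_tors_R) (rule coordinates_tors[OF W(1,3,4) f v(2) that])
    then have "\<forall>w\<in>W. \<exists>m p. k_var ^ m * f w = to_fract p" using Lau_cases by blast
    from bchoice[OF this] obtain m where "\<forall>w\<in>W. \<exists>p. k_var ^ m w * f w = to_fract p" by blast
    from bchoice[OF this] obtain p where p: "\<And>w. w \<in> W \<Longrightarrow> k_var ^ m w * f w = to_fract (p w)" by blast
    \<comment> \<open>A common power of x clears the poles at 0 of all coordinates; the index
      \<open>M\<close> then carries the part \<open>u M\<close> of \<open>v\<close> that is free of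
      x.\<close>
    define M where "M = (\<Sum>w\<in>W. m w)"
    define p' where "p' w = [:0, 1:] ^ (M - m w) * p w" for w
    have p': "k_var ^ M * f w = to_fract (p' w)" if "w \<in> W" for w
    proof -
      have "m w \<le> M" unfolding M_def by (rule member_le_sum) (use that W(1) in auto)
      then have "k_var ^ M * f w = k_var ^ (M - m w) * (k_var ^ m w * f w)"
        by (simp only: mult.assoc[symmetric] power_add[symmetric] le_add_diff_inverse2)
      then show ?thesis unfolding p[OF that] by (simp add: p'_def to_fract_power k_var_def)
    qed
    define N where "N = (\<Sum>w\<in>W. degree (p' w)) + M"
    define u where "u i = (\<Sum>w\<in>W. k_const (coeff (p' w) i) *s w)" for i
    have uW: "u i \<in> C.span W" for i unfolding u_def by (intro C.span_sum C.span_scale C.span_base)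
    then have uV: "u i \<in> V" for i using W(2) V(1) C.span_minimal by blast
    have fw: "f w = (\<Sum>i\<le>N. k_const (coeff (p' w) i) * k_var powi (int i - int M))" if "w \<in> W" for w
    proof -
      have "degree (p' w) \<le> (\<Sum>w\<in>W. degree (p' w))" by (rule member_le_sum) (use that W(1) in auto)
      then have "p' w = (\<Sum>i\<le>N. monom (coeff (p' w) i) i)"
        by (intro poly_as_sum_of_monoms'[symmetric]) (simp add: N_def)
      then have "to_fract (p' w) = (\<Sum>i\<le>N. k_const (coeff (p' w) i) * k_var ^ i)"
        by (metis (no_types, lifting) sum.cong to_fract_sum monom_altdef to_fract_smult to_fract_power k_var_def)
      moreover have "f w = to_fract (p' w) / k_var ^ M" using p'[OF that] by (simp add: field_simps)
      ultimately show ?thesis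
        by (simp add: sum_divide_distrib power_int_diff)
    qed
    have "v = (\<Sum>w\<in>W. \<Sum>i\<le>N. (k_var powi (int i - int M)) *s (k_const (coeff (p' w) i) *s w))"
      unfolding f by (rule sum.cong[OF refl]) (simp add: fw vec.scale_sum_left vector_smult_assoc mult.commute)
    also have "\<dots> = (\<Sum>i\<le>N. (k_var powi (int i - int M)) *s u i)"
      by (subst sum.swap) (simp add: u_def vec.scale_sum_right)
    also have "\<dots> = (k_var powi (int M - int M)) *s u M + (\<Sum>i\<in>{..N} - {M}. (k_var powi (int i - int M)) *s u i)"
      by (rule sum.remove) (auto simp: N_def)
    finally have eq: "v - u M = (\<Sum>i\<in>{..N} - {M}. (k_var powi (int i - int M)) *s u i)" by simp
    \<comment> \<open>The summands with index different from \<open>M\<close> have their eigenvalues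
      outside \<open>reps\<close>, whereas those of \<open>v - u M\<close> lie in
      \<open>reps\<close>; coprime annihilators force \<open>v = u M\<close>.\<close>
    have "\<exists>F. F \<noteq> 0 \<and> (\<forall>z. poly F z = 0 \<longrightarrow> z \<notin> reps) \<and> ops.op_T.act F (\<Sum>i\<in>I. (k_var powi (int i - int M)) *s u i) = 0"
      if "finite I" "M \<notin> I" for I
      using that
    proof (induction I rule: finite_induct)
      case empty
      show ?case using act_0 by (intro exI[of _ 1]) auto
    next
      case (insert i I)
      then obtain F where F: "F \<noteq> 0" "\<forall>z. poly F z = 0 \<longrightarrow> z \<notin> reps"
        "ops.op_T.act F (\<Sum>i\<in>I. (k_var powi (int i - int M)) *s u i) = 0" by auto
      define k where "k = int i - int M"
      have "k \<noteq> 0" using insert by (auto simp: k_def)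
      obtain h where h: "h \<noteq> 0" "\<forall>z. poly h z = 0 \<longrightarrow> z \<in> reps" "ops.op_T.act h (u i) = 0"
        using uV[of i] unfolding V_def by blast
      define h' where "h' = s (inverse (q1 powi k)) h"
      have sh: "pcompose h' [:0, q1 powi k:] = h"
        using s_inv[of "q1 powi k" h] q(1) by (simp add: h'_def s_def)
      have "h' \<noteq> 0" using sh h(1) by auto
      have "ops.op_T.act h' (k_var powi k *s u i) = 0" by (simp add: act_powi sh h(3))
      moreover have "z \<notin> reps" if "poly h' z = 0" for z
      proof
        assume "z \<in> reps"
        have "poly h (inverse (q1 powi k) * z) = 0" using that by (simp add: h'_def s_def poly_pcompose mult.commute)
        then have "z * q1 powi (- k) \<in> reps" using h(2) by (simp add: power_int_minus mult.commute)
        from reps_unique[OF \<open>z \<in> reps\<close> this] show False using \<open>k \<noteq> 0\<close> by simp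
      qed
      moreover have "ops.op_T.act (F * h') (k_var powi k *s u i + (\<Sum>i\<in>I. (k_var powi (int i - int M)) *s u i)) = 0"
      proof -
        have "ops.op_T.act (F * h') (k_var powi k *s u i) = 0"
          using calculation(1) act_0 by (simp only: ops.op_T.act_mult)
        moreover have "ops.op_T.act (h' * F) (\<Sum>i\<in>I. (k_var powi (int i - int M)) *s u i) = 0"
          using F(3) act_0 by (simp only: ops.op_T.act_mult)
        ultimately show ?thesis by (simp add: ops.op_T.act_add_right mult.commute)
      qed
      ultimately show ?case using F \<open>h' \<noteq> 0\<close> insert.hyps
        by (intro exI[of _ "F * h'"]) (auto simp: k_def)
    qed
    from this[of "{..N} - {M}"] obtain F where F: "F \<noteq> 0" "\<forall>z. poly F z = 0 \<longrightarrow> z \<notin> reps"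
      "ops.op_T.act F (v - u M) = 0" unfolding eq by auto
    have "v - u M \<in> V" using v(1) uV V(1) by (rule C.subspace_diff[rotated])
    then obtain h where h: "h \<noteq> 0" "\<forall>z. poly h z = 0 \<longrightarrow> z \<in> reps" "ops.op_T.act h (v - u M) = 0"
      unfolding V_def by blast
    have "cop F h" by (rule cop_no_common_root) (use F h in auto)
    then obtain a b where "a * F + b * h = 1" unfolding cop_def by blast
    then have "v - u M = ops.op_T.act (a * F + b * h) (v - u M)" by simp
    also have "\<dots> = 0" unfolding ops.op_T.act_add_left ops.op_T.act_mult F(3) h(3) act_0 by simp
    finally show "v \<in> C.span W" using uW[of M] by simp
  qed
  then obtain W where W: "finite W" "vec.independent W" "C.span W = V" by blast
  have "V \<subseteq> vec.span W"
  proof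
    fix v assume "v \<in> V"
    then have "v \<in> C.span W" using W by simp
    then show "v \<in> vec.span W"
      by (induction rule: C.span_induct_alt) (auto simp: vec.span_zero vec.span_base intro!: vec.span_add vec.span_scale)
  qed
  then have "vec.span W = UNIV"
    using \<open>vec.span V = UNIV\<close> by (metis vec.span_minimal vec.subspace_span top.extremum_uniqueI)
  show ?thesis
  proof (rule constant_form[OF W(1,2) \<open>vec.span W = UNIV\<close>])
    fix w assume "w \<in> W"
    then have "w \<in> V" using W(3) C.span_base by blast
    then show "\<Phi>1 w \<in> C.span W" "\<Phi>2 w \<in> C.span W" unfolding W(3) using V by blast+
  qed
qed

section \<open>Mahler substitutions\<close>

text \<open>\<open>sub s f\<close> is \<open>f(x\<^sup>s)\<close> for \<open>s > 0\<close>; no such homomorphism exists for \<open>s = 0\<close>.\<close>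
definition sub :: "nat \<Rightarrow> 'c::field ratfun \<Rightarrow> 'c ratfun"
  where "sub s = (SOME \<sigma>. C_alg_hom k_const k_const \<sigma> \<and> \<sigma> k_var = k_var ^ s)"

abbreviation pvar :: "nat \<Rightarrow> 'c::field poly"
  where "pvar s \<equiv> monom 1 s"

lemma sub_spec:
  assumes "s > 0"
  shows "C_alg_hom k_const k_const (sub s :: 'c::field ratfun \<Rightarrow> _)" and "sub s k_var = (k_var :: 'c ratfun) ^ s"
proof -
  have "degree (pvar s :: 'c poly) > 0" using assms by (simp add: degree_monom_eq)
  from k_endo_exists[OF this] obtain \<sigma> :: "'c ratfun \<Rightarrow> 'c ratfun"
    where "C_alg_hom k_const k_const \<sigma>" "\<sigma> k_var = to_fract (pvar s)" by blast
  then have "C_alg_hom k_const k_const \<sigma> \<and> \<sigma> k_var = k_var ^ s"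
    by (simp add: monom_altdef to_fract_power k_var_def)
  from someI[of "\<lambda>\<sigma>. C_alg_hom k_const k_const \<sigma> \<and> \<sigma> k_var = k_var ^ s", OF this]
  show "C_alg_hom k_const k_const (sub s :: 'c ratfun \<Rightarrow> _)" "sub s k_var = (k_var :: 'c ratfun) ^ s"
    unfolding sub_def by blast+
qed

lemma sub_hom: "s > 0 \<Longrightarrow> field_hom (sub s)"
  using sub_spec(1) by (auto simp: C_alg_hom_def)

lemma sub_const [simp]: "s > 0 \<Longrightarrow> sub s (k_const c) = k_const c"
  using sub_spec(1) by (auto simp: C_alg_hom_def)

lemma sub_unique:
  assumes "s > 0" "C_alg_hom k_const k_const \<sigma>" "\<sigma> k_var = k_var ^ s"
  shows "\<sigma> = sub s"
  by (rule C_alg_hom_k_unique[OF assms(2) sub_spec(1)[OF assms(1)]]) (simp only: assms(3) sub_spec(2)[OF assms(1)])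

lemma sub_to_fract:
  assumes "s > 0" shows "sub s (to_fract p) = to_fract (pcompose p (pvar s))"
proof -
  have "sub s k_var = to_fract (pvar s)"
    using sub_spec(2)[OF assms] by (simp add: monom_altdef to_fract_power k_var_def)
  then show ?thesis
    unfolding C_alg_hom_k_eval[OF sub_spec(1)[OF assms]] by (metis poly_map_k_const)
qed

lemma sub_sub:
  assumes "s > 0" "t > 0" shows "sub s (sub t f) = sub (s * t) f"
proof -
  have "sub s (sub t k_var) = (k_var :: 'a ratfun) ^ (s * t)"
    unfolding sub_spec(2)[OF assms(2)] field_hom_simps(8)[OF sub_hom[OF assms(1)]] sub_spec(2)[OF assms(1)]
    by (simp add: power_mult)
  then have "sub s \<circ> sub t = (sub (s * t) :: 'a ratfun \<Rightarrow> _)"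
    using assms by (intro sub_unique C_alg_hom_comp[OF sub_spec(1) sub_spec(1)]) simp_all
  then show ?thesis by (metis comp_apply)
qed

lemma sub_1 [simp]: "sub 1 f = f" "sub (Suc 0) f = f"
proof -
  have "(\<lambda>f. f) = sub 1" by (rule sub_unique) (auto simp: C_alg_hom_def field_hom_def)
  then show "sub 1 f = f" "sub (Suc 0) f = f" by (metis One_nat_def)+
qed

lemma sub_iter: "s > 0 \<Longrightarrow> (sub s ^^ l) f = sub (s ^ l) f"
  by (induction l) (simp_all add: sub_sub)

lemma sub_eq_0_iff: "s > 0 \<Longrightarrow> sub s f = 0 \<longleftrightarrow> f = 0"
  by (rule field_hom_eq_0_iff[OF sub_hom])

lemma order_0_pvar_comp:
  assumes "s > 0" "p \<noteq> 0"
  shows "order 0 (pcompose p (pvar s :: 'c::field poly)) = s * order 0 p"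
proof -
  obtain r where r: "p = [:- 0, 1:] ^ order 0 p * r" "\<not> [:- 0, 1:] dvd r"
    using order_decomp[OF assms(2)] by blast
  then have "r \<noteq> 0" "poly r 0 \<noteq> 0" by (auto simp: poly_eq_0_iff_dvd)
  define t where "t = pcompose r (pvar s)"
  have "poly t 0 \<noteq> 0" using \<open>poly r 0 \<noteq> 0\<close> assms by (simp add: t_def poly_pcompose poly_monom zero_power)
  then have "t \<noteq> 0" by auto
  have "pcompose p (pvar s) = [:- 0, 1:] ^ (s * order 0 p) * t"
    by (subst (1) r(1))
      (simp add: pcompose_mult pcompose_power pcompose_pCons t_def monom_altdef flip: power_mult)
  then have "order 0 (pcompose p (pvar s)) = order 0 ([:- 0, 1::'c:] ^ (s * order 0 p)) + order 0 t"
    using \<open>t \<noteq> 0\<close> by (simp add: order_mult)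
  also have "order 0 t = 0" using \<open>poly t 0 \<noteq> 0\<close> by (rule order_0I)
  finally show ?thesis using order_power_n_n[of "0 :: 'c" "s * order 0 p"] by simp
qed

lemma val_sub:
  assumes "s > 0" "f \<noteq> 0"
  shows "val0.val (sub s f) = int s * val0.val f" "vali.val (sub s f) = int s * vali.val f"
proof -
  obtain a b where ab: "a \<noteq> 0" "b \<noteq> 0" "f = to_fract a / to_fract b" using assms vali.nz_cases by metis
  have nz: "pcompose p (pvar s) \<noteq> 0" if "p \<noteq> 0" for p :: "'a poly"
    using that sub_eq_0_iff[OF assms(1), of "to_fract p"] by (simp add: sub_to_fract assms(1))
  then have "sub s f = to_fract (pcompose a (pvar s)) / to_fract (pcompose b (pvar s))"
    using ab assms(1) by (simp add: field_hom_simps sub_hom sub_to_fract)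
  then show "val0.val (sub s f) = int s * val0.val f" "vali.val (sub s f) = int s * vali.val f"
    using ab nz assms(1)
    by (simp_all add: val0.val_quot vali.val_quot order_0_pvar_comp degree_pcompose degree_monom_eq algebra_simps)
qed

text \<open>Covers the valuations at 0 and at infinity, where x -> x^s is totally ramified;
  \<open>sg\<close> is the valuation of x there.\<close>

locale mahler_valuation = poly_valuation w
  for w :: "'c::{alg_closed_field,field_char_0} poly \<Rightarrow> int" +
  fixes sg :: int
  assumes sg: "sg = 1 \<or> sg = - 1" and val_k_var: "val k_var = sg"
    and val_sub': "s > 0 \<Longrightarrow> f \<noteq> 0 \<Longrightarrow> val (sub s f) = int s * val f"
begin

lemma vge_sub: "s > 0 \<Longrightarrow> vge (real s * t) (sub s f) \<longleftrightarrow> vge t f"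
  by (cases "f = 0") (auto simp: vge_def val_sub' sub_eq_0_iff)

lemma val_add_eq:
  assumes "f \<noteq> 0" "vge (of_int (val f) + 1) g"
  shows "f + g \<noteq> 0" "val (f + g) = val f"
proof -
  have "f + g \<noteq> 0 \<and> val (f + g) = val f"
  proof (cases "g = 0")
    case False
    then have lt: "val f < val g" using assms(2) by (auto simp: vge_def)
    have "f + g \<noteq> 0"
    proof
      assume "f + g = 0"
      then have "g = - f" by (simp add: add_eq_0_iff)
      then show False using lt by simp
    qed
    moreover have "val f \<le> val (f + g)" using val_add[OF assms(1) False \<open>f + g \<noteq> 0\<close>] lt by linarith
    moreover have "min (val (f + g)) (val (- g)) \<le> val f"
      using val_add[of "f + g" "- g"] \<open>f + g \<noteq> 0\<close> False assms(1) by simp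
    ultimately show ?thesis using lt by (auto simp: min_def split: if_splits)
  qed (use assms in simp)
  then show "f + g \<noteq> 0" "val (f + g) = val f" by auto
qed

text \<open>Distinct valuations exclude cancellation, so the valuation of the sum is the minimum
  over the nonzero summands.\<close>

lemma vge_sum_distinct:
  assumes "finite A" and inj: "\<And>i j. i \<in> A \<Longrightarrow> j \<in> A \<Longrightarrow> f i \<noteq> 0 \<Longrightarrow> f j \<noteq> 0 \<Longrightarrow> val (f i) = val (f j) \<Longrightarrow> i = j"
    and "vge t (sum f A)" "i \<in> A"
  shows "vge t (f i)"
proof (cases "f i = 0")
  case False
  define A' where "A' = {j\<in>A. f j \<noteq> 0}"
  have "finite A'" "A' \<noteq> {}" using assms False by (auto simp: A'_def)
  then obtain m where m: "m \<in> A'" "\<And>j. j \<in> A' \<Longrightarrow> val (f m) \<le> val (f j)"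
    using ex_min_if_finite[of "(\<lambda>j. val (f j)) ` A'"] by (auto simp: not_less)
  have "vge (of_int (val (f m)) + 1) (f j)" if "j \<in> A - {m}" for j
  proof (cases "f j = 0")
    case False
    then have "val (f m) \<noteq> val (f j)" "val (f m) \<le> val (f j)"
      using that m inj[of m j] by (auto simp: A'_def)
    then show ?thesis by (auto simp: vge_def)
  qed simp
  then have "vge (of_int (val (f m)) + 1) (\<Sum>j\<in>A - {m}. f j)" by (rule vge_sum)
  moreover have "sum f A = f m + (\<Sum>j\<in>A - {m}. f j)"
    using m(1) assms(1) by (intro sum.remove) (auto simp: A'_def)
  ultimately have "sum f A \<noteq> 0" "val (sum f A) = val (f m)"
    using val_add_eq[of "f m"] m(1) by (auto simp: A'_def)
  then have "t \<le> of_int (val (f m))" using assms(3) by (auto simp: vge_def)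
  also have "val (f m) \<le> val (f i)" using m(2)[of i] False assms(4) by (auto simp: A'_def)
  finally show ?thesis by (simp add: vge_def)
qed simp

text \<open>Modulo \<open>r\<close> the summand with index \<open>a\<close> has valuation a u up to
  a common sign, and these residues are distinct because \<open>u\<close> is prime to
  \<open>r\<close>.\<close>

lemma vge_section:
  assumes "r > 0" "coprime u r" "vge t (\<Sum>a<r. k_var ^ (a * u) * sub r (g a))" "a < r"
  shows "vge t (k_var ^ (a * u) * sub r (g a))"
proof (rule vge_sum_distinct[OF _ _ assms(3)])
  fix i j assume ij: "i \<in> {..<r}" "j \<in> {..<r}" "k_var ^ (i * u) * sub r (g i) \<noteq> 0"
    "k_var ^ (j * u) * sub r (g j) \<noteq> 0"
    and eq: "val (k_var ^ (i * u) * sub r (g i)) = val (k_var ^ (j * u) * sub r (g j))"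
  then have "g i \<noteq> 0" "g j \<noteq> 0" using assms(1) by (auto simp: sub_eq_0_iff)
  then have "int (i * u) * sg + int r * val (g i) = int (j * u) * sg + int r * val (g j)"
    using eq ij assms(1) by (simp add: val_mult val_power val_k_var val_sub')
  then have "(int i * int u - int j * int u) * sg = int r * (val (g j) - val (g i))"
    by (simp add: algebra_simps)
  then have "int r dvd (int i * int u - int j * int u) * sg" by simp
  then have "int r dvd int i * int u - int j * int u"
    using sg by (metis dvd_minus_iff mult.right_neutral mult_minus_right)
  then have "[i * u = j * u] (mod r)" by (simp add: cong_int_iff[symmetric] cong_iff_dvd_diff)
  then have "[i = j] (mod r)" using assms(2) by (simp add: cong_mult_rcancel_nat coprime_commute)
  then show "i = j" using ij by (simp add: cong_less_modulus_unique_nat)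
qed (use assms in auto)

end

interpretation mval0: mahler_valuation "\<lambda>p :: 'c::{alg_closed_field,field_char_0} poly. int (order 0 p)" 1
  by standard (simp_all add: val_sub)

interpretation mvali: mahler_valuation "\<lambda>p :: 'c::{alg_closed_field,field_char_0} poly. - int (degree p)" "-1"
  by standard (simp_all add: val_sub)

text \<open>By \<open>vge_section\<close> the sections of 0 satisfy every valuation bound, hence
  vanish.\<close>

lemma section_unique:
  fixes g :: "nat \<Rightarrow> 'c::{alg_closed_field,field_char_0} ratfun"
  assumes "r > 0" "(\<Sum>a<r. k_var ^ a * sub r (g a)) = (\<Sum>a<r. k_var ^ a * sub r (h a))" "a < r"
  shows "g a = h a"
proof (rule ccontr)
  assume "g a \<noteq> h a"
  define d where "d a = g a - h a" for a
  have 0: "(\<Sum>a<r. k_var ^ (a * 1) * sub r (d a)) = 0"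
    using assms(1,2) by (simp add: d_def field_hom_simps sub_hom algebra_simps sum_subtractf)
  have "val0.vge t (k_var ^ (a * 1) * sub r (d a))" for t
    by (rule mval0.vge_section[OF assms(1) _ _ assms(3)]) (use 0 in auto)
  moreover have "k_var ^ (a * 1) * sub r (d a) \<noteq> 0"
    using \<open>g a \<noteq> h a\<close> assms(1) by (simp add: d_def sub_eq_0_iff)
  ultimately have "t \<le> real_of_int (val0.val (k_var ^ (a * 1) * sub r (d a)))" for t
    unfolding val0.vge_def by blast
  from this[of "real_of_int (val0.val (k_var ^ (a * 1) * sub r (d a))) + 1"] show False by simp
qed

text \<open>The coefficients of \<open>p\<close> are sorted by the residue of their index modulo
  \<open>r\<close>.\<close>

lemma poly_section:
  fixes p :: "'c::field poly"
  assumes "r > 0"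
  shows "\<exists>g. to_fract p = (\<Sum>a<r. k_var ^ a * sub r (to_fract (g a))) \<and> (\<forall>a<r. r * degree (g a) \<le> degree p) \<and>
    (p \<noteq> 0 \<longrightarrow> (\<exists>a<r. g a \<noteq> 0))"
proof -
  define N where "N = degree p"
  define g where "g a = (\<Sum>i\<le>N. monom (coeff p (a + r * i)) i)" for a
  have gc: "coeff (g a) i = coeff p (a + r * i)" for a i
  proof (cases "i \<le> N")
    case False
    then have "N < a + r * i" using assms by (metis add_lessD1 mult.commute mult_le_mono2 not_le order_less_le_trans Suc_leI nat_mult_1_right add.commute trans_less_add2 One_nat_def)
    then show ?thesis using False by (simp add: g_def coeff_sum coeff_eq_0 N_def)
  qed (simp add: g_def coeff_sum)
  have "r * degree (g a) \<le> degree p" for a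
  proof (cases "g a = 0")
    case False
    then have "coeff (g a) (degree (g a)) \<noteq> 0" by simp
    then have "coeff p (a + r * degree (g a)) \<noteq> 0" unfolding gc .
    then show ?thesis using le_degree by fastforce
  qed simp
  moreover have "to_fract p = (\<Sum>a<r. k_var ^ a * sub r (to_fract (g a)))"
  proof -
    have "p = (\<Sum>a<r. pvar a * pcompose (g a) (pvar r))"
    proof (rule poly_eqI)
      fix n
      have c: "coeff (pcompose q (pvar r)) m = (if r dvd m then coeff q (m div r) else 0)" for q :: "'c poly" and m
      proof (induction q arbitrary: m)
        case (pCons a q)
        show ?case
        proof (cases "m < r")
          case True
          then show ?thesis using assms
            by (cases "m = 0") (auto simp: pcompose_pCons coeff_monom_mult coeff_pCons split: nat.splits)
        next
          case False
          then obtain m' where m': "m = r + m'" by (metis le_add_diff_inverse not_le)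
          have "coeff [:a:] m = 0" using False assms by (simp add: coeff_pCons split: nat.splits)
          then show ?thesis using assms pCons by (simp add: pcompose_pCons coeff_monom_mult m' coeff_pCons)
        qed
      qed simp
      have "coeff (\<Sum>a<r. pvar a * pcompose (g a) (pvar r)) n
          = (\<Sum>a<r. if a = n mod r then coeff p n else 0)"
        unfolding coeff_sum
      proof (rule sum.cong[OF refl])
        fix a assume "a \<in> {..<r}"
        then have a: "a < r" by simp
        show "coeff (pvar a * pcompose (g a) (pvar r)) n = (if a = n mod r then coeff p n else 0)"
        proof (cases "a \<le> n \<and> r dvd n - a")
          case True
          then obtain i where i: "n = a + r * i" by (metis dvdE le_add_diff_inverse)
          then have "n mod r = a" using a by simp
          moreover have "coeff (pvar a * pcompose (g a) (pvar r)) n = coeff p n"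
            using a assms by (simp add: i coeff_monom_mult c gc)
          ultimately show ?thesis by simp
        next
          case False
          have "a \<noteq> n mod r"
          proof
            assume "a = n mod r"
            then show False using False by (metis dvd_minus_mod mod_less_eq_dividend)
          qed
          then show ?thesis using False by (auto simp: coeff_monom_mult c not_le)
        qed
      qed
      also have "\<dots> = coeff p n" using assms by simp
      finally show "coeff p n = coeff (\<Sum>a<r. pvar a * pcompose (g a) (pvar r)) n" ..
    qed
    then have "to_fract p = to_fract (\<Sum>a<r. pvar a * pcompose (g a) (pvar r))" by simp
    then show ?thesis using assms
      by (simp add: sub_to_fract monom_altdef[of _ 1] to_fract_power k_var_def monom_altdef)
  qed
  moreover have "\<exists>a<r. g a \<noteq> 0" if "p \<noteq> 0"
  proof -
    have "coeff (g (N mod r)) (N div r) = coeff p N" by (simp add: gc)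
    then have "g (N mod r) \<noteq> 0" using that by (auto simp: N_def)
    then show ?thesis using assms mod_less_divisor by blast
  qed
  ultimately show ?thesis by blast
qed

text \<open>\<open>e(x\<^sup>r)\<close> is the norm of \<open>d\<close> along \<open>x \<mapsto> x\<^sup>r\<close>.\<close>
lemma norm_exists:
  fixes d :: "'c::alg_closed_field poly"
  assumes "d \<noteq> 0" "r > 0"
  shows "\<exists>e d'. e \<noteq> 0 \<and> degree e = degree d \<and> d * d' = pcompose e (pvar r)"
  using assms(1)
proof (induction "degree d" arbitrary: d)
  case 0
  then obtain c where "d = [:c:]" "c \<noteq> 0" by (metis degree_eq_zeroE pCons_0_0)
  then show ?case by (intro exI[of _ d] exI[of _ 1]) auto
next
  case (Suc n)
  then obtain c where "poly d c = 0" using alg_closed_imp_poly_has_root[of d] by auto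
  then obtain h where h: "d = [:- c, 1:] * h" by (auto simp: poly_eq_0_iff_dvd)
  then have "h \<noteq> 0" using Suc by auto
  then have "degree d = 1 + degree h" unfolding h by (subst degree_mult_eq) auto
  then obtain e h' where e: "e \<noteq> 0" "degree e = degree h" "h * h' = pcompose e (pvar r)"
    using Suc \<open>h \<noteq> 0\<close> by (metis Suc_inject plus_1_eq_Suc)
  \<comment> \<open>A root c of \<open>d\<close> contributes the factor x - c^r to \<open>e\<close>,
    since x - c divides x^r - c^r.\<close>
  have "poly (pcompose [:- (c ^ r), 1:] (pvar r)) c = 0" by (simp add: poly_pcompose poly_monom)
  then obtain l where l: "pcompose [:- (c ^ r), 1:] (pvar r) = [:- c, 1:] * l" by (auto simp: poly_eq_0_iff_dvd)
  have "d * (l * h') = pcompose ([:- (c ^ r), 1:] * e) (pvar r)"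
    unfolding pcompose_mult l e(3)[symmetric] h by (simp only: ac_simps)
  moreover have "degree ([:- (c ^ r), 1:] * e) = degree d"
    using e \<open>degree d = 1 + degree h\<close> by (subst degree_mult_eq) auto
  moreover have "[:- (c ^ r), 1:] * e \<noteq> 0" using e(1) by (simp only: mult_eq_0_iff) simp
  ultimately show ?case by blast
qed

text \<open>Expanding the fraction by the cofactor of a norm makes the denominator a function of
  x^r, and only a polynomial remains to be split.\<close>

lemma section_exists:
  fixes f :: "'c::{alg_closed_field,field_char_0} ratfun"
  assumes "r > 0"
  shows "\<exists>g. f = (\<Sum>a<r. k_var ^ a * sub r (g a))"
proof -
  obtain a b where ab: "b \<noteq> 0" "f = to_fract a / to_fract b" by (rule ratfun_cases)
  obtain e b' where e: "e \<noteq> 0" "b * b' = pcompose e (pvar r)" using norm_exists[OF ab(1) assms] by blast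
  have "to_fract b * to_fract b' = sub r (to_fract e)" using e(2) by (simp add: sub_to_fract assms flip: to_fract_mult)
  moreover have nz: "sub r (to_fract e) \<noteq> 0" using e(1) assms by (simp add: sub_eq_0_iff)
  ultimately have "to_fract b' \<noteq> 0" by auto
  then have f: "f = to_fract (a * b') / sub r (to_fract e)"
    using ab \<open>to_fract b * to_fract b' = sub r (to_fract e)\<close>[symmetric] by simp
  obtain g where g: "to_fract (a * b') = (\<Sum>a<r. k_var ^ a * sub r (to_fract (g a)))"
    using poly_section[OF assms] by blast
  have "f = (\<Sum>a<r. k_var ^ a * sub r (to_fract (g a) / to_fract e))"
    unfolding f g by (simp add: sum_divide_distrib field_hom_simps sub_hom assms)
  then show ?thesis by (intro exI[of _ "\<lambda>a. to_fract (g a) / to_fract e"])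
qed

lemma Lau_sub:
  assumes "s > 0" "f \<in> Lau" shows "sub s f \<in> Lau"
proof -
  from Lau_cases[OF assms(2)] obtain m p where "k_var ^ m * f = to_fract p" by blast
  then have "sub s (k_var ^ m * f) \<in> Pol" by (simp add: sub_to_fract assms(1) Pol_closed)
  then have "k_var ^ (s * m) * sub s f \<in> Pol"
    by (simp add: field_hom_simps sub_hom assms(1) sub_spec power_mult)
  then show ?thesis by (rule LauI)
qed

text \<open>Since \<open>u\<close> is prime to \<open>r\<close>, the exponents a u run through all
  residues modulo \<open>r\<close>. After reindexing, uniqueness identifies the sections with those
  of a polynomial, up to powers of x.\<close>

lemma Lau_section:
  fixes h :: "nat \<Rightarrow> 'c::{alg_closed_field,field_char_0} ratfun"
  assumes r: "r > 0" "coprime u r" and "(\<Sum>a<r. k_var ^ (a * u) * sub r (h a)) \<in> Lau" and "a < r"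
  shows "h a \<in> Lau"
proof -
  define f where "f = (\<Sum>a<r. k_var ^ (a * u) * sub r (h a))"
  from Lau_cases[OF assms(3)] obtain m p where mp: "k_var ^ m * f = to_fract p" unfolding f_def by blast
  define \<pi> where "\<pi> a = (a * u) mod r" for a
  have "inj_on \<pi> {..<r}"
  proof
    fix i j assume ij: "i \<in> {..<r}" "j \<in> {..<r}" "\<pi> i = \<pi> j"
    then have "[i * u = j * u] (mod r)" by (simp add: \<pi>_def cong_def)
    then have "[i = j] (mod r)" using r(2) by (simp add: cong_mult_rcancel_nat coprime_commute)
    then show "i = j" using ij by (simp add: cong_less_modulus_unique_nat)
  qed
  moreover have "\<pi> ` {..<r} \<subseteq> {..<r}" using r by (auto simp: \<pi>_def)
  ultimately have bij: "bij_betw \<pi> {..<r} {..<r}" by (simp add: bij_betw_def endo_inj_surj)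
  define \<rho> where "\<rho> = the_inv_into {..<r} \<pi>"
  have \<rho>: "\<rho> (\<pi> a) = a" if "a < r" for a
    using \<open>inj_on \<pi> {..<r}\<close> that by (simp add: \<rho>_def the_inv_into_f_f)
  \<comment> \<open>The multiple of \<open>r\<close> contained in a u moves inside
    \<open>sub r\<close>; the factor x^m there becomes x^(r m) outside and clears the pole at
    0.\<close>
  define H where "H b = k_var ^ m * (k_var ^ (\<rho> b * u div r) * h (\<rho> b))" for b
  have "k_var ^ (r * m) * f = (\<Sum>a<r. k_var ^ \<pi> a * sub r (H (\<pi> a)))"
    unfolding f_def sum_distrib_left
  proof (rule sum.cong[OF refl])
    fix a assume "a \<in> {..<r}"
    then have "\<rho> (\<pi> a) = a" by (simp add: \<rho>)
    then have "k_var ^ \<pi> a * sub r (H (\<pi> a)) = k_var ^ (\<pi> a + r * m + r * (a * u div r)) * sub r (h a)"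
      using r(1) by (simp add: H_def field_hom_simps sub_hom sub_spec power_add power_mult)
    also have "\<pi> a + r * m + r * (a * u div r) = r * m + a * u"
      using mult_div_mod_eq[of r "a * u"] by (simp add: \<pi>_def)
    finally show "k_var ^ (r * m) * (k_var ^ (a * u) * sub r (h a)) = k_var ^ \<pi> a * sub r (H (\<pi> a))"
      by (simp add: power_add)
  qed
  also have "\<dots> = (\<Sum>b<r. k_var ^ b * sub r (H b))"
    by (rule sum.reindex_bij_betw[OF bij, of "\<lambda>b. k_var ^ b * sub r (H b)"])
  finally have "(\<Sum>b<r. k_var ^ b * sub r (H b)) = k_var ^ (r * m - m) * (k_var ^ m * f)"
    using r(1) by (simp add: mult.assoc[symmetric] flip: power_add)
  also have "\<dots> = to_fract ([:0, 1:] ^ (r * m - m) * p)" unfolding mp by (simp add: k_var_def to_fract_power)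
  finally have eq: "(\<Sum>b<r. k_var ^ b * sub r (H b)) = to_fract ([:0, 1:] ^ (r * m - m) * p)" .
  obtain g where "to_fract ([:0, 1:] ^ (r * m - m) * p) = (\<Sum>a<r. k_var ^ a * sub r (to_fract (g a)))"
    using poly_section[OF r(1)] by blast
  then have "H b = to_fract (g b)" if "b < r" for b
    using section_unique[OF r(1) _ that, of H "\<lambda>b. to_fract (g b)"] eq by simp
  then have "H (\<pi> a) \<in> Pol" using \<open>a < r\<close> r(1) by (simp add: \<pi>_def Pol_closed)
  then have "k_var ^ (m + a * u div r) * h a \<in> Pol" using \<rho>[OF \<open>a < r\<close>] by (simp add: H_def power_add mult.assoc)
  then show ?thesis by (rule LauI)
qed

section \<open>Asymptotic heights\<close>

abbreviation lv :: "nat \<Rightarrow> 'c::field ratfun ^ 'n ^ 'm \<Rightarrow> 'c ratfun ^ 'n ^ 'm"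
  where "lv s \<equiv> map_matrix (sub s)"

lemma lv_simps:
  "s > 0 \<Longrightarrow> lv s (A ** B) = lv s A ** lv s B"
  "s > 0 \<Longrightarrow> t > 0 \<Longrightarrow> lv s (lv t A) = lv (s * t) A"
  "s > 0 \<Longrightarrow> invertible D \<Longrightarrow> invertible (lv s D)"
  "s > 0 \<Longrightarrow> vmap (sub s) (A *v z) = lv s A *v vmap (sub s) z"
  "s > 0 \<Longrightarrow> t > 0 \<Longrightarrow> vmap (sub s) (vmap (sub t) z) = vmap (sub (s * t)) z"
  by (simp_all add: map_matrix_mult sub_hom map_matrix_comp sub_sub invertible_map_matrix vmap_mult vmap_comp)

lemma lv_1 [simp]: "lv (Suc 0) A = A" "vmap (sub (Suc 0)) z = z"
  "map_matrix (\<lambda>f. f) A = A" "vmap (\<lambda>f. f) z = z"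
  by (simp_all add: vec_eq_iff)

lemma sub_k_var_power: "s > 0 \<Longrightarrow> sub s (k_var ^ a) = k_var ^ (a * s)"
  by (simp add: field_hom_simps(8)[OF sub_hom] sub_spec(2) mult.commute flip: power_mult)

lemma vmap_sub_k_var_power:
  "s > 0 \<Longrightarrow> vmap (sub s) (k_var ^ a *s z) = k_var ^ (a * s) *s vmap (sub s) z"
  by (simp add: vmap_scale sub_hom sub_k_var_power)

text \<open>The direction matters: z -> M z carries orbits for \<open>D'\<close> to orbits for
  \<open>D\<close>, as in \<open>gauge_semilin\<close>.\<close>

definition gauge :: "nat \<Rightarrow> 'c::field ratfun ^ 'n ^ 'n \<Rightarrow> 'c ratfun ^ 'n ^ 'n \<Rightarrow> 'c ratfun ^ 'n ^ 'n \<Rightarrow> bool"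
  where "gauge q M D D' \<longleftrightarrow> invertible M \<and> D ** lv q M = M ** D'"

lemma gauge_semilin:
  assumes "gauge q M D D'" "q > 0"
  shows "(semilin D (sub q) ^^ l) (M *v z) = M *v (semilin D' (sub q) ^^ l) z"
proof (induction l)
  case (Suc l)
  then show ?case using assms
    by (simp add: semilin_def lv_simps matrix_vector_mul_assoc gauge_def)
qed simp

lemma gauge_inv:
  assumes "gauge q M D D'" "q > 0"
  shows "gauge q (matrix_inv M) D' D"
proof -
  have M: "invertible M" "D ** lv q M = M ** D'" using assms(1) by (auto simp: gauge_def)
  have 1: "lv q M ** lv q (matrix_inv M) = mat 1"
    unfolding lv_simps(1)[OF assms(2), symmetric] using M(1) assms(2)
    by (simp add: matrix_inv_right map_matrix_mat_1 sub_hom)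
  have "D' ** lv q (matrix_inv M) = matrix_inv M ** (M ** D') ** lv q (matrix_inv M)"
    using M(1) by (simp add: matrix_mul_assoc matrix_inv_left)
  also have "\<dots> = matrix_inv M ** D ** (lv q M ** lv q (matrix_inv M))"
    unfolding M(2)[symmetric] by (simp add: matrix_mul_assoc)
  finally show ?thesis using M(1) by (simp add: gauge_def 1 invertible_matrix_inv)
qed

lemma gauge_trans: "gauge q M D D' \<Longrightarrow> gauge q M' D' D'' \<Longrightarrow> q > 0 \<Longrightarrow> gauge q (M ** M') D D''"
  by (auto simp: gauge_def lv_simps invertible_mult matrix_mul_assoc) (metis matrix_mul_assoc)

lemma gauge_lv:
  assumes "gauge q M D D'" "q > 0" "s > 0" shows "gauge q (lv s M) (lv s D) (lv s D')"
proof -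
  have "lv s (D ** lv q M) = lv s (M ** D')" using assms(1) by (simp add: gauge_def)
  then show ?thesis using assms by (simp add: gauge_def lv_simps mult.commute)
qed

lemma semilin_lv:
  assumes "q > 0" "s > 0"
  shows "(semilin (lv s D) (sub q) ^^ l) (vmap (sub s) z) = vmap (sub s) ((semilin D (sub q) ^^ l) z)"
  by (induction l) (use assms in \<open>simp_all add: semilin_def lv_simps mult.commute\<close>)

lemma semilin_k_var_power:
  assumes "q > 0"
  shows "(semilin D (sub q) ^^ l) (k_var ^ a *s z) = k_var ^ (a * q ^ l) *s (semilin D (sub q) ^^ l) z"
  by (induction l)
    (use assms in \<open>simp_all add: semilin_scale sub_hom sub_k_var_power mult.assoc mult.commute[of q]\<close>)

text \<open>\<open>B t Z\<close> stands for an upper bound \<open>t\<close> of a height of the set \<open>Z\<close> of vectors: minus a valuation,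
  or the degree of a common denominator. Passing to the sections modulo \<open>r\<close> costs a factor \<open>kap r\<close>,
  and \<open>sg\<close> is the amount by which multiplication by \<open>x\<close> lowers the height.\<close>
locale mahler_height =
  fixes B :: "real \<Rightarrow> ('c::{alg_closed_field,field_char_0} ratfun ^ 'n) set \<Rightarrow> bool"
    and kap :: "nat \<Rightarrow> real" and sg :: real
  assumes B_mono: "B t Z \<Longrightarrow> t \<le> t' \<Longrightarrow> B t' Z"
    and B_sub: "s > 0 \<Longrightarrow> B (real s * t) (vmap (sub s) ` Z) \<longleftrightarrow> B t Z"
    and B_mult: "\<exists>c\<ge>0. \<forall>s>0. \<forall>t Z. B t Z \<longrightarrow> B (t + real s * c) ((*v) (lv s G) ` Z)"
    and B_sec: "r > 0 \<Longrightarrow> coprime u r \<Longrightarrow> a < r \<Longrightarrow>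
      B t {\<Sum>a<r. k_var ^ (a * u) *s vmap (sub r) (g a)} \<Longrightarrow>
      B (kap r * t) {k_var ^ (a * u) *s vmap (sub r) (g a)}"
    and B_shift: "B t {k_var ^ a *s z} \<longleftrightarrow> B (t + sg * real a) {z}"
    and kap_pos: "r > 0 \<Longrightarrow> kap r > 0" and kap_1: "kap 1 = 1"
    and kap_mult: "kap (r * s) = kap r * kap s" and kap_sg: "kap r * sg = sg"
begin

text \<open>An upper bound \<open>t\<close> of the canonical height, the growth rate of the height along the orbit.\<close>
definition hh :: "nat \<Rightarrow> 'c ratfun ^ 'n ^ 'n \<Rightarrow> real \<Rightarrow> ('c ratfun ^ 'n) set \<Rightarrow> bool"
  where "hh q D t Z \<longleftrightarrow> (\<exists>c. \<forall>l. B (real q ^ l * t + c) ((semilin D (sub q) ^^ l) ` Z))"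

text \<open>One step costs at most s c beyond the factor q, and the losses sum geometrically.
  \<open>hh_prime_section\<close> relies on the error being linear in the level s, with c
  independent of s.\<close>

lemma hhI:
  assumes "q \<ge> 2"
  shows "\<exists>c\<ge>0. \<forall>s>0. \<forall>t Z. B t Z \<longrightarrow> hh q (lv s D) (t + real s * c) Z"
proof -
  obtain c where c: "c \<ge> 0" "\<And>s t Z. s > 0 \<Longrightarrow> B t Z \<Longrightarrow> B (t + real s * c) ((*v) (lv s D) ` Z)"
    using B_mult[of D] by blast
  have "hh q (lv s D) (t + real s * c) Z" if s: "s > 0" and B: "B t Z" for s t Z
  proof -
    \<comment> \<open>The factor q^l - 1 instead of q^l makes the induction close, as q (q^l - 1) +
      1 \<le> q^(l + 1) - 1 for \<open>q \<ge> 2\<close>.\<close>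
    have "B (real q ^ l * t + (real q ^ l - 1) * (real s * c)) ((semilin (lv s D) (sub q) ^^ l) ` Z)" for l
    proof (induction l)
      case (Suc l)
      have B': "B (real q * (real q ^ l * t + (real q ^ l - 1) * (real s * c)) + real s * c)
         ((*v) (lv s D) ` vmap (sub q) ` (semilin (lv s D) (sub q) ^^ l) ` Z)"
        by (rule c(2)[OF s]) (use Suc assms B_sub in auto)
      have im: "(*v) (lv s D) ` vmap (sub q) ` (semilin (lv s D) (sub q) ^^ l) ` Z
          = (semilin (lv s D) (sub q) ^^ Suc l) ` Z"
        by (simp add: image_image semilin_def)
      have "real q * (real q ^ l * t + (real q ^ l - 1) * (real s * c)) + real s * c
          \<le> real q ^ Suc l * t + (real q ^ Suc l - 1) * (real s * c)"
      proof -
        have "0 \<le> (real q - 2) * (real s * c)" using assms c(1) by simp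
        then show ?thesis by (simp add: algebra_simps)
      qed
      then show ?case using B_mono[OF B'] unfolding im by blast
    qed (simp add: B)
    then have "B (real q ^ l * (t + real s * c) + 0) ((semilin (lv s D) (sub q) ^^ l) ` Z)" for l
      by (rule B_mono) (use c(1) in \<open>simp add: algebra_simps\<close>)
    then show ?thesis unfolding hh_def by blast
  qed
  then show ?thesis using c(1) by blast
qed

text \<open>The inverse of \<open>D\<close> turns a bound for the image of z into a bound for z
  divided by q, and the errors again sum geometrically.\<close>

lemma hhD:
  assumes "q \<ge> 2" "invertible D"
  shows "\<exists>c\<ge>0. \<forall>s>0. \<forall>t Z. hh q (lv s D) t Z \<longrightarrow> B (t + real s * c) Z"
proof -
  obtain c where c: "c \<ge> 0"
    "\<And>s t Z. s > 0 \<Longrightarrow> B t Z \<Longrightarrow> B (t + real s * c) ((*v) (lv s (matrix_inv D)) ` Z)"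
    using B_mult[of "matrix_inv D"] by blast
  \<comment> \<open>The extra 1 pays for the additive constant in the canonical height, which is at
    most 1 \<le> s after division by a large q^l.\<close>
  have "B (t + real s * (c + 1)) Z" if s: "s > 0" and h: "hh q (lv s D) t Z" for s t Z
  proof -
    have q: "q > 0" using assms by simp
    have inv: "lv s (matrix_inv D) *v (lv s D *v z) = z" for z
      using assms(2) s
      by (simp add: matrix_vector_mul_assoc matrix_inv_left map_matrix_mat_1 sub_hom flip: lv_simps(1))
    have step: "B ((t' + real s * c) / real q) Z'" if "B t' (semilin (lv s D) (sub q) ` Z')" for t' Z'
    proof -
      have "B (t' + real s * c) ((*v) (lv s (matrix_inv D)) ` semilin (lv s D) (sub q) ` Z')"
        by (rule c(2)[OF s that])
      then have "B (real q * ((t' + real s * c) / real q)) (vmap (sub q) ` Z')"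
        using q by (simp add: image_image semilin_def inv)
      then show ?thesis using B_sub[OF q] by blast
    qed
    have iter: "B t' ((semilin (lv s D) (sub q) ^^ l) ` Z') \<Longrightarrow> B (t' / real q ^ l + real s * c) Z'" for l t' Z'
    proof (induction l arbitrary: Z')
      case 0
      then show ?case using B_mono[of t' Z'] c(1) by simp
    next
      case (Suc l)
      have "(semilin (lv s D) (sub q) ^^ Suc l) ` Z' = (semilin (lv s D) (sub q) ^^ l) ` semilin (lv s D) (sub q) ` Z'"
        by (simp only: funpow_Suc_right image_comp)
      with Suc have "B (t' / real q ^ l + real s * c) (semilin (lv s D) (sub q) ` Z')" by simp
      from step[OF this] have B: "B ((t' / real q ^ l + real s * c + real s * c) / real q) Z'" .
      have "(real s * c + real s * c) / real q \<le> real s * c"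
      proof -
        have "2 * (real s * c) \<le> real q * (real s * c)" using assms(1) c(1) by (intro mult_right_mono) auto
        then show ?thesis using q by (simp add: field_simps)
      qed
      moreover have "(t' / real q ^ l + real s * c + real s * c) / real q
          = t' / real q ^ Suc l + (real s * c + real s * c) / real q"
        by (simp add: add_divide_distrib mult.commute)
      ultimately have "(t' / real q ^ l + real s * c + real s * c) / real q \<le> t' / real q ^ Suc l + real s * c"
        by linarith
      with B show ?case using B_mono by blast
    qed
    obtain c' where c': "\<And>l. B (real q ^ l * t + c') ((semilin (lv s D) (sub q) ^^ l) ` Z)"
      using h unfolding hh_def by blast
    obtain l where l: "c' < real q ^ l" using real_arch_pow[of "real q" c'] assms(1) by auto
    have "B ((real q ^ l * t + c') / real q ^ l + real s * c) Z" by (rule iter[OF c'])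
    moreover have "(real q ^ l * t + c') / real q ^ l + real s * c \<le> t + real s * (c + 1)"
    proof -
      have "c' / real q ^ l \<le> 1" using l q by simp
      then have "c' / real q ^ l \<le> real s" using s by linarith
      then show ?thesis using q by (simp add: add_divide_distrib algebra_simps)
    qed
    ultimately show ?thesis using B_mono by blast
  qed
  then show ?thesis using c(1) by (intro exI[of _ "c + 1"]) auto
qed

lemma hh_mono: "hh q D t Z \<Longrightarrow> t \<le> t' \<Longrightarrow> hh q D t' Z"
  unfolding hh_def by (meson B_mono add_right_mono mult_left_mono of_nat_0_le_iff zero_le_power)

lemma hh_sub:
  assumes "q > 0" "s > 0"
  shows "hh q (lv s D) (real s * t) (vmap (sub s) ` Z) \<longleftrightarrow> hh q D t Z"
proof -
  have im: "(semilin (lv s D) (sub q) ^^ l) ` vmap (sub s) ` Z = vmap (sub s) ` (semilin D (sub q) ^^ l) ` Z" for l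
    by (simp add: image_image semilin_lv assms)
  have Bs: "B (real s * t' + real s * c) (vmap (sub s) ` Z') \<longleftrightarrow> B (t' + c) Z'" for t' c Z'
    using B_sub[OF assms(2), of "t' + c" Z'] by (simp add: distrib_left)
  show ?thesis
  proof
    assume "hh q D t Z"
    then obtain c where "\<And>l. B (real q ^ l * t + c) ((semilin D (sub q) ^^ l) ` Z)" unfolding hh_def by blast
    then have "B (real q ^ l * (real s * t) + real s * c) ((semilin (lv s D) (sub q) ^^ l) ` vmap (sub s) ` Z)" for l
      unfolding im using Bs[of "real q ^ l * t" c] by (simp add: ac_simps)
    then show "hh q (lv s D) (real s * t) (vmap (sub s) ` Z)" unfolding hh_def by blast
  next
    assume "hh q (lv s D) (real s * t) (vmap (sub s) ` Z)"
    then obtain c where c: "\<And>l. B (real q ^ l * (real s * t) + c) (vmap (sub s) ` (semilin D (sub q) ^^ l) ` Z)"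
      unfolding hh_def im by blast
    have "B (real q ^ l * t + c / real s) ((semilin D (sub q) ^^ l) ` Z)" for l
      using c[of l] Bs[of "real q ^ l * t" "c / real s"] assms(2) by (simp add: ac_simps)
    then show "hh q D t Z" unfolding hh_def by blast
  qed
qed

text \<open>A gauge transformation changes heights by a bounded amount, which disappears in the
  growth rate.\<close>

lemma hh_gauge:
  assumes "gauge q M D D'" "q > 0" "hh q D' t Z"
  shows "hh q D t ((*v) M ` Z)"
proof -
  obtain c where c: "\<And>t Z. B t Z \<Longrightarrow> B (t + c) ((*v) M ` Z)"
  proof -
    obtain c where "\<forall>s>0. \<forall>t Z. B t Z \<longrightarrow> B (t + real s * c) ((*v) (lv s M) ` Z)"
      using B_mult[of M] by blast
    from this[rule_format, of 1] have "B t Z \<Longrightarrow> B (t + c) ((*v) M ` Z)" for t Z by simp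
    then show ?thesis by (rule that)
  qed
  obtain c' where "\<And>l. B (real q ^ l * t + c') ((semilin D' (sub q) ^^ l) ` Z)"
    using assms(3) unfolding hh_def by blast
  then have "B (real q ^ l * t + c' + c) ((*v) M ` (semilin D' (sub q) ^^ l) ` Z)" for l using c by blast
  then have "B (real q ^ l * t + (c' + c)) ((semilin D (sub q) ^^ l) ` (*v) M ` Z)" for l
    by (simp add: image_image gauge_semilin[OF assms(1,2)] add.assoc)
  then show ?thesis unfolding hh_def by blast
qed

lemma hh_gauge_iff:
  assumes "gauge q M D D'" "q > 0"
  shows "hh q D t ((*v) M ` Z) \<longleftrightarrow> hh q D' t Z"
proof
  assume "hh q D t ((*v) M ` Z)"
  from hh_gauge[OF gauge_inv[OF assms] assms(2) this] show "hh q D' t Z"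
    using assms(1) by (simp add: gauge_def image_image matrix_vector_mul_assoc matrix_inv_left)
qed (rule hh_gauge[OF assms])

lemma hh_shift:
  assumes "q > 0"
  shows "hh q D t {k_var ^ a *s z} \<longleftrightarrow> hh q D (t + sg * real a) {z}"
proof -
  have "B (real q ^ l * t + c) {k_var ^ (a * q ^ l) *s w} \<longleftrightarrow> B (real q ^ l * (t + sg * real a) + c) {w}" for l c w
    by (simp add: B_shift algebra_simps)
  then show ?thesis unfolding hh_def by (simp add: semilin_k_var_power[OF assms])
qed

end

section \<open>Gauge equivalence between the levels of a Mahler system\<close>

locale mahler_pair =
  fixes q1 q2 :: nat and D1 D2 :: "'c::{alg_closed_field,field_char_0} ratfun ^ 'n ^ 'n"
  assumes q: "q1 \<ge> 2" "q2 \<ge> 2" and D: "invertible D1" "invertible D2"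
    and cons: "D1 ** lv q1 D2 = D2 ** lv q2 D1"
    and indep: "\<And>a b. q1 ^ a = q2 ^ b \<Longrightarrow> a = 0 \<and> b = 0"
begin

lemma q_pos [simp]: "q1 > 0" "q2 > 0" using q by auto

lemma level: "s > 0 \<Longrightarrow> mahler_pair q1 q2 (lv s D1) (lv s D2)"
proof
  assume s: "s > 0"
  have "lv s (D1 ** lv q1 D2) = lv s (D2 ** lv q2 D1)" using cons by simp
  then show "lv s D1 ** lv q1 (lv s D2) = lv s D2 ** lv q2 (lv s D1)"
    using s by (simp add: lv_simps mult.commute)
qed (use q D indep in \<open>auto intro: lv_simps\<close>)

text \<open>\<open>D1\<close> itself is a gauge from \<open>D1\<close> to its level
  \<open>q1\<close>, and by consistency \<open>D2\<close> is one to its level \<open>q2\<close>.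
  Compositions reach every monomial.\<close>

lemma gauge_level: "\<exists>M. gauge q1 M D1 (lv (q1 ^ i * q2 ^ j) D1)"
proof -
  have step: "\<exists>M. gauge q1 M D1 (lv (q * s) D1)"
    if "\<exists>M. gauge q1 M D1 (lv s D1)" "\<exists>M. gauge q1 M D1 (lv q D1)" "q > 0" "s > 0" for q s
    using that gauge_trans[OF _ gauge_lv[of q1 _ D1 "lv s D1" q]] by (fastforce simp: lv_simps)
  have 1: "\<exists>M. gauge q1 M D1 (lv q1 D1)" using D by (auto simp: gauge_def)
  have 2: "\<exists>M. gauge q1 M D1 (lv q2 D1)" using D cons by (auto simp: gauge_def)
  have "gauge q1 (mat 1) D1 D1" by (simp add: gauge_def map_matrix_mat_1 sub_hom invertible_def)
  then have "\<exists>M. gauge q1 M D1 (lv (q2 ^ j) D1)"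
    by (induction j) (auto intro: step[OF _ 2])
  then show ?thesis
    by (induction i) (simp_all add: mult.assoc step[OF _ 1])
qed

text \<open>With \<alpha> and \<beta> the multiplicities of \<open>r\<close> in \<open>q1\<close>
  and \<open>q2\<close>, the numbers \<open>q1 ^ \<beta>\<close> and \<open>q2 ^ \<alpha>\<close>
  contain the same power of \<open>r\<close>. Their cofactors are prime to \<open>r\<close> and
  differ by multiplicative independence; the larger one is \<open>u\<close>.\<close>

lemma exponents:
  assumes "prime r" "r dvd q2"
  obtains u v i j i' j' where "0 < v" "v < u" "coprime u r" "v * (q1 ^ i * q2 ^ j) = u * (q1 ^ i' * q2 ^ j')"
proof -
  define \<alpha> where "\<alpha> = multiplicity r q1"
  define \<beta> where "\<beta> = multiplicity r q2"
  have "\<not> is_unit r" using assms(1) by auto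
  then obtain X0 Y0 where XY: "q1 = r ^ \<alpha> * X0" "\<not> r dvd X0" "q2 = r ^ \<beta> * Y0" "\<not> r dvd Y0"
    unfolding \<alpha>_def \<beta>_def
    by (metis multiplicity_decompose' q_pos less_not_refl)
  have "\<beta> > 0" using assms(2) XY(3,4) by (cases \<beta>) auto
  define X where "X = X0 ^ \<beta>"
  define Y where "Y = Y0 ^ \<alpha>"
  have X: "q1 ^ \<beta> = r ^ (\<alpha> * \<beta>) * X" and Y: "q2 ^ \<alpha> = r ^ (\<alpha> * \<beta>) * Y"
    by (subst XY, simp add: X_def Y_def power_mult_distrib mult.commute flip: power_mult)+
  have "X > 0" "Y > 0" using XY q by (auto simp: X_def Y_def intro!: Nat.gr0I)
  have "coprime r X0" "coprime r Y0" using XY assms(1) by (simp_all add: prime_imp_coprime)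
  then have cop: "coprime X r" "coprime Y r" by (simp_all add: X_def Y_def coprime_commute)
  have "X \<noteq> Y" using indep[of \<beta> \<alpha>] X Y \<open>\<beta> > 0\<close> by auto
  then consider "X < Y" | "Y < X" by linarith
  then show ?thesis
  proof cases
    case 1
    show ?thesis by (rule that[of X Y 0 \<alpha> \<beta> 0]) (use 1 \<open>X > 0\<close> cop X Y in auto)
  next
    case 2
    show ?thesis by (rule that[of Y X \<beta> 0 0 \<alpha>]) (use 2 \<open>Y > 0\<close> cop X Y in auto)
  qed
qed

text \<open>The two levels have a common multiple \<open>v ^ l * X = u ^ l * Y\<close> with
  monomials \<open>X\<close> and \<open>Y\<close>, which \<open>gauge_level\<close> reaches from
  both sides.\<close>

lemma exponent_gauge:
  assumes "0 < v" "v * (q1 ^ i * q2 ^ j) = u * (q1 ^ i' * q2 ^ j')"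
  shows "\<exists>M. gauge q1 M (lv (v ^ l) D1) (lv (u ^ l) D1)"
proof -
  have u: "u > 0" using assms by (metis mult_is_0 neq0_conv power_not_zero q_pos)
  define X where "X = q1 ^ (i * l) * q2 ^ (j * l)"
  define Y where "Y = q1 ^ (i' * l) * q2 ^ (j' * l)"
  have "v ^ l * X = u ^ l * Y" using arg_cong[OF assms(2), of "\<lambda>x. x ^ l"]
    by (simp add: X_def Y_def power_mult_distrib power_mult)
  obtain M1 where "gauge q1 M1 D1 (lv X D1)" using gauge_level X_def by blast
  then have 1: "gauge q1 (lv (v ^ l) M1) (lv (v ^ l) D1) (lv (v ^ l * X) D1)"
    using gauge_lv[of q1 M1 D1 "lv X D1" "v ^ l"] assms(1) by (simp add: lv_simps X_def)
  obtain M2 where "gauge q1 M2 D1 (lv Y D1)" using gauge_level Y_def by blast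
  then have 2: "gauge q1 (lv (u ^ l) M2) (lv (u ^ l) D1) (lv (u ^ l * Y) D1)"
    using gauge_lv[of q1 M2 D1 "lv Y D1" "u ^ l"] u by (simp add: lv_simps Y_def)
  show ?thesis
    using gauge_trans[OF 1] gauge_inv[OF 2] \<open>v ^ l * X = u ^ l * Y\<close> q_pos by metis
qed

end

context mahler_height
begin

text \<open>Since \<open>u / v\<close> is a quotient of monomials in \<open>q1\<close> and \<open>q2\<close>, the systems at the levels \<open>u\<^sup>l\<close> and \<open>v\<^sup>l\<close> are
  gauge equivalent. The substitution \<open>x \<mapsto> x^(u^l)\<close> only permutes the sections modulo \<open>r\<close>, as \<open>u\<close> is prime
  to \<open>r\<close>, and it scales the canonical height by \<open>u\<^sup>l\<close>, whereas the bounded difference between height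
  and canonical height at the level \<open>v\<^sup>l\<close> is only of size \<open>v\<^sup>l\<close>.\<close>
lemma hh_prime_section:
  assumes "mahler_pair q1 q2 E1 E2" and r: "prime r" "r dvd q2" and "\<epsilon> > 0" and b: "b < r"
    and h: "hh q1 (lv r E1) t {\<Sum>b<r. k_var ^ b *s vmap (sub r) (y b)}"
  shows "hh q1 (lv r E1) (kap r * t + \<epsilon>) {k_var ^ b *s vmap (sub r) (y b)}"
proof -
  interpret mahler_pair q1 q2 E1 E2 by fact
  from r obtain u v i j i' j' where uv: "0 < v" "v < u" "coprime u r"
    "v * (q1 ^ i * q2 ^ j) = u * (q1 ^ i' * q2 ^ j')" by (rule exponents)
  have r0: "r > 0" using r(1) prime_gt_0_nat by blast
  have u0: "u > 0" using uv by simp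
  define D where "D = lv r E1"
  obtain c1 where c1: "c1 \<ge> 0" "\<And>s t Z. s > 0 \<Longrightarrow> B t Z \<Longrightarrow> hh q1 (lv s D) (t + real s * c1) Z"
    using hhI[OF q(1), of D] by blast
  obtain c2 where c2: "c2 \<ge> 0" "\<And>s t Z. s > 0 \<Longrightarrow> hh q1 (lv s D) t Z \<Longrightarrow> B (t + real s * c2) Z"
    using hhD[OF q(1), of D] D(1) r0 by (auto simp: D_def lv_simps)
  \<comment> \<open>The loss of passing from canonical heights to heights and back at level v^l,
    relative to v^l. After division by u^l it tends to 0.\<close>
  define C where "C = kap r * c2 + c1"
  have "C \<ge> 0" using kap_pos[OF r0] c1 c2 by (simp add: C_def)
  have "(\<lambda>l. C * (real v / real u) ^ l) \<longlonglongrightarrow> C * 0"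
    by (intro tendsto_intros LIMSEQ_power_zero) (use uv in simp)
  then have "\<forall>\<^sub>F l in sequentially. C * (real v / real u) ^ l < \<epsilon>"
    using \<open>\<epsilon> > 0\<close> by (simp add: order_tendstoD(2))
  then obtain l where l: "C * (real v / real u) ^ l < \<epsilon>" by (auto simp: eventually_sequentially)
  define V where "V = v ^ l"
  define U where "U = u ^ l"
  have VU: "V > 0" "U > 0" "coprime U r" using uv u0 by (auto simp: V_def U_def)
  obtain M where "gauge q1 M (lv V E1) (lv U E1)" using exponent_gauge[OF uv(1,4)] V_def U_def by blast
  then have M: "gauge q1 (lv r M) (lv V D) (lv U D)"
    using gauge_lv[of q1 M "lv V E1" "lv U E1" r] VU r0 by (simp add: D_def lv_simps mult.commute)
  \<comment> \<open>Substitution of x^(u^l) followed by the gauge to level v^l. It keeps the shape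
    of a sum of sections modulo \<open>r\<close>, with exponents multiplied by u^l.\<close>
  define T where "T z = lv r M *v vmap (sub U) z" for z
  have T: "hh q1 (lv V D) (real U * t) {T z} \<longleftrightarrow> hh q1 D t {z}" for t z
    using hh_gauge_iff[OF M, of "real U * t" "{vmap (sub U) z}"] hh_sub[of q1 U D t "{z}"] VU
    by (simp add: T_def)
  have Tb: "T (k_var ^ b *s vmap (sub r) z) = k_var ^ (b * U) *s vmap (sub r) (M *v vmap (sub U) z)" for b z
    using VU r0 by (simp add: T_def vmap_sub_k_var_power vector_scalar_commute lv_simps mult.commute)
  have Tsum: "T (sum f A) = (\<Sum>a\<in>A. T (f a))" for f :: "nat \<Rightarrow> _" and A
    using VU by (simp add: T_def vmap_sum sub_hom vec.linear_sum[OF matrix_vector_mul_linear_gen])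
  have "B (real U * t + real V * c2) {T (\<Sum>b<r. k_var ^ b *s vmap (sub r) (y b))}"
    using c2(2)[OF VU(1)] T h by (simp add: D_def)
  then have "B (real U * t + real V * c2) {\<Sum>b<r. k_var ^ (b * U) *s vmap (sub r) (M *v vmap (sub U) (y b))}"
    by (simp add: Tsum Tb)
  from B_sec[OF r0 VU(3) b this]
  have "B (kap r * (real U * t + real V * c2)) {T (k_var ^ b *s vmap (sub r) (y b))}" by (simp add: Tb)
  from c1(2)[OF VU(1) this]
  have "hh q1 (lv V D) (kap r * (real U * t + real V * c2) + real V * c1) {T (k_var ^ b *s vmap (sub r) (y b))}" .
  moreover have "kap r * (real U * t + real V * c2) + real V * c1 = real U * (kap r * t + C * (real v / real u) ^ l)"
    using u0 by (simp add: C_def U_def V_def field_simps)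
  ultimately have "hh q1 D (kap r * t + C * (real v / real u) ^ l) {k_var ^ b *s vmap (sub r) (y b)}"
    using T by simp
  then show ?thesis unfolding D_def by (rule hh_mono) (use l in simp)
qed

text \<open>Prime factors of N are split off one at a time with a = b + r d. The shifts by b and
  then by d add up to (b + r d) / N = a / N, because \<open>kap_sg\<close> lets the factors
  \<open>kap\<close> pass the shifts.\<close>

lemma hh_section:
  assumes "N > 0" "\<And>r. prime r \<Longrightarrow> r dvd N \<Longrightarrow> r dvd q2"
    and "mahler_pair q1 q2 E1 E2" "\<epsilon> > 0" "a < N"
    and "hh q1 (lv N E1) t {\<Sum>a<N. k_var ^ a *s vmap (sub N) (p a)}"
  shows "hh q1 E1 ((kap N * t + sg * real a) / real N + \<epsilon>) {p a}"
  using assms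
proof (induction N arbitrary: t \<epsilon> a p rule: less_induct)
  case (less N)
  interpret mahler_pair q1 q2 E1 E2 by fact
  show ?case
  proof (cases "N = 1")
    case True
    then have "hh q1 E1 t {p 0}" using less.prems by (simp add: lessThan_Suc)
    then show ?thesis using True less.prems kap_1 by (auto intro: hh_mono)
  next
    case False
    then obtain r where r: "prime r" "r dvd N" using prime_factor_nat by blast
    then obtain N' where N': "N = r * N'" by blast
    have r0: "r > 0" "r > 1" using r(1) prime_gt_0_nat prime_gt_1_nat by blast+
    have N'0: "N' > 0" "N' < N" using less.prems(1) r0 by (auto simp: N')
    define b where "b = a mod r"
    define d where "d = a div r"
    have a: "a = b + r * d" "b < r" by (simp_all add: b_def d_def r0)
    have d: "d < N'" using less.prems(5) by (simp add: d_def N' less_mult_imp_div_less mult.commute)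
    define y where "y b = (\<Sum>d<N'. k_var ^ d *s vmap (sub N') (p (b + r * d)))" for b
    have "(\<Sum>a<N. k_var ^ a *s vmap (sub N) (p a))
        = (\<Sum>b<r. \<Sum>d<N'. k_var ^ (b + r * d) *s vmap (sub N) (p (b + r * d)))"
    proof -
      have "(\<Sum>a<N. k_var ^ a *s vmap (sub N) (p a))
          = (\<Sum>(b, d)\<in>{..<r} \<times> {..<N'}. k_var ^ (b + r * d) *s vmap (sub N) (p (b + r * d)))"
      proof (rule sum.reindex_bij_witness[of _ "\<lambda>(b, d). b + r * d" "\<lambda>a. (a mod r, a div r)"])
        fix bd assume bd: "bd \<in> {..<r} \<times> {..<N'}"
        show "(\<lambda>(b, d). b + r * d) bd \<in> {..<N}"
        proof -
          have "fst bd + r * snd bd < r * (snd bd + 1)" using bd by auto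
          also have "\<dots> \<le> r * N'" using bd by (intro mult_left_mono) auto
          finally show ?thesis by (simp add: N' case_prod_beta)
        qed
        show "(\<lambda>a. (a mod r, a div r)) ((\<lambda>(b, d). b + r * d) bd) = bd" using bd by auto
      qed (auto simp: N' r0 less_mult_imp_div_less mult.commute)
      then show ?thesis by (simp add: sum.cartesian_product)
    qed
    also have "\<dots> = (\<Sum>b<r. k_var ^ b *s vmap (sub r) (y b))"
    proof (rule sum.cong[OF refl])
      fix b
      show "(\<Sum>d<N'. k_var ^ (b + r * d) *s vmap (sub N) (p (b + r * d))) = k_var ^ b *s vmap (sub r) (y b)"
        unfolding y_def using r0 N'0
        by (simp add: vmap_sum sub_hom vmap_sub_k_var_power lv_simps N' vec.scale_sum_right power_add mult.commute)
    qed
    finally have eq: "(\<Sum>a<N. k_var ^ a *s vmap (sub N) (p a)) = (\<Sum>b<r. k_var ^ b *s vmap (sub r) (y b))" .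
    \<comment> \<open>Scaled so that the later factor \<open>kap N' / N\<close> turns it into half
      of \<epsilon>.\<close>
    define \<epsilon>' where "\<epsilon>' = \<epsilon> / 2 * real N / kap N'"
    have "\<epsilon>' > 0" using less.prems N'0 kap_pos by (simp add: \<epsilon>'_def)
    have "hh q1 (lv r (lv N' E1)) (kap r * t + \<epsilon>') {k_var ^ b *s vmap (sub r) (y b)}"
      using less.prems(2)[OF r] level[OF N'0(1)] r(1) a(2) \<open>\<epsilon>' > 0\<close> less.prems(6) N'0 r0
      by (intro hh_prime_section[of q1 q2 "lv N' E1" "lv N' E2"]) (auto simp: eq[symmetric] lv_simps N')
    then have "hh q1 (lv r (lv N' E1)) (kap r * t + \<epsilon>' + sg * real b) (vmap (sub r) ` {y b})"
      by (simp add: hh_shift)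
    moreover have "kap r * t + \<epsilon>' + sg * real b = real r * ((kap r * t + \<epsilon>' + sg * real b) / real r)" using r0 by simp
    ultimately have "hh q1 (lv N' E1) ((kap r * t + \<epsilon>' + sg * real b) / real r) {y b}"
      using hh_sub[of q1 r "lv N' E1" "(kap r * t + \<epsilon>' + sg * real b) / real r" "{y b}"] r0 by simp
    from less.IH[OF N'0(2,1) _ less.prems(3) _ d this[unfolded y_def], of "\<epsilon> / 2"]
    have "hh q1 E1 ((kap N' * ((kap r * t + \<epsilon>' + sg * real b) / real r) + sg * real d) / real N' + \<epsilon> / 2) {p a}"
      using less.prems(2,4) by (simp add: a(1) N')
    moreover have "(kap N' * ((kap r * t + \<epsilon>' + sg * real b) / real r) + sg * real d) / real N' + \<epsilon> / 2
        = (kap N * t + sg * real a) / real N + \<epsilon>"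
    proof -
      define k where "k = kap N * t"
      have "real N = real r * real N'" by (simp add: N')
      have "kap N' * (kap r * t + \<epsilon>' + sg * real b) = kap N * t + \<epsilon> / 2 * real N + kap N' * sg * real b"
        using kap_pos[OF N'0(1)] by (simp add: \<epsilon>'_def N' kap_mult algebra_simps)
      also have "\<dots> = kap N * t + \<epsilon> / 2 * real N + sg * real b" by (simp add: kap_sg)
      finally have e': "kap N' * (kap r * t + \<epsilon>' + sg * real b) = k + \<epsilon> / 2 * real N + sg * real b"
        unfolding k_def .
      have e: "kap N' * ((kap r * t + \<epsilon>' + sg * real b) / real r) + sg * real d
          = (k + \<epsilon> / 2 * real N + sg * real b + sg * real d * real r) / real r"
        unfolding times_divide_eq_right e' using r0 by (simp add: add_divide_distrib)
      show ?thesis unfolding e k_def[symmetric] a(1) \<open>real N = real r * real N'\<close>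
        using r0 N'0 by (simp add: field_simps)
    qed
    ultimately show ?thesis by simp
  qed
qed

end

section \<open>Dependence, denominators and attained canonical heights\<close>

lemma vec_dependent_family:
  fixes w :: "'i \<Rightarrow> 'f::field ^ 'n"
  assumes "finite I" "card I > CARD('n)"
  shows "\<exists>a. (\<exists>i\<in>I. a i \<noteq> 0) \<and> (\<Sum>i\<in>I. a i *s w i) = 0"
proof (cases "inj_on w I")
  case False
  then obtain i j where ij: "i \<in> I" "j \<in> I" "i \<noteq> j" "w i = w j" by (auto simp: inj_on_def)
  define a where "a l = (if l = i then 1 else if l = j then -1 else 0 :: 'f)" for l
  have "(\<Sum>l\<in>I. a l *s w l) = (\<Sum>l\<in>{i,j}. a l *s w l)"
    by (rule sum.mono_neutral_right) (use ij assms in \<open>auto simp: a_def\<close>)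
  also have "\<dots> = 0" using ij by (simp add: a_def vec_eq_iff)
  finally show ?thesis using ij by (intro exI[of _ a]) (auto simp: a_def)
next
  case True
  have "vec.dependent (w ` I)"
  proof (rule ccontr)
    assume "\<not> vec.dependent (w ` I)"
    then have "card (w ` I) \<le> CARD('n)"
      using vec.independent_bound_general dim_subset_UNIV_cart_gen le_trans by blast
    then show False using assms True by (simp add: card_image)
  qed
  then obtain u where u: "\<exists>v\<in>w ` I. u v \<noteq> 0" "(\<Sum>v\<in>w ` I. u v *s v) = 0"
    using vec.dependent_finite[of "w ` I"] assms(1) by auto
  then show ?thesis using True by (intro exI[of _ "u \<circ> w"]) (auto simp: sum.reindex)
qed

lemma common_denominator:
  fixes A :: "'c::field ratfun set"
  assumes "finite A"
  shows "\<exists>d. d \<noteq> 0 \<and> (\<forall>f\<in>A. to_fract d * f \<in> Pol)"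
  using assms
proof (induction A)
  case empty
  show ?case by (intro exI[of _ 1]) auto
next
  case (insert f A)
  then obtain d where d: "d \<noteq> 0" "\<forall>f\<in>A. to_fract d * f \<in> Pol" by blast
  obtain a b where ab: "b \<noteq> 0" "f = to_fract a / to_fract b" by (rule ratfun_cases)
  have "to_fract (b * d) * g \<in> Pol" if "g \<in> insert f A" for g
  proof (cases "g = f")
    case True
    then have "to_fract (b * d) * g = to_fract (a * d)" using ab by simp
    then show ?thesis by (metis Pol_closed(1))
  next
    case False
    then have "to_fract b * (to_fract d * g) \<in> Pol" using that d False by (subst Pol_closed(7)[OF Pol_closed(1)]) auto
    then show ?thesis by (simp add: mult.assoc)
  qed
  then show ?case using ab d by (intro exI[of _ "b * d"]) auto
qed

text \<open>A common multiple of the differences q^j - q^i; in \<open>hh_integral\<close> it clears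
  the denominators of canonical heights.\<close>

definition gap_prod :: "nat \<Rightarrow> nat \<Rightarrow> nat"
  where "gap_prod q n = (\<Prod>(i, j)\<in>{(i, j). i < j \<and> j \<le> n}. q ^ j - q ^ i)"

lemma gap_finite: "finite {(i, j). i < j \<and> j \<le> (n::nat)}"
  by (rule finite_subset[of _ "{..n} \<times> {..n}"]) auto

lemma gap_prod_pos: "q \<ge> 2 \<Longrightarrow> gap_prod q n > 0"
  unfolding gap_prod_def by (intro prod_pos) (auto intro: power_strict_increasing)

lemma gap_dvd: "i < j \<Longrightarrow> j \<le> n \<Longrightarrow> q ^ j - q ^ i dvd gap_prod q n"
  unfolding gap_prod_def using dvd_prodI[OF gap_finite[of n], of "(i, j)" "\<lambda>(i, j). q ^ j - q ^ i"] by auto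

context mahler_height
begin

lemma hhI1:
  assumes "q \<ge> 2" shows "\<exists>c. \<forall>t Z. B t Z \<longrightarrow> hh q D (t + c) Z"
proof -
  obtain c where "\<forall>s>0. \<forall>t Z. B t Z \<longrightarrow> hh q (lv s D) (t + real s * c) Z"
    using hhI[OF assms] by blast
  from this[rule_format, of 1] have "\<forall>t Z. B t Z \<longrightarrow> hh q D (t + c) Z" by simp
  then show ?thesis by blast
qed

lemma hhD1:
  assumes "q \<ge> 2" "invertible D" shows "\<exists>c. \<forall>t Z. hh q D t Z \<longrightarrow> B (t + c) Z"
proof -
  obtain c where "\<forall>s>0. \<forall>t Z. hh q (lv s D) t Z \<longrightarrow> B (t + real s * c) Z"
    using hhD[OF assms] by blast
  from this[rule_format, of 1] have "\<forall>t Z. hh q D t Z \<longrightarrow> B (t + c) Z" by simp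
  then show ?thesis by blast
qed

lemma hh_semilin:
  assumes "q > 0" "invertible D"
  shows "hh q D (real q * t) (semilin D (sub q) ` Z) \<longleftrightarrow> hh q D t Z"
proof -
  have g: "gauge q D D (lv q D)" using assms by (simp add: gauge_def)
  have "semilin D (sub q) ` Z = (*v) D ` vmap (sub q) ` Z" by (auto simp: semilin_def)
  then show ?thesis using hh_gauge_iff[OF g assms(1)] hh_sub[OF assms(1,1)] by simp
qed

lemma hh_semilin_iter:
  assumes "q > 0" "invertible D"
  shows "hh q D (real q ^ l * t) {(semilin D (sub q) ^^ l) z} \<longleftrightarrow> hh q D t {z}"
proof (induction l)
  case (Suc l)
  then show ?case using hh_semilin[OF assms, of "real q ^ l * t" "{(semilin D (sub q) ^^ l) z}"]
    by (simp add: mult.assoc)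
qed simp

text \<open>A bound worse by 1 / q^l costs only the constant 1 at the l-th iterate, so the growth
  rate \<tau> itself is reached with a larger additive constant.\<close>

lemma hh_closed:
  assumes "q \<ge> 2" "invertible D" "\<And>t. \<tau> < t \<Longrightarrow> hh q D t {z}"
  shows "hh q D \<tau> {z}"
proof -
  have q: "q > 0" using assms by simp
  obtain c where c: "\<And>t Z. hh q D t Z \<Longrightarrow> B (t + c) Z" using hhD1[OF assms(1,2)] by blast
  have "B (real q ^ l * \<tau> + (1 + c)) {(semilin D (sub q) ^^ l) z}" for l
  proof -
    have "hh q D (\<tau> + 1 / real q ^ l) {z}" using q by (intro assms(3)) simp
    then have "hh q D (real q ^ l * (\<tau> + 1 / real q ^ l)) {(semilin D (sub q) ^^ l) z}"
      using hh_semilin_iter[OF q assms(2)] by blast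
    from c[OF this] show ?thesis using q by (simp add: distrib_left add.assoc)
  qed
  then show ?thesis unfolding hh_def by auto
qed

end

section \<open>Heights from valuations and from denominators\<close>

context mahler_valuation
begin

definition Bv :: "real \<Rightarrow> ('c ratfun ^ 'n) set \<Rightarrow> bool"
  where "Bv t Z \<longleftrightarrow> (\<forall>z\<in>Z. \<forall>i. vge (- t) (z $ i))"

lemma vge_mult_iff: "a \<noteq> 0 \<Longrightarrow> vge t (a * f) \<longleftrightarrow> vge (t - of_int (val a)) f"
  by (cases "f = 0") (auto simp: vge_def val_mult)

lemma mahler_height_Bv: "mahler_height (Bv :: real \<Rightarrow> ('c ratfun ^ 'n) set \<Rightarrow> bool) (\<lambda>_. 1) (of_int sg)"
proof
  fix s :: nat and t and Z :: "('c ratfun ^ 'n) set"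
  assume "s > 0"
  then show "Bv (real s * t) (vmap (sub s) ` Z) \<longleftrightarrow> Bv t Z"
    using vge_sub[of s "- t"] by (simp add: Bv_def)
next
  fix G :: "'c ratfun ^ 'n ^ 'n"
  have "finite (range (\<lambda>(i, j). G $ i $ j))" by simp
  then obtain e where "\<forall>f\<in>range (\<lambda>(i, j). G $ i $ j). vge (- real e) f" using vge_exists_finite by blast
  then have e: "vge (- real e) (G $ i $ j)" for i j by auto
  have "Bv (t + real s * real e) ((*v) (lv s G) ` Z)" if "s > 0" "Bv t Z" for s t Z
    unfolding Bv_def
  proof (intro ballI allI)
    fix y i assume "y \<in> (*v) (lv s G) ` Z"
    then obtain z where z: "z \<in> Z" "y = lv s G *v z" by blast
    have "vge (- (real s * real e) + - t) (sub s (G $ i $ j) * z $ j)" for j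
    proof (rule vge_mult)
      show "vge (- (real s * real e)) (sub s (G $ i $ j))"
        using vge_sub[OF that(1), of "- real e"] e by simp
    qed (use that(2) z(1) in \<open>simp add: Bv_def\<close>)
    then have "vge (- (real s * real e) + - t) (y $ i)"
      unfolding z(2) matrix_vector_mult_def by (auto intro: vge_sum)
    then show "vge (- (t + real s * real e)) (y $ i)" by (simp add: add.commute)
  qed
  then show "\<exists>c\<ge>0. \<forall>s>0. \<forall>t Z. Bv t Z \<longrightarrow> Bv (t + real s * c) ((*v) (lv s G) ` Z)"
    by (intro exI[of _ "real e"]) auto
next
  fix r u a t and g :: "nat \<Rightarrow> 'c ratfun ^ 'n"
  assume "r > 0" "coprime u r" "a < r" "Bv t {\<Sum>a<r. k_var ^ (a * u) *s vmap (sub r) (g a)}"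
  then show "Bv (1 * t) {k_var ^ (a * u) *s vmap (sub r) (g a)}"
    using vge_section[of r u "- t" "\<lambda>a. g a $ i" a for i] by (simp add: Bv_def)
next
  fix t a and z :: "'c ratfun ^ 'n"
  show "Bv t {k_var ^ a *s z} \<longleftrightarrow> Bv (t + of_int sg * real a) {z}"
  proof -
    have e: "- t - of_int (int a * sg) = - (t + of_int sg * real a)" by simp
    have "vge (- t) ((k_var ^ a *s z) $ i) \<longleftrightarrow> vge (- t - of_int (int a * sg)) (z $ i)" for i
      by (simp add: vge_mult_iff val_power val_k_var)
    then show ?thesis unfolding e by (simp add: Bv_def)
  qed
next
  fix t t' and Z :: "('c ratfun ^ 'n) set"
  assume "Bv t Z" "t \<le> t'"
  then show "Bv t' Z" unfolding Bv_def by (meson vge_mono neg_le_iff_le)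
qed auto

sublocale H: mahler_height "Bv :: real \<Rightarrow> ('c ratfun ^ 'n) set \<Rightarrow> bool" "\<lambda>_. 1" "of_int sg"
  by (rule mahler_height_Bv)

lemma Bv_exists: "\<exists>t. Bv t {z :: 'c ratfun ^ 'n}"
proof -
  have "finite (range (\<lambda>i. z $ i))" by simp
  then obtain e where "\<forall>f\<in>range (\<lambda>i. z $ i). vge (- real e) f" using vge_exists_finite by blast
  then show ?thesis by (intro exI[of _ "real e"]) (simp add: Bv_def)
qed

lemma hh_exists:
  fixes z :: "'c ratfun ^ 'n"
  assumes "q \<ge> 2" shows "\<exists>t. H.hh q D t {z}"
proof -
  obtain t where "Bv t {z}" using Bv_exists by blast
  then show ?thesis using H.hhI1[OF assms] by blast
qed

lemma semilin_scale_iter: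
  "q > 0 \<Longrightarrow> (semilin D (sub q) ^^ l) (a *s z) = sub (q ^ l) a *s (semilin D (sub q) ^^ l) z"
  by (induction l) (simp_all add: semilin_scale sub_hom sub_sub)

lemma hh_scale:
  fixes z :: "'c ratfun ^ 'n"
  assumes "q > 0" "a \<noteq> 0"
  shows "H.hh q D t {a *s z} \<longleftrightarrow> H.hh q D (t + of_int (val a)) {z}"
proof -
  have "Bv (real q ^ l * t + c) {sub (q ^ l) a *s y} \<longleftrightarrow> Bv (real q ^ l * (t + of_int (val a)) + c) {y}"
    for l c and y :: "'c ratfun ^ 'n"
  proof -
    have e: "- (real q ^ l * t + c) - of_int (val (sub (q ^ l) a)) = - (real q ^ l * (t + of_int (val a)) + c)"
      using assms by (simp add: val_sub' algebra_simps)
    have "vge (- (real q ^ l * t + c)) ((sub (q ^ l) a *s y) $ i)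
        \<longleftrightarrow> vge (- (real q ^ l * t + c) - of_int (val (sub (q ^ l) a))) (y $ i)" for i
      using assms by (simp add: vge_mult_iff sub_eq_0_iff)
    then show ?thesis unfolding e by (simp add: Bv_def)
  qed
  then show ?thesis unfolding H.hh_def by (simp add: semilin_scale_iter assms)
qed

lemma hh_add:
  fixes z z' :: "'c ratfun ^ 'n"
  assumes "q > 0" "H.hh q D t {z}" "H.hh q D t {z'}"
  shows "H.hh q D t {z + z'}"
proof -
  obtain c c' where c: "\<And>l. Bv (real q ^ l * t + c) {(semilin D (sub q) ^^ l) z}"
    "\<And>l. Bv (real q ^ l * t + c') {(semilin D (sub q) ^^ l) z'}"
    using assms unfolding H.hh_def by auto
  have "(semilin D (sub q) ^^ l) (z + z') = (semilin D (sub q) ^^ l) z + (semilin D (sub q) ^^ l) z'" for l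
    using assms(1) by (induction l) (simp_all add: semilin_add sub_hom)
  moreover have "Bv (real q ^ l * t + max c c') {(semilin D (sub q) ^^ l) z + (semilin D (sub q) ^^ l) z'}" for l
    using H.B_mono[OF c(1), of l "real q ^ l * t + max c c'"] H.B_mono[OF c(2), of l "real q ^ l * t + max c c'"]
    by (auto simp: Bv_def intro: vge_add)
  ultimately show ?thesis unfolding H.hh_def by (intro exI[of _ "max c c'"]) simp
qed

lemma hh_sum:
  fixes z :: "'i \<Rightarrow> 'c ratfun ^ 'n"
  assumes "q > 0" "\<And>i. i \<in> A \<Longrightarrow> H.hh q D t {z i}"
  shows "H.hh q D t {sum z A}"
proof -
  have "(semilin D (sub q) ^^ l) 0 = (0 :: 'c ratfun ^ 'n)" for l
    using semilin_scale_iter[OF assms(1), of l D 0 0] assms(1) by (simp add: field_hom_simps sub_hom)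
  then have 0: "H.hh q D t {0 :: 'c ratfun ^ 'n}"
    unfolding H.hh_def by (simp add: Bv_def)
  show ?thesis using assms(2)
    by (induction A rule: infinite_finite_induct) (simp_all only: sum.infinite sum.empty sum.insert 0 hh_add[OF assms(1)] insert_iff simp_thms)
qed

text \<open>The valid bounds form an upward closed set, bounded below by a nonzero entry of
  \<open>z\<close> through \<open>hhD1\<close> and closed by \<open>hh_closed\<close>; \<tau> is its
  infimum.\<close>

lemma hh_exact:
  fixes z :: "'c ratfun ^ 'n"
  assumes "q \<ge> 2" "invertible D" "z \<noteq> 0"
  shows "\<exists>\<tau>. \<forall>t. H.hh q D t {z} \<longleftrightarrow> \<tau> \<le> t"
proof -
  define A where "A = {t. H.hh q D t {z}}"
  obtain c where c: "\<And>t Z. H.hh q D t Z \<Longrightarrow> Bv (t + c) (Z :: ('c ratfun ^ 'n) set)"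
    using H.hhD1[OF assms(1,2)] by blast
  obtain i where i: "z $ i \<noteq> 0" using assms(3) by (auto simp: vec_eq_iff)
  have lower: "- of_int (val (z $ i)) - c \<le> t" if "t \<in> A" for t
    using c[of t "{z}"] that i by (auto simp: A_def Bv_def vge_def)
  then have bdd: "bdd_below A" by (rule bdd_belowI)
  have "A \<noteq> {}" using hh_exists[OF assms(1)] by (auto simp: A_def)
  have "H.hh q D (Inf A) {z}"
  proof (rule H.hh_closed[OF assms(1,2)])
    fix t assume "Inf A < t"
    then obtain t' where "t' \<in> A" "t' < t" using cInf_less_iff[OF \<open>A \<noteq> {}\<close> bdd] by blast
    then show "H.hh q D t {z}" unfolding A_def by (auto elim: H.hh_mono)
  qed
  then have "H.hh q D t {z} \<longleftrightarrow> Inf A \<le> t" for t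
    using cInf_lower[OF _ bdd, of t] H.hh_mono by (auto simp: A_def)
  then show ?thesis by blast
qed

text \<open>The exact canonical height \<open>\<tau>\<close> is a norm compatible with the valuation and is multiplied by \<open>q\<close>
  under \<open>\<Phi>\<close>. In a linear relation between \<open>z, \<Phi> z, \<dots>, \<Phi>\<^sup>n z\<close> the maximal norm occurs twice, so that
  \<open>(q\<^sup>j - q\<^sup>i) \<tau>\<close> is an integer for some \<open>i < j\<close>.\<close>
lemma hh_integral:
  fixes z :: "'c ratfun ^ 'n"
  assumes q: "q \<ge> 2" and D: "invertible D" and "z \<noteq> 0"
  shows "\<exists>m::int. \<forall>t. H.hh q D t {z} \<longleftrightarrow> of_int m \<le> real (gap_prod q CARD('n)) * t"
proof -
  have q0: "q > 0" using q by simp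
  define n where "n = CARD('n)"
  define w where "w i = (semilin D (sub q) ^^ i) z" for i
  have w0: "w i \<noteq> 0" for i
    unfolding w_def by (induction i) (use assms q0 in \<open>simp_all add: semilin_eq_0_iff sub_hom\<close>)
  obtain \<tau> where \<tau>: "\<And>t. H.hh q D t {z} \<longleftrightarrow> \<tau> \<le> t" using hh_exact[OF assms] by blast
  have \<tau>w: "H.hh q D t {w i} \<longleftrightarrow> real q ^ i * \<tau> \<le> t" for t i
    using H.hh_semilin_iter[OF q0 D, of i "t / real q ^ i" z] \<tau>[of "t / real q ^ i"] q0
    by (simp add: w_def field_simps)
  obtain a where a: "\<exists>i\<in>{..n}. a i \<noteq> 0" "(\<Sum>i\<in>{..n}. a i *s w i) = 0"
    using vec_dependent_family[of "{..n}" w] by (auto simp: n_def)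
  define J where "J = {i\<in>{..n}. a i \<noteq> 0}"
  define T where "T i = real q ^ i * \<tau> - of_int (val (a i))" for i
  have T: "H.hh q D t {a i *s w i} \<longleftrightarrow> T i \<le> t" if "i \<in> J" for t i
    using that hh_scale[OF q0, of "a i" D t "w i"] \<tau>w by (auto simp: J_def T_def)
  have J: "finite J" "J \<noteq> {}" using a(1) by (auto simp: J_def)
  then have "Max (T ` J) \<in> T ` J" by simp
  then obtain i where i: "i \<in> J" "T i = Max (T ` J)" by auto
  then have max: "T j \<le> T i" if "j \<in> J" for j using J that by simp
  have "(\<Sum>i\<in>J. a i *s w i) = 0"
    unfolding a(2)[symmetric] by (rule sum.mono_neutral_left) (auto simp: J_def)
  then have sum0: "a i *s w i = (\<Sum>j\<in>J - {i}. - (a j *s w j))"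
    using i(1) J(1) by (simp add: sum.remove[of J i] sum_negf add_eq_0_iff2)
  have "\<exists>j\<in>J. j \<noteq> i \<and> T j = T i"
  proof (rule ccontr)
    assume "\<not> ?thesis"
    then have lt: "T j < T i" if "j \<in> J - {i}" for j using that max[of j] by (metis Diff_iff insertI1 order_le_imp_less_or_eq)
    \<comment> \<open>If \<open>i\<close> is the only index, any value below \<open>T i\<close>
      serves, the remaining sum being empty.\<close>
    define t where "t = (if J = {i} then T i - 1 else Max (T ` (J - {i})))"
    have "t < T i"
    proof (cases "J = {i}")
      case False
      then have "J - {i} \<noteq> {}" using i(1) by blast
      then show ?thesis using False lt J(1) by (simp add: t_def)
    qed (simp add: t_def)
    have "H.hh q D t {- (a j *s w j)}" if "j \<in> J - {i}" for j
    proof -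
      have "T j \<le> t" using that J(1) by (auto simp: t_def)
      then have "H.hh q D t {a j *s w j}" using T that by blast
      then have "H.hh q D t {(- 1) *s (a j *s w j)}" by (subst hh_scale) (use q0 in auto)
      then show ?thesis by simp
    qed
    then have "H.hh q D t {a i *s w i}" unfolding sum0 by (rule hh_sum[OF q0])
    then have "T i \<le> t" using T i(1) by blast
    then show False using \<open>t < T i\<close> by simp
  qed
  then obtain j where j: "j \<in> J" "j \<noteq> i" "T j = T i" by blast
  have *: "\<exists>m::int. real (gap_prod q n) * \<tau> = of_int m"
    if ij: "i < j" "i \<in> J" "j \<in> J" "T i = T j" for i j
  proof -
    have le: "q ^ i \<le> q ^ j" using ij(1) q0 by (simp add: power_increasing)
    have eq: "real (q ^ j - q ^ i) * \<tau> = of_int (val (a j) - val (a i))"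
      using ij(4) le by (simp add: T_def of_nat_diff left_diff_distrib)
    obtain k where "gap_prod q n = (q ^ j - q ^ i) * k" using gap_dvd[OF ij(1), of n q] ij(3) by (auto simp: J_def)
    then have "real (gap_prod q n) * \<tau> = real k * (real (q ^ j - q ^ i) * \<tau>)" by simp
    also have "\<dots> = of_int (int k * (val (a j) - val (a i)))" unfolding eq by simp
    finally show ?thesis by blast
  qed
  have "\<exists>m::int. real (gap_prod q n) * \<tau> = of_int m"
    using *[of i j] *[of j i] i(1) j by (cases "i < j") auto
  then obtain m :: int where m: "real (gap_prod q n) * \<tau> = of_int m" by blast
  have "\<tau> \<le> t \<longleftrightarrow> of_int m \<le> real (gap_prod q n) * t" for t
    using gap_prod_pos[OF q, of n] by (simp add: m[symmetric])
  then show ?thesis using \<tau> by (auto simp: n_def)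
qed

end

text \<open>Poles at \<open>0\<close> are disregarded.\<close>
definition Bn :: "real \<Rightarrow> ('c::field ratfun ^ 'n) set \<Rightarrow> bool"
  where "Bn t Z \<longleftrightarrow> (\<exists>d. d \<noteq> 0 \<and> real (degree d) \<le> t \<and> (\<forall>z\<in>Z. \<forall>i. to_fract d * z $ i \<in> Lau))"

lemma Lau_k_var_power_iff: "k_var ^ m * f \<in> Lau \<longleftrightarrow> f \<in> Lau"
  using Lau_divide_k_var[of "k_var ^ m * f" m] by simp

text \<open>The norm e of a denominator d has the same degree, and e(x^r), of degree r deg d, is a
  denominator of every section term; hence \<open>kap r = r\<close>. Undoing x -> x^s uses a nonzero
  section of the denominator, whose degree is smaller by the factor s. Powers of x are units among
  Laurent polynomials, hence the shift 0.\<close>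

lemma mahler_height_Bn:
  "mahler_height (Bn :: real \<Rightarrow> ('c::{alg_closed_field,field_char_0} ratfun ^ 'n) set \<Rightarrow> bool) real 0"
proof
  fix s :: nat and t and Z :: "('c ratfun ^ 'n) set"
  assume s: "s > 0"
  show "Bn (real s * t) (vmap (sub s) ` Z) \<longleftrightarrow> Bn t Z"
  proof
    assume "Bn t Z"
    then obtain d where d: "d \<noteq> 0" "real (degree d) \<le> t" "\<forall>z\<in>Z. \<forall>i. to_fract d * z $ i \<in> Lau"
      unfolding Bn_def by blast
    have "sub s (to_fract d * z $ i) \<in> Lau" if "z \<in> Z" for z i using d(3) that s by (intro Lau_sub) auto
    moreover have "pcompose d (pvar s) \<noteq> 0" using d(1) s sub_eq_0_iff[OF s, of "to_fract d"] by (simp add: sub_to_fract)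
    moreover have "real (degree (pcompose d (pvar s))) \<le> real s * t"
      using d(2) s by (simp add: degree_pcompose degree_monom_eq mult.commute mult_left_mono)
    ultimately show "Bn (real s * t) (vmap (sub s) ` Z)" unfolding Bn_def using s
      by (intro exI[of _ "pcompose d (pvar s)"]) (auto simp: field_hom_simps sub_hom sub_to_fract)
  next
    assume "Bn (real s * t) (vmap (sub s) ` Z)"
    then obtain d where d: "d \<noteq> 0" "real (degree d) \<le> real s * t"
      "\<And>z i. z \<in> Z \<Longrightarrow> to_fract d * sub s (z $ i) \<in> Lau" unfolding Bn_def by auto
    obtain g where g: "to_fract d = (\<Sum>a<s. k_var ^ a * sub s (to_fract (g a)))"
      "\<And>a. a < s \<Longrightarrow> s * degree (g a) \<le> degree d" "\<exists>a<s. g a \<noteq> 0" using poly_section[OF s, of d] d(1) by blast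
    then obtain a where a: "a < s" "g a \<noteq> 0" by blast
    have "to_fract (g a) * z $ i \<in> Lau" if "z \<in> Z" for z i
    proof -
      have "(\<Sum>a<s. k_var ^ (a * 1) * sub s (to_fract (g a) * z $ i)) = to_fract d * sub s (z $ i)"
        using s by (simp add: g(1) sum_distrib_right field_hom_simps sub_hom mult.assoc)
      then show ?thesis using Lau_section[OF s, of 1 "\<lambda>a. to_fract (g a) * z $ i" a] d(3)[OF that] a(1) by simp
    qed
    moreover have "real (degree (g a)) \<le> t"
    proof -
      have "real s * real (degree (g a)) \<le> real s * t"
        using g(2)[OF a(1)] d(2) by (metis of_nat_mono of_nat_mult order_trans)
      then show ?thesis using s by simp
    qed
    ultimately show "Bn t Z" unfolding Bn_def using a(2) by blast
  qed
next
  fix G :: "'c ratfun ^ 'n ^ 'n"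
  have "finite (range (\<lambda>(i, j). G $ i $ j))" by simp
  from common_denominator[OF this] obtain g where g: "g \<noteq> 0" "\<And>i j. to_fract g * G $ i $ j \<in> Pol" by auto
  have "Bn (t + real s * real (degree g)) ((*v) (lv s G) ` Z)" if s: "s > 0" and B: "Bn t Z" for s t Z
  proof -
    obtain d where d: "d \<noteq> 0" "real (degree d) \<le> t" "\<And>z i. z \<in> Z \<Longrightarrow> to_fract d * z $ i \<in> Lau"
      using B unfolding Bn_def by blast
    have gs: "to_fract (pcompose g (pvar s)) = sub s (to_fract g)" using s by (simp add: sub_to_fract)
    have nz: "pcompose g (pvar s) \<noteq> 0" using g(1) s sub_eq_0_iff[OF s, of "to_fract g"] by (simp add: sub_to_fract)
    have "to_fract (d * pcompose g (pvar s)) * (lv s G *v z) $ i \<in> Lau" if "z \<in> Z" for z i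
    proof -
      have "to_fract (d * pcompose g (pvar s)) * (lv s G *v z) $ i
          = (\<Sum>j\<in>UNIV. sub s (to_fract g * G $ i $ j) * (to_fract d * z $ j))"
        using s by (simp add: gs matrix_vector_mult_def sum_distrib_left field_hom_simps sub_hom ac_simps)
      also have "\<dots> \<in> Lau" using d(3)[OF that] Pol_Lau[OF g(2)] s
        by (intro Lau_sum Lau_mult[OF Lau_sub]) auto
      finally show ?thesis .
    qed
    moreover have "real (degree (d * pcompose g (pvar s))) \<le> t + real s * real (degree g)"
      using d(1,2) nz s by (simp add: degree_mult_eq degree_pcompose degree_monom_eq mult.commute)
    ultimately show ?thesis unfolding Bn_def using d(1) nz
      by (intro exI[of _ "d * pcompose g (pvar s)"]) auto
  qed
  then show "\<exists>c\<ge>0. \<forall>s>0. \<forall>t Z. Bn t Z \<longrightarrow> Bn (t + real s * c) ((*v) (lv s G) ` Z)"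
    by (intro exI[of _ "real (degree g)"]) auto
next
  fix r u a t and g :: "nat \<Rightarrow> 'c ratfun ^ 'n"
  assume r: "r > 0" "coprime u r" "a < r" and "Bn t {\<Sum>a<r. k_var ^ (a * u) *s vmap (sub r) (g a)}"
  then obtain d where d: "d \<noteq> 0" "real (degree d) \<le> t"
    "\<And>i. to_fract d * (\<Sum>a<r. k_var ^ (a * u) * sub r (g a $ i)) \<in> Lau" unfolding Bn_def by auto
  obtain e d' where e: "e \<noteq> 0" "degree e = degree d" "d * d' = pcompose e (pvar r)"
    using norm_exists[OF d(1) r(1)] by blast
  have de: "to_fract d' * to_fract d = sub r (to_fract e)"
    using e(3) r(1) by (simp add: sub_to_fract mult.commute flip: to_fract_mult)
  have "sub r (to_fract e * g a $ i) \<in> Lau" for i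
  proof -
    have "to_fract d' * (to_fract d * (\<Sum>a<r. k_var ^ (a * u) * sub r (g a $ i))) \<in> Lau"
      using d(3) by (subst Lau_mult[OF Pol_Lau[OF Pol_closed(1)]]) auto
    moreover have "to_fract d' * (to_fract d * (\<Sum>a<r. k_var ^ (a * u) * sub r (g a $ i)))
        = (\<Sum>a<r. k_var ^ (a * u) * sub r (to_fract e * g a $ i))"
      unfolding mult.assoc[symmetric] de using r(1)
      by (simp add: sum_distrib_left field_hom_simps sub_hom mult.left_commute)
    ultimately have "(\<Sum>a<r. k_var ^ (a * u) * sub r (to_fract e * g a $ i)) \<in> Lau" by simp
    then have "to_fract e * g a $ i \<in> Lau" by (rule Lau_section[OF r(1,2) _ r(3)])
    then show ?thesis by (rule Lau_sub[OF r(1)])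
  qed
  then have "to_fract (pcompose e (pvar r)) * (k_var ^ (a * u) * sub r (g a $ i)) \<in> Lau" for i
    using r(1) Lau_k_var_power_iff[of "a * u" "sub r (to_fract e * g a $ i)"]
    by (simp add: field_hom_simps sub_hom sub_to_fract ac_simps)
  moreover have "pcompose e (pvar r) \<noteq> 0" using e(1) r(1) sub_eq_0_iff[OF r(1), of "to_fract e"] by (simp add: sub_to_fract)
  moreover have "real (degree (pcompose e (pvar r))) \<le> real r * t"
    using d(2) e(2) r(1) by (simp add: degree_pcompose degree_monom_eq mult.commute mult_left_mono)
  ultimately show "Bn (real r * t) {k_var ^ (a * u) *s vmap (sub r) (g a)}" unfolding Bn_def by auto
next
  fix t a and z :: "'c ratfun ^ 'n"
  have "to_fract d * (k_var ^ a * z $ i) \<in> Lau \<longleftrightarrow> to_fract d * z $ i \<in> Lau" for d i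
    using Lau_k_var_power_iff[of a "to_fract d * z $ i"] by (simp add: ac_simps)
  then show "Bn t {k_var ^ a *s z} \<longleftrightarrow> Bn (t + 0 * real a) {z}" by (simp add: Bn_def)
qed (auto simp: Bn_def)

interpretation N: mahler_height
  "Bn :: real \<Rightarrow> ('c::{alg_closed_field,field_char_0} ratfun ^ 'n) set \<Rightarrow> bool" real 0
  by (rule mahler_height_Bn)

lemma Bn_Un:
  fixes Z :: "('c::field ratfun ^ 'n) set"
  assumes "Bn t Z" "Bn t' Z'" shows "Bn (t + t') (Z \<union> Z')"
proof -
  obtain d where d: "d \<noteq> 0" "real (degree d) \<le> t" "\<And>z i. z \<in> Z \<Longrightarrow> to_fract d * z $ i \<in> Lau"
    using assms(1) unfolding Bn_def by blast
  obtain d' where d': "d' \<noteq> 0" "real (degree d') \<le> t'" "\<And>z i. z \<in> Z' \<Longrightarrow> to_fract d' * z $ i \<in> Lau"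
    using assms(2) unfolding Bn_def by blast
  have "to_fract (d * d') * z $ i \<in> Lau" if "z \<in> Z \<union> Z'" for z i
  proof (cases "z \<in> Z")
    case True
    then have "to_fract d' * (to_fract d * z $ i) \<in> Lau" using d by (subst Lau_mult[OF Pol_Lau[OF Pol_closed(1)]]) auto
    then show ?thesis by (simp add: ac_simps)
  next
    case False
    then have "to_fract d * (to_fract d' * z $ i) \<in> Lau" using d' that by (subst Lau_mult[OF Pol_Lau[OF Pol_closed(1)]]) auto
    then show ?thesis by (simp add: ac_simps)
  qed
  then show ?thesis unfolding Bn_def using d d' by (intro exI[of _ "d * d'"]) (auto simp: degree_mult_eq)
qed

lemma hh_Un:
  assumes "N.hh q D t Z" "N.hh q D t' Z'" shows "N.hh q D (t + t') (Z \<union> Z')"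
proof -
  obtain c c' where c: "\<And>l. Bn (real q ^ l * t + c) ((semilin D (sub q) ^^ l) ` Z)"
    "\<And>l. Bn (real q ^ l * t' + c') ((semilin D (sub q) ^^ l) ` Z')"
    using assms unfolding N.hh_def by blast
  have "Bn (real q ^ l * (t + t') + (c + c')) ((semilin D (sub q) ^^ l) ` (Z \<union> Z'))" for l
    using Bn_Un[OF c(1)[of l] c(2)[of l]] by (simp add: image_Un algebra_simps)
  then show ?thesis unfolding N.hh_def by blast
qed

section \<open>The Mahler case\<close>

text \<open>Nonpositive canonical heights stay nonpositive along the orbit, so the poles at 0 and
  infinity are bounded uniformly in the iterate. Denominators are controlled only for finitely many
  iterates: \<epsilon> is so small that these share a denominator whose degree is bounded in
  advance.\<close>

lemma torsion_of_small_heights: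
  fixes D :: "'c::{alg_closed_field,field_char_0} ratfun ^ 'n ^ 'n"
  assumes q: "q \<ge> 2" and D: "invertible D"
  shows "\<exists>\<epsilon>>0. \<forall>p. mval0.H.hh q D 0 {p} \<longrightarrow> mvali.H.hh q D 0 {p} \<longrightarrow> N.hh q D \<epsilon> {p} \<longrightarrow>
    (\<exists>c m. (\<exists>i\<le>m. c i \<noteq> 0) \<and> (\<Sum>i\<le>m. k_const (c i) *s (semilin D (sub q) ^^ i) p) = 0)"
proof -
  have q0: "q > 0" using q by simp
  obtain c0 where c0: "\<And>t Z. mval0.H.hh q D t Z \<Longrightarrow> mval0.Bv (t + c0) Z" using mval0.H.hhD1[OF assms] by blast
  obtain ci where ci: "\<And>t Z. mvali.H.hh q D t Z \<Longrightarrow> mvali.Bv (t + ci) Z" using mvali.H.hhD1[OF assms] by blast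
  obtain cn where cn: "\<And>t Z. N.hh q D t Z \<Longrightarrow> Bn (t + cn) Z" using N.hhD1[OF assms] by blast
  define e0 where "e0 = nat \<lceil>c0\<rceil>"
  define ei where "ei = nat \<lceil>ci\<rceil>"
  define en where "en = nat \<lceil>1 + cn\<rceil>"
  have e: "c0 \<le> real e0" "ci \<le> real ei" "1 + cn \<le> real en"
    unfolding e0_def ei_def en_def by (rule real_nat_ceiling_ge)+
  \<comment> \<open>\<open>m\<close> bounds the dimension of the space that will contain the
    iterates of index 0 to \<open>m\<close>, and (m + 1) q^m \<epsilon> = 1 makes their joint
    canonical denominator height at most 1.\<close>
  define m where "m = CARD('n) * (e0 + (en + ei) + 1)"
  define \<epsilon> where "\<epsilon> = 1 / (real (m + 1) * real q ^ m)"
  have "\<epsilon> > 0" using q0 by (simp add: \<epsilon>_def)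
  have "\<exists>c m. (\<exists>i\<le>m. c i \<noteq> 0) \<and> (\<Sum>i\<le>m. k_const (c i) *s (semilin D (sub q) ^^ i) p) = 0"
    if h: "mval0.H.hh q D 0 {p}" "mvali.H.hh q D 0 {p}" "N.hh q D \<epsilon> {p}" for p
  proof -
    define w where "w i = (semilin D (sub q) ^^ i) p" for i
    have "mval0.H.hh q D 0 {w i}" for i
      using mval0.H.hh_semilin_iter[OF q0 D, of i 0 p] h(1) by (simp add: w_def)
    from c0[OF this] have "val0.vge (- (0 + c0)) (w i $ j)" for i j
      unfolding mval0.Bv_def by blast
    then have w0: "val0.vge (- real e0) (w i $ j)" for i j
      by (rule val0.vge_mono) (use e(1) in simp)
    have "mvali.H.hh q D 0 {w i}" for i
      using mvali.H.hh_semilin_iter[OF q0 D, of i 0 p] h(2) by (simp add: w_def)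
    from ci[OF this] have "vali.vge (- (0 + ci)) (w i $ j)" for i j
      unfolding mvali.Bv_def by blast
    then have wi: "vali.vge (- real ei) (w i $ j)" for i j
      by (rule vali.vge_mono) (use e(2) in simp)
    have "N.hh q D (real (k + 1) * (real q ^ m * \<epsilon>)) (w ` {..k})" if "k \<le> m" for k
      using that
    proof (induction k)
      case 0
      have "1 * \<epsilon> \<le> real q ^ m * \<epsilon>" using \<open>\<epsilon> > 0\<close> q0 by (intro mult_right_mono) auto
      then have "N.hh q D (real q ^ m * \<epsilon>) {p}" using N.hh_mono[OF h(3)] by simp
      then show ?case by (simp add: w_def atMost_0)
    next
      case (Suc k)
      have "N.hh q D (real q ^ Suc k * \<epsilon>) {w (Suc k)}"
        using N.hh_semilin_iter[OF q0 D, of "Suc k" \<epsilon> p] h(3) unfolding w_def by blast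
      moreover have "real q ^ Suc k * \<epsilon> \<le> real q ^ m * \<epsilon>"
        using \<open>\<epsilon> > 0\<close> q0 Suc.prems by (intro mult_right_mono power_increasing) auto
      ultimately have "N.hh q D (real q ^ m * \<epsilon>) {w (Suc k)}" by (rule N.hh_mono)
      from hh_Un[OF Suc.IH this] Suc.prems
      have "N.hh q D (real (k + 1) * (real q ^ m * \<epsilon>) + real q ^ m * \<epsilon>) (w ` {..k} \<union> {w (Suc k)})" by simp
      moreover have "w ` {..k} \<union> {w (Suc k)} = w ` {..Suc k}" by (auto simp: atMost_Suc)
      ultimately show ?case by (simp add: algebra_simps)
    qed
    from this[of m] have "N.hh q D 1 (w ` {..m})" using q0 by (simp add: \<epsilon>_def)
    from cn[OF this] obtain d where d: "d \<noteq> 0" "real (degree d) \<le> 1 + cn"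
      "\<And>i j. i \<le> m \<Longrightarrow> to_fract d * w i $ j \<in> Lau" unfolding Bn_def by auto
    have "degree d \<le> en" using d(2) e(3) by linarith
    have poly: "\<exists>P. k_var ^ e0 * to_fract d * w i $ j = to_fract P \<and> degree P \<le> e0 + (en + ei)" if "i \<in> {..m}" for i j
    proof -
      have "val0.vge (0 + - real e0) (to_fract d * w i $ j)"
        by (rule val0.vge_mult[OF _ w0]) (simp add: val0.vge_def d(1) val0.val_to_fract)
      moreover have "vali.vge (- real en + - real ei) (to_fract d * w i $ j)"
        by (rule vali.vge_mult[OF _ wi]) (simp add: vali.vge_def d(1) vali.val_to_fract \<open>degree d \<le> en\<close>)
      ultimately show ?thesis using Lau_bounded[OF d(3)[of i j], of e0 "en + ei"] that by (simp add: mult.assoc)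
    qed
    have "\<exists>c. (\<exists>i\<in>{..m}. c i \<noteq> 0) \<and> (\<Sum>i\<in>{..m}. k_const (c i) *s w i) = 0"
      by (rule fd_dependent[OF _ _ poly]) (use d(1) in \<open>auto simp: m_def\<close>)
    then show ?thesis by (auto simp: w_def)
  qed
  then show ?thesis using \<open>\<epsilon> > 0\<close> by blast
qed

lemma vec_section_exists:
  fixes f :: "'c::{alg_closed_field,field_char_0} ratfun ^ 'n"
  assumes "r > 0"
  shows "\<exists>p. f = (\<Sum>a<r. k_var ^ a *s vmap (sub r) (p a))"
proof -
  have "\<forall>i. \<exists>g. f $ i = (\<Sum>a<r. k_var ^ a * sub r (g a))" using section_exists[OF assms] by blast
  from choice[OF this] obtain g where "\<And>i. f $ i = (\<Sum>a<r. k_var ^ a * sub r (g i a))" by blast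
  then have "f = (\<Sum>a<r. k_var ^ a *s vmap (sub r) (\<chi> i. g i a))" by (simp add: vec_eq_iff)
  then show ?thesis by (rule exI[of _ "\<lambda>a. \<chi> i. g i a"])
qed

context mahler_pair
begin

text \<open>The functional \<open>y\<close> is there so that the resulting vectors span. Sections
  modulo a power N of \<open>q2\<close>, taken at the gauge equivalent level N, divide the sum of
  the heights at 0 and infinity by N, as the two shifts by a cancel. If \<open>y\<close> vanished on
  all sections, then \<open>y\<close> at x^N would vanish on a basis.\<close>

lemma small_vectors:
  fixes y :: "'c ratfun ^ 'n"
  assumes "\<epsilon> > 0" "y \<noteq> 0"
  shows "\<exists>p. (\<Sum>i\<in>UNIV. y $ i * p $ i) \<noteq> 0 \<and> N.hh q1 D1 \<epsilon> {p} \<and>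
    (\<exists>t t'. mval0.H.hh q1 D1 t {p} \<and> mvali.H.hh q1 D1 t' {p} \<and> t + t' < \<epsilon>)"
proof -
  define \<Phi> where "\<Phi> = semilin D1 (sub q1)"
  obtain c where c: "\<And>t Z. Bn t Z \<Longrightarrow> N.hh q1 D1 (t + c) Z" using N.hhI1[OF q(1), of D1] by blast
  obtain b where b: "2 * c / \<epsilon> < real q1 ^ b" using real_arch_pow[of "real q1"] q(1) by auto
  have cb: "c / real q1 ^ b \<le> \<epsilon> / 2" using b assms(1) by (simp add: field_simps)
  have "\<exists>g. g \<noteq> 0 \<and> N.hh q1 D1 (\<epsilon> / 2) {g *s axis i 1}" for i :: 'n
  proof -
    \<comment> \<open>The multiplier e comes from a norm: e at x^(q1^b) is a multiple of the
      denominator of the b-th iterate of the basis vector. So the b-th iterate of the product has no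
      denominator, and pulling back divides the constant \<open>c\<close> by q1^b.\<close>
    define v where "v = (\<Phi> ^^ b) (axis i 1)"
    have "finite (range (\<lambda>j. v $ j))" by simp
    from common_denominator[OF this] obtain d where d: "d \<noteq> 0" "\<And>j. to_fract d * v $ j \<in> Pol" by auto
    have qb: "q1 ^ b > 0" by simp
    obtain e d' where e: "e \<noteq> 0" "d * d' = pcompose e (pvar (q1 ^ b))" using norm_exists[OF d(1) qb] by blast
    have "sub (q1 ^ b) (to_fract e) = to_fract d' * to_fract d"
      using e(2) qb by (simp add: sub_to_fract mult.commute flip: to_fract_mult)
    then have "sub (q1 ^ b) (to_fract e) * v $ j \<in> Pol" for j
      using Pol_closed(7)[OF Pol_closed(1) d(2)] by (simp add: mult.assoc)
    then have "Bn 0 {(\<Phi> ^^ b) (to_fract e *s axis i 1)}"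
      unfolding Bn_def \<Phi>_def mval0.semilin_scale_iter[OF q_pos(1)]
      by (intro exI[of _ 1]) (auto simp: v_def \<Phi>_def intro: Pol_Lau)
    from c[OF this] have "N.hh q1 D1 (real q1 ^ b * (c / real q1 ^ b)) {(\<Phi> ^^ b) (to_fract e *s axis i 1)}" by simp
    then have "N.hh q1 D1 (c / real q1 ^ b) {to_fract e *s axis i 1}"
      using N.hh_semilin_iter[OF q_pos(1) D(1)] unfolding \<Phi>_def by blast
    from N.hh_mono[OF this cb] show ?thesis using e(1) by (intro exI[of _ "to_fract e"]) auto
  qed
  then obtain g where g: "\<And>i. g i \<noteq> 0" "\<And>i. N.hh q1 D1 (\<epsilon> / 2) {g i *s axis i 1}"
    using choice[of "\<lambda>i g. g \<noteq> 0 \<and> N.hh q1 D1 (\<epsilon> / 2) {g *s axis i 1}"] by blast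
  define f where "f i = g i *s axis i 1" for i
  have "\<forall>i. \<exists>t. mval0.H.hh q1 D1 t {f i}" using mval0.hh_exists[OF q(1)] by blast
  from choice[OF this] obtain t0 where t0: "\<And>i. mval0.H.hh q1 D1 (t0 i) {f i}" by blast
  have "\<forall>i. \<exists>t. mvali.H.hh q1 D1 t {f i}" using mvali.hh_exists[OF q(1)] by blast
  from choice[OF this] obtain ti where ti: "\<And>i. mvali.H.hh q1 D1 (ti i) {f i}" by blast
  define T0 where "T0 = Max (range t0)"
  define Ti where "Ti = Max (range ti)"
  have T0: "mval0.H.hh q1 D1 T0 {f i}" for i by (rule mval0.H.hh_mono[OF t0]) (simp add: T0_def)
  have Ti: "mvali.H.hh q1 D1 Ti {f i}" for i by (rule mvali.H.hh_mono[OF ti]) (simp add: Ti_def)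
  obtain j where j: "4 * (T0 + Ti) / \<epsilon> < real q2 ^ j" using real_arch_pow[of "real q2"] q(2) by auto
  define N where "N = q2 ^ j"
  have N0: "N > 0" by (simp add: N_def)
  have TN: "(T0 + Ti) / real N < \<epsilon> / 4" using j assms(1) N0 by (simp add: N_def field_simps)
  have primes: "\<And>r. prime r \<Longrightarrow> r dvd N \<Longrightarrow> r dvd q2" unfolding N_def using prime_dvd_power by blast
  obtain M where M: "gauge q1 M D1 (lv N D1)" using gauge_level[of 0 j] by (auto simp: N_def)
  then have invM: "invertible M" by (simp add: gauge_def)
  define f' where "f' i = matrix_inv M *v f i" for i
  have f: "f i = M *v f' i" for i using invM by (simp add: f'_def matrix_vector_mul_assoc matrix_inv_right)
  have "\<forall>i. \<exists>p. f' i = (\<Sum>a<N. k_var ^ a *s vmap (sub N) (p a))" using vec_section_exists[OF N0] by blast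
  from choice[OF this] obtain p where p: "\<And>i. f' i = (\<Sum>a<N. k_var ^ a *s vmap (sub N) (p i a))" by blast
  have "\<exists>i. \<exists>a<N. (\<Sum>l\<in>UNIV. y $ l * p i a $ l) \<noteq> 0"
  proof (rule ccontr)
    assume "\<not> ?thesis"
    then have 0: "(\<Sum>l\<in>UNIV. y $ l * p i a $ l) = 0" if "a < N" for i a using that by blast
    define w where "w = vmap (sub N) y"
    have w0: "(\<Sum>l\<in>UNIV. w $ l * f' i $ l) = 0" for i
    proof -
      have "(\<Sum>l\<in>UNIV. w $ l * f' i $ l) = (\<Sum>l\<in>UNIV. \<Sum>a<N. k_var ^ a * sub N (y $ l * p i a $ l))"
        using N0 by (simp add: p w_def sum_distrib_left field_hom_simps sub_hom mult.left_commute)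
      also have "\<dots> = (\<Sum>a<N. \<Sum>l\<in>UNIV. k_var ^ a * sub N (y $ l * p i a $ l))" by (rule sum.swap)
      also have "\<dots> = (\<Sum>a<N. k_var ^ a * sub N (\<Sum>l\<in>UNIV. y $ l * p i a $ l))"
        by (simp add: sum_distrib_left field_hom_sum[OF sub_hom[OF N0]])
      also have "\<dots> = 0" using N0 by (simp add: 0 field_hom_simps sub_hom)
      finally show ?thesis .
    qed
    have "f' i = g i *s column i (matrix_inv M)" for i
      unfolding f'_def f_def vector_scalar_commute
      by (simp add: vec_eq_iff matrix_vector_mult_def axis_def column_def if_distrib cong: if_cong)
    then have "(transpose (matrix_inv M) *v w) $ i = 0" for i
    proof -
      have "0 = g i * (\<Sum>l\<in>UNIV. w $ l * column i (matrix_inv M) $ l)"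
        using w0[of i] \<open>f' i = g i *s column i (matrix_inv M)\<close>
        by (simp add: sum_distrib_left mult.left_commute)
      then show ?thesis using g(1)[of i]
        by (simp add: matrix_vector_mult_def transpose_def column_def mult.commute)
    qed
    then have "transpose (matrix_inv M) *v w = 0" by (simp add: vec_eq_iff)
    moreover have "invertible (transpose (matrix_inv M))"
      using invertible_matrix_inv[OF invM] by (simp add: invertible_det_nz det_transpose)
    ultimately have "w = 0" by (simp only: invertible_mult_vec_eq_0)
    then show False using assms(2) N0 by (simp add: w_def vmap_eq_0_iff sub_hom)
  qed
  then obtain i a where ia: "a < N" "(\<Sum>l\<in>UNIV. y $ l * p i a $ l) \<noteq> 0" by blast
  have e4: "\<epsilon> / 4 > 0" using assms(1) by simp
  have "mval0.H.hh q1 (lv N D1) T0 {f' i}"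
    using mval0.H.hh_gauge_iff[OF M q_pos(1), of T0 "{f' i}"] T0 by (simp add: f)
  from mval0.H.hh_section[OF N0 primes mahler_pair_axioms e4 ia(1) this[unfolded p]]
  have "mval0.H.hh q1 D1 ((T0 + real a) / real N + \<epsilon> / 4) {p i a}" by simp
  moreover have "mvali.H.hh q1 (lv N D1) Ti {f' i}"
    using mvali.H.hh_gauge_iff[OF M q_pos(1), of Ti "{f' i}"] Ti by (simp add: f)
  from mvali.H.hh_section[OF N0 primes mahler_pair_axioms e4 ia(1) this[unfolded p]]
  have "mvali.H.hh q1 D1 ((Ti - real a) / real N + \<epsilon> / 4) {p i a}" by simp
  moreover have "((T0 + real a) / real N + \<epsilon> / 4) + ((Ti - real a) / real N + \<epsilon> / 4) < \<epsilon>"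
  proof -
    have "(T0 + real a) / real N + (Ti - real a) / real N = (T0 + Ti) / real N" by (simp add: add_divide_distrib diff_divide_distrib)
    then show ?thesis using TN assms(1) by linarith
  qed
  moreover have "N.hh q1 D1 \<epsilon> {p i a}"
  proof -
    have "N.hh q1 (lv N D1) (\<epsilon> / 2) {f' i}"
      using N.hh_gauge_iff[OF M q_pos(1), of "\<epsilon> / 2" "{f' i}"] g(2)[of i] f[of i] by (simp add: f_def)
    from N.hh_section[OF N0 primes mahler_pair_axioms e4 ia(1) this[unfolded p]]
    have "N.hh q1 D1 (\<epsilon> / 2 + \<epsilon> / 4) {p i a}" using N0 by simp
    then show ?thesis by (rule N.hh_mono) (use assms(1) in simp)
  qed
  ultimately show ?thesis using ia(2) by blast
qed

text \<open>\<open>S\<close> clears the denominators of the heights at 0 and infinity, so a sum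
  below 1 / S becomes a nonpositive integer after x -> x^S, and a power of x then balances the two.
  Choosing the vector for a nonzero section of \<open>y\<close> modulo \<open>S\<close> keeps
  \<open>y\<close> nonzero on the substituted vector.\<close>

lemma torsion_vectors:
  fixes y :: "'c ratfun ^ 'n"
  defines "S \<equiv> gap_prod q1 CARD('n)"
  assumes "y \<noteq> 0"
  shows "\<exists>p. (\<Sum>l\<in>UNIV. y $ l * p $ l) \<noteq> 0 \<and>
    (\<exists>c m. (\<exists>i\<le>m. c i \<noteq> 0) \<and> (\<Sum>i\<le>m. k_const (c i) *s (semilin (lv S D1) (sub q1) ^^ i) p) = 0)"
proof -
  have S: "S > 0" unfolding S_def by (rule gap_prod_pos[OF q(1)])
  obtain Y where Y: "y = (\<Sum>a<S. k_var ^ a *s vmap (sub S) (Y a))" using vec_section_exists[OF S] by blast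
  have "\<exists>a<S. Y a \<noteq> 0"
  proof (rule ccontr)
    assume "\<not> ?thesis"
    then have "y = 0" unfolding Y using S by (simp add: vmap_0 sub_hom)
    then show False using assms by simp
  qed
  then obtain a where a: "a < S" "Y a \<noteq> 0" by blast
  obtain \<epsilon>' where \<epsilon>': "\<epsilon>' > 0" and tors: "\<And>p. mval0.H.hh q1 (lv S D1) 0 {p} \<Longrightarrow> mvali.H.hh q1 (lv S D1) 0 {p} \<Longrightarrow>
    N.hh q1 (lv S D1) \<epsilon>' {p} \<Longrightarrow>
    \<exists>c m. (\<exists>i\<le>m. c i \<noteq> 0) \<and> (\<Sum>i\<le>m. k_const (c i) *s (semilin (lv S D1) (sub q1) ^^ i) p) = 0"
    using torsion_of_small_heights[OF q(1), of "lv S D1"] D(1) S by (auto simp: lv_simps)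
  \<comment> \<open>The bound 1 / S makes the integer \<open>m + m'\<close> nonpositive; the bound
    \<epsilon>' / S leaves a denominator height at most \<epsilon>' after the substitution.\<close>
  define \<epsilon> where "\<epsilon> = min 1 \<epsilon>' / real S"
  have "\<epsilon> > 0" using \<epsilon>' S by (simp add: \<epsilon>_def)
  from small_vectors[OF this a(2)] obtain p t t' where p: "(\<Sum>l\<in>UNIV. Y a $ l * p $ l) \<noteq> 0" "N.hh q1 D1 \<epsilon> {p}"
    "mval0.H.hh q1 D1 t {p}" "mvali.H.hh q1 D1 t' {p}" "t + t' < \<epsilon>" by blast
  have "p \<noteq> 0" using p(1) by auto
  obtain m :: int where m: "\<And>t. mval0.H.hh q1 D1 t {p} \<longleftrightarrow> of_int m \<le> real S * t"
    using mval0.hh_integral[OF q(1) D(1) \<open>p \<noteq> 0\<close>] unfolding S_def by blast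
  obtain m' :: int where m': "\<And>t. mvali.H.hh q1 D1 t {p} \<longleftrightarrow> of_int m' \<le> real S * t"
    using mvali.hh_integral[OF q(1) D(1) \<open>p \<noteq> 0\<close>] unfolding S_def by blast
  have "of_int m + of_int m' \<le> real S * (t + t')" using m m' p(3,4) by (simp add: distrib_left add_mono)
  also have "\<dots> < real S * \<epsilon>" using p(5) S by simp
  also have "\<dots> \<le> 1" using S by (simp add: \<epsilon>_def)
  finally have mm: "m + m' \<le> 0" by linarith
  define z where "z = vmap (sub S) p"
  have z0: "mval0.H.hh q1 (lv S D1) (of_int m) {z}"
    using mval0.H.hh_sub[OF q_pos(1) S, of D1 "of_int m / real S" "{p}"] m[of "of_int m / real S"] S by (simp add: z_def)
  have zi: "mvali.H.hh q1 (lv S D1) (of_int m') {z}"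
    using mvali.H.hh_sub[OF q_pos(1) S, of D1 "of_int m' / real S" "{p}"] m'[of "of_int m' / real S"] S by (simp add: z_def)
  have zn: "N.hh q1 (lv S D1) \<epsilon>' {z}"
  proof (rule N.hh_mono)
    show "N.hh q1 (lv S D1) (real S * \<epsilon>) {z}"
      using N.hh_sub[OF q_pos(1) S, of D1 \<epsilon> "{p}"] p(2) by (simp add: z_def)
  qed (use S in \<open>simp add: \<epsilon>_def\<close>)
  have "(\<Sum>l\<in>UNIV. y $ l * z $ l) = (\<Sum>b<S. k_var ^ b * sub S (\<Sum>l\<in>UNIV. Y b $ l * p $ l))"
  proof -
    have "(\<Sum>l\<in>UNIV. y $ l * z $ l) = (\<Sum>l\<in>UNIV. \<Sum>b<S. k_var ^ b * sub S (Y b $ l * p $ l))"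
      using S by (simp add: Y z_def sum_distrib_right field_hom_simps sub_hom mult.assoc)
    also have "\<dots> = (\<Sum>b<S. \<Sum>l\<in>UNIV. k_var ^ b * sub S (Y b $ l * p $ l))" by (rule sum.swap)
    finally show ?thesis by (simp add: sum_distrib_left field_hom_sum[OF sub_hom[OF S]])
  qed
  moreover have "(\<Sum>b<S. k_var ^ b * sub S (\<Sum>l\<in>UNIV. Y b $ l * p $ l)) \<noteq> 0"
  proof
    assume "(\<Sum>b<S. k_var ^ b * sub S (\<Sum>l\<in>UNIV. Y b $ l * p $ l)) = 0"
    also have "0 = (\<Sum>b<S. k_var ^ b * sub S 0)" using S by (simp add: field_hom_simps sub_hom)
    finally show False
      using section_unique[OF S _ a(1), of "\<lambda>b. \<Sum>l\<in>UNIV. Y b $ l * p $ l" "\<lambda>_. 0"] p(1) by blast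
  qed
  ultimately have yz: "(\<Sum>l\<in>UNIV. y $ l * z $ l) \<noteq> 0" by simp
  show ?thesis
  proof (cases "m \<ge> 0")
    case True
    define p' where "p' = k_var ^ nat m *s z"
    have "(\<Sum>l\<in>UNIV. y $ l * p' $ l) = k_var ^ nat m * (\<Sum>l\<in>UNIV. y $ l * z $ l)"
      by (simp add: p'_def sum_distrib_left mult.left_commute)
    then have "(\<Sum>l\<in>UNIV. y $ l * p' $ l) \<noteq> 0" using yz by simp
    moreover have "mval0.H.hh q1 (lv S D1) 0 {p'}" using z0 True by (simp add: p'_def mval0.H.hh_shift)
    moreover have "mvali.H.hh q1 (lv S D1) 0 {p'}"
      unfolding p'_def mvali.H.hh_shift[OF q_pos(1)] by (rule mvali.H.hh_mono[OF zi]) (use True mm in simp)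
    moreover have "N.hh q1 (lv S D1) \<epsilon>' {p'}" using zn by (simp add: p'_def N.hh_shift)
    ultimately show ?thesis using tors by blast
  next
    case False
    \<comment> \<open>\<open>hh_shift\<close> covers natural exponents, so for negative
      \<open>m\<close> the vector \<open>z\<close> is written as a shift of
      \<open>p'\<close>.\<close>
    define p' where "p' = inverse (k_var ^ nat (- m)) *s z"
    have z: "z = k_var ^ nat (- m) *s p'" by (simp add: p'_def vector_smult_assoc)
    have "(\<Sum>l\<in>UNIV. y $ l * z $ l) = k_var ^ nat (- m) * (\<Sum>l\<in>UNIV. y $ l * p' $ l)"
      by (simp add: z sum_distrib_left mult.left_commute)
    then have "(\<Sum>l\<in>UNIV. y $ l * p' $ l) \<noteq> 0" using yz by auto
    moreover have "mval0.H.hh q1 (lv S D1) 0 {p'}"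
      using z0 False unfolding z by (simp add: mval0.H.hh_shift)
    moreover have "mvali.H.hh q1 (lv S D1) 0 {p'}"
      using zi unfolding z mvali.H.hh_shift[OF q_pos(1)] by (rule mvali.H.hh_mono) (use False mm in simp)
    moreover have "N.hh q1 (lv S D1) \<epsilon>' {p'}" using zn unfolding z by (simp add: N.hh_shift)
    ultimately show ?thesis using tors by blast
  qed
qed

end

text \<open>If the valuation v of g were nonzero, the nonzero terms of an annihilating relation
  would have the distinct valuations q^i v and could not cancel.\<close>

lemma (in consistent_system) tors_sub_val0:
  assumes \<sigma>1: "\<sigma>1 = sub q" and q: "q \<ge> 2" and g: "scal.tors g" "g \<noteq> 0"
  shows "val0.val g = 0"
proof (rule ccontr)
  assume v: "val0.val g \<noteq> 0"
  obtain F where F: "F \<noteq> 0" "scal.op_T.act F g = 0" using g(1) unfolding scal.tors_def by blast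
  define h where "h i = k_const (coeff F i) * sub (q ^ i) g" for i
  have q0: "q > 0" using q by simp
  have sum0: "(\<Sum>i\<le>degree F. h i) = 0" using F(2) unfolding scal.op_T.act_def
    by (simp add: h_def \<sigma>1 sub_iter[OF q0])
  have hv: "val0.val (h i) = int (q ^ i) * val0.val g" if "h i \<noteq> 0" for i
    using that q0 g(2) val_sub(1)[of "q ^ i" g]
    by (auto simp: h_def val0.val_mult val0.val_const)
  have "val0.vge t (h (degree F))" for t
  proof (rule mval0.vge_sum_distinct[of "{..degree F}" h])
    fix i j assume "h i \<noteq> 0" "h j \<noteq> 0" "val0.val (h i) = val0.val (h j)"
    then have "int (q ^ i) = int (q ^ j)" using hv v by simp
    then show "i = j" using q by simp
  qed (simp_all add: sum0)
  moreover have "h (degree F) \<noteq> 0" using F(1) g(2) q0 by (simp add: h_def sub_eq_0_iff)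
  ultimately have "t \<le> real_of_int (val0.val (h (degree F)))" for t by (auto simp: val0.vge_def)
  from this[of "real_of_int (val0.val (h (degree F))) + 1"] show False by simp
qed

text \<open>A nonzero torsion scalar has neither zero nor pole at 0. Subtracting its value there
  gives a torsion scalar vanishing at 0, which must be 0.\<close>

lemma (in consistent_system) tors_sub_const:
  assumes \<sigma>1: "\<sigma>1 = sub q" and q: "q \<ge> 2" and f: "scal.tors f"
  shows "f \<in> range k_const"
proof (cases "f = 0")
  case True
  then have "f = k_const 0" by simp
  then show ?thesis by blast
next
  case False
  have q0: "q > 0" using q by simp
  obtain a b where ab: "a \<noteq> 0" "b \<noteq> 0" "f = to_fract a / to_fract b" using val0.nz_cases[OF False] by blast
  have "val0.val f = 0" by (rule tors_sub_val0[OF \<sigma>1 q f False])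
  then have ord: "order 0 a = order 0 b" using ab by (simp add: val0.val_quot)
  define n where "n = order 0 b"
  obtain a' where a': "a = [:- 0, 1:] ^ n * a'" "\<not> [:- 0, 1:] dvd a'"
    using order_decomp[OF ab(1), of 0] unfolding n_def ord by blast
  obtain b' where b': "b = [:- 0, 1:] ^ n * b'" "\<not> [:- 0, 1:] dvd b'"
    using order_decomp[OF ab(2), of 0] unfolding n_def by blast
  have nz: "poly a' 0 \<noteq> 0" "poly b' 0 \<noteq> 0" using a' b' by (auto simp: poly_eq_0_iff_dvd)
  then have b'0: "b' \<noteq> 0" by auto
  have f': "f = to_fract a' / to_fract b'"
    unfolding ab(3) a'(1) b'(1) by (simp add: to_fract_power)
  define c where "c = poly a' 0 / poly b' 0"
  have fc: "f - k_const c = to_fract (a' - smult c b') / to_fract b'"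
  proof -
    have "to_fract (smult c b') = k_const c * to_fract b'" by (simp add: to_fract_smult)
    then show ?thesis using b'0 by (simp add: f' field_simps)
  qed
  have "a' - smult c b' = 0"
  proof (rule ccontr)
    assume nz': "a' - smult c b' \<noteq> 0"
    have "poly (a' - smult c b') 0 = 0" using nz by (simp add: c_def)
    from iffD1[OF order_root this] nz' have "order 0 (a' - smult c b') \<noteq> 0" by blast
    moreover have "order 0 b' = 0" using nz by (simp add: order_0I)
    ultimately have "val0.val (f - k_const c) \<noteq> 0" "f - k_const c \<noteq> 0"
      using nz' b'0 unfolding fc by (simp_all add: val0.val_quot del: to_fract_diff)
    moreover have "scal.tors (k_const c)"
      by (rule scal.torsI[of "[:-1, 1:]"]) (simp_all add: scal.op_T.act_pCons)
    then have "scal.tors (f - k_const c)" by (rule scal.tors_diff[OF f])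
    ultimately show False using tors_sub_val0[OF \<sigma>1 q] by blast
  qed
  then have "f = k_const c" using fc by simp
  then show ?thesis by blast
qed

text \<open>A proper subspace would be annihilated by a nonzero functional. \<open>W\<close> is
  padded with zero columns to a square matrix whose transpose has trivial kernel.\<close>

lemma vec_span_eq_UNIV:
  fixes W :: "('f::field ^ 'n) set"
  assumes "finite W" "card W \<le> CARD('n)"
    and functional: "\<And>y. y \<noteq> 0 \<Longrightarrow> \<exists>w\<in>vec.span W. (\<Sum>i\<in>UNIV. y $ i * w $ i) \<noteq> 0"
  shows "vec.span W = UNIV"
proof -
  obtain h :: "'f ^ 'n \<Rightarrow> 'n" where h: "inj_on h W"
    using card_le_inj[OF assms(1) finite[of UNIV]] assms(2) by auto
  define A where "A = (\<chi> i j. (if j \<in> h ` W then inv_into W h j else 0) $ i)"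
  have col: "column j A = (if j \<in> h ` W then inv_into W h j else 0)" for j
    by (simp add: A_def column_def vec_eq_iff)
  have W: "w \<in> columns A" if "w \<in> W" for w
    using that h col[of "h w"] by (auto simp: columns_def eq_commute[of w])
  have ker: "\<forall>y. transpose A *v y = 0 \<longrightarrow> y = 0"
  proof (intro allI impI, rule ccontr)
    fix y assume y: "transpose A *v y = 0" "y \<noteq> 0"
    have 0: "(\<Sum>i\<in>UNIV. y $ i * w $ i) = 0" if "w \<in> W" for w
    proof -
      have "(transpose A *v y) $ h w = (\<Sum>i\<in>UNIV. y $ i * column (h w) A $ i)"
        by (simp add: matrix_vector_mult_def transpose_def column_def mult.commute)
      then show ?thesis using y(1) that h by (simp add: col)
    qed
    have "(\<Sum>i\<in>UNIV. y $ i * w $ i) = 0" if "w \<in> vec.span W" for w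
      using that
    proof (induction rule: vec.span_induct_alt)
      case (step c x z)
      then show ?case by (simp add: 0 distrib_left sum.distrib mult.left_commute[of _ c] flip: sum_distrib_left)
    qed simp
    then show False using functional[OF y(2)] by blast
  qed
  then have "invertible (transpose A)" by (simp add: invertible_left_inverse matrix_left_invertible_ker)
  then have "invertible A" by (simp add: invertible_det_nz det_transpose)
  then have "vec.span (columns A) = UNIV" by (simp add: matrix_right_invertible_span_columns[symmetric] invertible_right_inverse)
  moreover have "columns A \<subseteq> vec.span W"
    using inv_into_into[of _ h W] by (auto simp: columns_def col vec.span_zero vec.span_base)
  ultimately show ?thesis using vec.span_minimal[of "columns A" "vec.span W"] by auto
qed

text \<open>At level S all torsion vectors are taken. Their coordinates in a stable constant basis
  are torsion scalars, hence constant, and by \<open>torsion_vectors\<close> no nonzero functional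
  vanishes on all of them.\<close>

theorem (in mahler_pair) constant_form_2M:
  shows "\<exists>S>0. \<exists>P (A1 :: 'c^'n^'n) (A2 :: 'c^'n^'n). invertible P \<and> A1 ** A2 = A2 ** A1 \<and>
    lv S D1 ** lv q1 P = P ** map_matrix k_const A1 \<and> lv S D2 ** lv q2 P = P ** map_matrix k_const A2"
proof -
  define S where "S = gap_prod q1 CARD('n)"
  have S: "S > 0" unfolding S_def by (rule gap_prod_pos[OF q(1)])
  interpret L: mahler_pair q1 q2 "lv S D1" "lv S D2" by (rule level[OF S])
  interpret consistent_system "sub q1" "sub q2" "lv S D1" "lv S D2"
    by standard (use sub_spec(1)[OF q_pos(1)] sub_spec(1)[OF q_pos(2)] L.D L.cons in \<open>auto simp: sub_sub mult.commute\<close>)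
  define V where "V = {v. ops.tors v}"
  have V: "C.subspace V" "\<And>v. v \<in> V \<Longrightarrow> \<Phi>1 v \<in> V" "\<And>v. v \<in> V \<Longrightarrow> \<Phi>2 v \<in> V" "\<And>v. v \<in> V \<Longrightarrow> ops.tors v"
    using ops.subspace_tors ops.tors_S ops.tors_act[of _ "[:0, 1:]"]
    by (auto simp: V_def ops.op_T.act_pCons)
  have "\<exists>W. finite W \<and> vec.independent W \<and> C.span W = V"
  proof (rule maximal_constant_basis[OF V(1,2,4)])
    fix W v c
    assume W: "finite W" "W \<subseteq> V" "vec.independent W" "\<And>w. w \<in> W \<Longrightarrow> \<Phi>1 w \<in> C.span W"
      and v: "\<Phi>1 v - k_const c *s v \<in> C.span W" "v \<in> vec.span W"
    obtain f where f: "v = (\<Sum>w\<in>W. f w *s w)" using v(2) vec.span_finite[OF W(1)] by auto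
    have "f w *s w \<in> C.span W" if "w \<in> W" for w
    proof -
      have "scal.tors (f w)" by (rule coordinates_tors[OF W(1,3,4) f v(1) that])
      from tors_sub_const[OF refl q(1) this] obtain a where "f w = k_const a" by blast
      then show ?thesis using C.span_scale[OF C.span_base[OF that], of a] by simp
    qed
    then show "v \<in> C.span W" unfolding f by (rule C.span_sum)
  qed
  then obtain W where W: "finite W" "vec.independent W" "C.span W = V" by blast
  have sub: "V \<subseteq> vec.span W"
  proof
    fix v assume "v \<in> V"
    then obtain a where "v = (\<Sum>w\<in>W. k_const (a w) *s w)" using C.span_finite[OF W(1)] W(3) by auto
    then show "v \<in> vec.span W" by (auto intro: vec.span_sum vec.span_scale vec.span_base)
  qed
  have "vec.span W = UNIV"
  proof (rule vec_span_eq_UNIV[OF W(1)])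
    show "card W \<le> CARD('n)"
      using vec.independent_bound_general[OF W(2)] dim_subset_UNIV_cart_gen le_trans by blast
    fix y :: "'c ratfun ^ 'n" assume "y \<noteq> 0"
    then obtain p c m where p: "(\<Sum>l\<in>UNIV. y $ l * p $ l) \<noteq> 0" "\<exists>i\<le>m. c i \<noteq> 0"
      "(\<Sum>i\<le>m. k_const (c i) *s (\<Phi>1 ^^ i) p) = 0"
      using torsion_vectors[of y] unfolding S_def[symmetric] by blast
    define F where "F = (\<Sum>i\<le>m. monom (c i) i)"
    have coeffF: "coeff F i = (if i \<le> m then c i else 0)" for i by (simp add: F_def coeff_sum)
    then have "degree F \<le> m" by (intro degree_le) simp
    then have "ops.op_T.act F p = 0" using p(3) by (simp add: ops.op_T.act_eq_sum coeffF)
    moreover have "F \<noteq> 0" using p(2) coeffF coeff_0 by metis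
    ultimately have "p \<in> V" unfolding V_def using ops.torsI by blast
    then show "\<exists>w\<in>vec.span W. (\<Sum>l\<in>UNIV. y $ l * w $ l) \<noteq> 0" using sub p(1) by blast
  qed
  from constant_form[OF W(1,2) this] V(2,3) W(3) C.span_base show ?thesis using S by blast
qed

text \<open>The homomorphism f -> f(x^(1/S)) from k to K turns the system at level S back into the
  original one and commutes with the Mahler substitutions, so the basis found over k becomes one
  over K.\<close>

lemma constant_form_K:
  fixes B1 B2 :: "'c::{alg_closed_field,field_char_0} ratfun ^ 'n ^ 'n"
  assumes "case_2M \<sigma>1 \<sigma>2 \<tau>1 \<tau>2" "invertible B1" "invertible B2"
    and B: "map_matrix \<sigma>1 B2 ** B1 = map_matrix \<sigma>2 B1 ** B2"
  shows "\<exists>P (A1 :: 'c^'n^'n) (A2 :: 'c^'n^'n). invertible P \<and> A1 ** A2 = A2 ** A1 \<and>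
    matrix_inv (map_matrix k_to_K B1) ** map_matrix \<tau>1 P = P ** map_matrix K_const A1 \<and>
    matrix_inv (map_matrix k_to_K B2) ** map_matrix \<tau>2 P = P ** map_matrix K_const A2"
proof -
  obtain q1 q2 where q: "q1 \<ge> 2" "q2 \<ge> 2" "mult_independent (of_nat q1 :: rat) (of_nat q2)"
    and v: "\<sigma>1 k_var = k_var ^ q1" "\<sigma>2 k_var = k_var ^ q2"
    and \<tau>_pow: "\<And>a. \<tau>1 (K_pow a) = K_pow (of_nat q1 * a)" "\<And>a. \<tau>2 (K_pow a) = K_pow (of_nat q2 * a)"
    using assms(1) unfolding case_2M_def by blast
  have endo: "commuting_endos \<sigma>1 \<sigma>2" and \<tau>: "C_alg_hom K_const K_const \<tau>1" "C_alg_hom K_const K_const \<tau>2"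
    using assms(1) unfolding case_2M_def by blast+
  have \<sigma>: "\<sigma>1 = sub q1" "\<sigma>2 = sub q2"
    using endo v q unfolding commuting_endos_def by (auto intro: sub_unique)
  interpret cs: consistent_system \<sigma>1 \<sigma>2 "matrix_inv B1" "matrix_inv B2"
    by (rule consistent_system_matrix_inv[OF endo assms(2,3) B])
  interpret mahler_pair q1 q2 "matrix_inv B1" "matrix_inv B2"
  proof
    show "matrix_inv B1 ** lv q1 (matrix_inv B2) = matrix_inv B2 ** lv q2 (matrix_inv B1)"
      using cs.consistent unfolding \<sigma> .
    fix a b assume ab: "q1 ^ a = q2 ^ b"
    show "a = 0 \<and> b = 0"
    proof (cases "a = 0 \<or> b = 0")
      case True
      then have "q1 ^ a = 1 \<and> q2 ^ b = 1" by (metis ab power_0)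
      then show ?thesis using q by simp
    next
      case False
      have "(of_nat q2 :: rat) powi int b = of_nat q1 powi int a"
        using arg_cong[OF ab, of "of_nat :: nat \<Rightarrow> rat"] by simp
      then show ?thesis using q(3) False unfolding mult_independent_def by (metis of_nat_eq_0_iff)
    qed
  qed (use q cs.inv1 cs.inv2 in auto)
  obtain S P and A1 A2 :: "'c^'n^'n" where S: "S > 0" and P: "invertible P" "A1 ** A2 = A2 ** A1"
    "lv S (matrix_inv B1) ** lv q1 P = P ** map_matrix k_const A1"
    "lv S (matrix_inv B2) ** lv q2 P = P ** map_matrix k_const A2"
    using constant_form_2M by blast
  obtain \<tau> :: "'c fpfun \<Rightarrow> 'c fpfun" where t: "C_alg_hom K_const K_const \<tau>" "\<And>a. \<tau> (K_pow a) = K_pow (1 / of_nat S * a)"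
    using K_endo_exists[of "1 / of_nat S"] S by auto
  define \<epsilon> where "\<epsilon> = \<tau> \<circ> k_to_K"
  have \<epsilon>: "C_alg_hom k_const K_const \<epsilon>" unfolding \<epsilon>_def by (rule C_alg_hom_comp[OF k_to_K_hom t(1)])
  have \<epsilon>_hom: "field_hom \<epsilon>" and \<epsilon>_const: "\<And>c. \<epsilon> (k_const c) = K_const c" using \<epsilon> by (auto simp: C_alg_hom_def)
  have \<epsilon>_var: "\<epsilon> (k_var ^ m) = K_pow (of_nat m / of_nat S)" for m
    unfolding field_hom_simps(8)[OF \<epsilon>_hom] by (simp add: \<epsilon>_def k_to_K_var t(2) K_pow_power)
  have "\<epsilon> \<circ> sub S = k_to_K"
    by (rule C_alg_hom_k_unique[OF C_alg_hom_comp[OF sub_spec(1)[OF S] \<epsilon>] k_to_K_hom])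
      (use S in \<open>simp add: sub_spec(2) \<epsilon>_var k_to_K_var\<close>)
  then have \<epsilon>S: "map_matrix \<epsilon> (lv S A) = map_matrix k_to_K A" for A :: "'c ratfun ^ 'n ^ 'n"
    by (auto simp: map_matrix_comp vec_eq_iff fun_eq_iff)
  have \<epsilon>\<tau>: "map_matrix \<epsilon> (lv q P) = map_matrix \<tau>' (map_matrix \<epsilon> P)"
    if "q > 0" "C_alg_hom K_const K_const \<tau>'" "\<And>a. \<tau>' (K_pow a) = K_pow (of_nat q * a)" for q \<tau>'
  proof -
    have "\<tau>' \<circ> \<epsilon> = \<epsilon> \<circ> sub q"
      by (rule C_alg_hom_k_unique[OF C_alg_hom_comp[OF \<epsilon> that(2)] C_alg_hom_comp[OF sub_spec(1)[OF that(1)] \<epsilon>]])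
        (use \<epsilon>_var[of 1] that in \<open>simp add: sub_spec(2) \<epsilon>_var\<close>)
    then show ?thesis by (auto simp: map_matrix_comp vec_eq_iff fun_eq_iff)
  qed
  have inv: "matrix_inv (map_matrix k_to_K B) = map_matrix k_to_K (matrix_inv B)" if "invertible B"
    for B :: "'c ratfun ^ 'n ^ 'n"
  proof -
    have hom: "field_hom (k_to_K :: 'c ratfun \<Rightarrow> _)" using k_to_K_hom by (auto simp: C_alg_hom_def)
    have "map_matrix k_to_K B ** map_matrix k_to_K (matrix_inv B) = mat 1"
      unfolding map_matrix_mult[OF hom, symmetric] using that by (simp add: matrix_inv_right map_matrix_mat_1 hom)
    moreover have "map_matrix k_to_K (matrix_inv B) ** map_matrix k_to_K B = mat 1"
      unfolding map_matrix_mult[OF hom, symmetric] using that by (simp add: matrix_inv_left map_matrix_mat_1 hom)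
    ultimately show ?thesis by (rule matrix_inv_unique)
  qed
  have const: "map_matrix \<epsilon> (map_matrix k_const A) = map_matrix K_const A" for A :: "'c^'n^'n"
    by (simp add: map_matrix_comp \<epsilon>_const)
  have eq: "matrix_inv (map_matrix k_to_K B) ** map_matrix \<tau>' (map_matrix \<epsilon> P) = map_matrix \<epsilon> P ** map_matrix K_const A"
    if "invertible B" "lv S (matrix_inv B) ** lv q P = P ** map_matrix k_const A"
      "q > 0" "C_alg_hom K_const K_const \<tau>'" "\<And>a. \<tau>' (K_pow a) = K_pow (of_nat q * a)" for B A q \<tau>'
    using arg_cong[OF that(2), of "map_matrix \<epsilon>"]
    unfolding map_matrix_mult[OF \<epsilon>_hom] \<epsilon>S \<epsilon>\<tau>[OF that(3-5)] const inv[OF that(1)] .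
  show ?thesis
    using eq[OF assms(2) P(3) _ \<tau>(1) \<tau>_pow(1)] eq[OF assms(3) P(4) _ \<tau>(2) \<tau>_pow(2)] P(1,2)
      invertible_map_matrix[OF \<epsilon>_hom P(1)] q by (intro exI[of _ "map_matrix \<epsilon> P"] exI[of _ A1] exI[of _ A2]) auto
qed

theorem theorem13:
  fixes \<sigma>1 \<sigma>2 :: "('c::{alg_closed_field, field_char_0}) ratfun \<Rightarrow> 'c ratfun"
    and B1 B2 :: "'c ratfun ^ 'n ^ 'n"
  assumes "invertible B1" and "invertible B2"
    and "map_matrix \<sigma>1 B2 ** B1 = map_matrix \<sigma>2 B1 ** B2"
  shows "(case_2S \<sigma>1 \<sigma>2 \<or> case_2Q \<sigma>1 \<sigma>2 \<longrightarrow>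
           (\<exists>A1 A2 :: 'c ^ 'n ^ 'n. invertible A1 \<and> invertible A2 \<and> A2 ** A1 = A1 ** A2 \<and>
              gauge_equivalent \<sigma>1 \<sigma>2 B1 B2 (map_matrix k_const A1) (map_matrix k_const A2)))
       \<and> (\<forall>\<tau>1 \<tau>2. case_2M \<sigma>1 \<sigma>2 \<tau>1 \<tau>2 \<longrightarrow>
           (\<exists>A1 A2 :: 'c ^ 'n ^ 'n. invertible A1 \<and> invertible A2 \<and> A2 ** A1 = A1 ** A2 \<and>
              gauge_equivalent \<tau>1 \<tau>2 (map_matrix k_to_K B1) (map_matrix k_to_K B2)
                (map_matrix K_const A1) (map_matrix K_const A2)))"
proof (intro conjI impI allI)
  assume cases: "case_2S \<sigma>1 \<sigma>2 \<or> case_2Q \<sigma>1 \<sigma>2"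
  then have "commuting_endos \<sigma>1 \<sigma>2" by (auto simp: case_2S_def case_2Q_def)
  then have cs: "consistent_system \<sigma>1 \<sigma>2 (matrix_inv B1) (matrix_inv B2)"
    using assms by (intro consistent_system_matrix_inv)
  then interpret consistent_system \<sigma>1 \<sigma>2 "matrix_inv B1" "matrix_inv B2" .
  have "\<exists>P (A1 :: 'c^'n^'n) (A2 :: 'c^'n^'n). invertible P \<and> A1 ** A2 = A2 ** A1 \<and>
    matrix_inv B1 ** map_matrix \<sigma>1 P = P ** map_matrix k_const A1 \<and>
    matrix_inv B2 ** map_matrix \<sigma>2 P = P ** map_matrix k_const A2"
    using cases constant_form_2S[OF cs] constant_form_2Q[OF cs] by blast
  then show "\<exists>A1 A2 :: 'c ^ 'n ^ 'n. invertible A1 \<and> invertible A2 \<and> A2 ** A1 = A1 ** A2 \<and>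
      gauge_equivalent \<sigma>1 \<sigma>2 B1 B2 (map_matrix k_const A1) (map_matrix k_const A2)"
    using gauge_equivalent_constant[of k_const \<sigma>1 \<sigma>2 B1 B2] hom1 hom2 assms(1,2)
    by (auto simp: field_hom_def k_const_hom)
next
  fix \<tau>1 \<tau>2 assume M: "case_2M \<sigma>1 \<sigma>2 \<tau>1 \<tau>2"
  have hom: "field_hom \<tau>1" "field_hom \<tau>2" "field_hom (k_to_K :: 'c ratfun \<Rightarrow> _)" "field_hom (K_const :: 'c \<Rightarrow> _)"
    using M k_to_K_hom by (auto simp: case_2M_def C_alg_hom_def field_hom_def K_const_hom)
  then show "\<exists>A1 A2 :: 'c ^ 'n ^ 'n. invertible A1 \<and> invertible A2 \<and> A2 ** A1 = A1 ** A2 \<and>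
      gauge_equivalent \<tau>1 \<tau>2 (map_matrix k_to_K B1) (map_matrix k_to_K B2)
        (map_matrix K_const A1) (map_matrix K_const A2)"
    using constant_form_K[OF M assms]
      gauge_equivalent_constant[OF hom(4,1,2) invertible_map_matrix[OF hom(3) assms(1)] invertible_map_matrix[OF hom(3) assms(2)]]
    by blast
qed

end
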